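(* Let $(M_1,J,g_1)$ be an almost Hermitian manifold of dimension $2n$ ($n\ge 1$) with fundamental 2-form $\Phi_1$, carrying a 1-form $\omega$ with $d\omega=\Phi_1$. Let $\beta:I\to\mathbb{E}^m$ be an open curve with unit tangent vector field $T$, let $\alpha$ be a real constant, and let $M=M_1\times\beta(I)$. Equip $M$ with the structure $$\bar\phi(X_1,hT)=\bigl(JX_1,\,-\alpha\,\omega(JX_1)\,T\bigr),\qquad \bar\eta(X_1,hT)=\alpha\,\omega(X_1)+h,\qquad \bar\xi=(0,T),$$ $$g\bigl((X_1,h_1T),(Y_1,h_2T)\bigr)=g_1(X_1,Y_1)+\bar\eta(X_1,h_1T)\,\bar\eta(Y_1,h_2T).$$ Then $(M,\bar\phi,\bar\xi,\bar\eta,g)$ is a contact metric manifold if and only if $\alpha=1$.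
   Context: An open curve $\beta:I\to\mathbb{E}^m$ ($I$ an open interval) is a smooth curve in Euclidean space whose image $\beta(I)$ is a one-dimensional embedded manifold. Vector fields on $M=M_1\times\beta(I)$ are written $(X_1,hT)$ with $X_1\in\chi(M_1)$ and $h:I\to\mathbb{R}$ a function; tensor fields given on such fields are extended $C^\infty(M)$-linearly. An almost Hermitian manifold $(M_1,J,g_1)$ has $J^2=-\mathrm{id}$ and $g_1(JX,JY)=g_1(X,Y)$; its fundamental 2-form is $\Phi_1(X,Y)=g_1(X,JY)$. The exterior derivative of a 1-form is normalized by $2\,d\eta(X,Y)=X\eta(Y)-Y\eta(X)-\eta([X,Y])$. An almost contact metric manifold $(M,\phi,\xi,\eta,g)$ is an odd-dimensional manifold with a $(1,1)$-tensor field $\phi$, a vector field $\xi$, a 1-form $\eta$ and a metric $g$ satisfying $\phi^2X=-X+\eta(X)\xi$, $\eta(\xi)=1$ and $g(\phi X,\phi Y)=g(X,Y)-\eta(X)\eta(Y)$. It is a contact metric manifold if moreover $d\eta(X,Y)=g(X,\phi Y)$ for all $X,Y\in\chi(M)$. *)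

theory Defs
  imports "HOL-Analysis.Analysis"
begin

section \<open>Smooth maps between Euclidean spaces\<close>

(* Ck_on k f S is meant for open S: every iterated directional derivative of f of order at most k
   exists and is continuous on S. *)
primrec Ck_on :: "nat \<Rightarrow> ('e::euclidean_space \<Rightarrow> 'f::real_normed_vector) \<Rightarrow> 'e set \<Rightarrow> bool" where
  "Ck_on 0 f S \<longleftrightarrow> continuous_on S f"
| "Ck_on (Suc k) f S \<longleftrightarrow> (\<forall>x\<in>S. f differentiable (at x)) \<and>
     (\<forall>v. Ck_on k (\<lambda>x. frechet_derivative f (at x) v) S)"

definition smooth_on :: "'e::euclidean_space set \<Rightarrow> ('e \<Rightarrow> 'f::real_normed_vector) \<Rightarrow> bool" where
  "smooth_on S f \<longleftrightarrow> (\<forall>k. Ck_on k f S)"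

section \<open>Smooth manifolds\<close>

(* A manifold modelled on the Euclidean space 'e (so of dimension DIM('e)) is a topology on a
   carrier inside the type 'a with a (not necessarily maximal) smooth atlas.  A chart is a pair
   (U, c) of its domain and a map c of which only the values on U matter. *)
record ('a, 'e) mfd =
  mtop :: "'a topology"
  atlas :: "('a set \<times> ('a \<Rightarrow> 'e)) set"

abbreviation points :: "('a, 'e) mfd \<Rightarrow> 'a set" where
  "points M \<equiv> topspace (mtop M)"

definition smooth_manifold :: "('a, 'e::euclidean_space) mfd \<Rightarrow> bool" where
  "smooth_manifold M \<longleftrightarrow>
     points M \<noteq> {} \<and> Hausdorff_space (mtop M) \<and> second_countable (mtop M) \<and>
     (\<forall>(U, c)\<in>atlas M. openin (mtop M) U \<and> open (c ` U) \<and>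
        homeomorphic_map (subtopology (mtop M) U) (top_of_set (c ` U)) c) \<and>
     (\<Union>(U, c)\<in>atlas M. U) = points M \<and>
     (\<forall>(U, c)\<in>atlas M. \<forall>(V, d)\<in>atlas M. smooth_on (c ` (U \<inter> V)) (d \<circ> inv_into U c))"

(* smooth_fun M U f: the restriction of f to the open set U is a smooth function on U. *)
definition smooth_fun :: "('a, 'e::euclidean_space) mfd \<Rightarrow> 'a set \<Rightarrow> ('a \<Rightarrow> real) \<Rightarrow> bool" where
  "smooth_fun M U f \<longleftrightarrow> (\<forall>(V, c)\<in>atlas M. smooth_on (c ` (U \<inter> V)) (f \<circ> inv_into V c))"

definition smooth_at :: "('a, 'e::euclidean_space) mfd \<Rightarrow> 'a \<Rightarrow> ('a \<Rightarrow> real) \<Rightarrow> bool" where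
  "smooth_at M p f \<longleftrightarrow> (\<exists>U. openin (mtop M) U \<and> p \<in> U \<and> smooth_fun M U f)"

section \<open>Tangent vectors and tensor fields\<close>

type_synonym 'a tvec = "('a \<Rightarrow> real) \<Rightarrow> real"

abbreviation tzero :: "'a tvec" ("0\<^sub>t") where
  "0\<^sub>t \<equiv> (\<lambda>f. 0)"

abbreviation tadd :: "'a tvec \<Rightarrow> 'a tvec \<Rightarrow> 'a tvec" (infixl "+\<^sub>t" 65) where
  "u +\<^sub>t v \<equiv> (\<lambda>f. u f + v f)"

abbreviation tscale :: "real \<Rightarrow> 'a tvec \<Rightarrow> 'a tvec" (infixr "*\<^sub>t" 75) where
  "a *\<^sub>t v \<equiv> (\<lambda>f. a * v f)"

(* Tangent vectors at p are the derivations of the algebra of germs at p of smooth functions.  The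
   value 0 on functions that are not smooth near p is a convention which makes equality of tangent
   vectors the equality of HOL functions. *)
definition tangent_space :: "('a, 'e::euclidean_space) mfd \<Rightarrow> 'a \<Rightarrow> 'a tvec set" where
  "tangent_space M p = {v.
     (\<forall>f g. smooth_at M p f \<longrightarrow> smooth_at M p g \<longrightarrow> v (\<lambda>x. f x + g x) = v f + v g) \<and>
     (\<forall>a f. smooth_at M p f \<longrightarrow> v (\<lambda>x. a * f x) = a * v f) \<and>
     (\<forall>f g. smooth_at M p f \<longrightarrow> smooth_at M p g \<longrightarrow> v (\<lambda>x. f x * g x) = v f * g p + f p * v g) \<and>
     (\<forall>f g U. smooth_at M p f \<longrightarrow> openin (mtop M) U \<longrightarrow> p \<in> U \<longrightarrow> (\<forall>x\<in>U. f x = g x) \<longrightarrow> v f = v g) \<and>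
     (\<forall>f. \<not> smooth_at M p f \<longrightarrow> v f = 0)}"

definition smooth_vfield_on :: "('a, 'e::euclidean_space) mfd \<Rightarrow> 'a set \<Rightarrow> ('a \<Rightarrow> 'a tvec) \<Rightarrow> bool" where
  "smooth_vfield_on M U X \<longleftrightarrow> (\<forall>p\<in>U. X p \<in> tangent_space M p) \<and>
     (\<forall>V f. openin (mtop M) V \<longrightarrow> V \<subseteq> U \<longrightarrow> smooth_fun M V f \<longrightarrow> smooth_fun M V (\<lambda>p. X p f))"

definition vector_fields :: "('a, 'e::euclidean_space) mfd \<Rightarrow> ('a \<Rightarrow> 'a tvec) set" ("\<chi>") where
  "\<chi> M = {X. smooth_vfield_on M (points M) X}"

definition lie_bracket ::
    "('a, 'e::euclidean_space) mfd \<Rightarrow> ('a \<Rightarrow> 'a tvec) \<Rightarrow> ('a \<Rightarrow> 'a tvec) \<Rightarrow> 'a \<Rightarrow> 'a tvec" where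
  "lie_bracket M X Y p = (\<lambda>f. if smooth_at M p f
     then X p (\<lambda>q. Y q f) - Y p (\<lambda>q. X q f) else 0)"

(* Tensor fields are given pointwise, as (multi)linear maps on the tangent spaces; they are smooth
   when they produce smooth functions (fields) from vector fields smooth on an open set. *)
definition one_form :: "('a, 'e::euclidean_space) mfd \<Rightarrow> ('a \<Rightarrow> 'a tvec \<Rightarrow> real) \<Rightarrow> bool" where
  "one_form M \<omega> \<longleftrightarrow>
     (\<forall>p\<in>points M. \<forall>u\<in>tangent_space M p. \<forall>v\<in>tangent_space M p. \<forall>a.
        \<omega> p (u +\<^sub>t v) = \<omega> p u + \<omega> p v \<and> \<omega> p (a *\<^sub>t u) = a * \<omega> p u) \<and>
     (\<forall>U X. openin (mtop M) U \<longrightarrow> smooth_vfield_on M U X \<longrightarrow> smooth_fun M U (\<lambda>p. \<omega> p (X p)))"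

definition tensor_field_11 :: "('a, 'e::euclidean_space) mfd \<Rightarrow> ('a \<Rightarrow> 'a tvec \<Rightarrow> 'a tvec) \<Rightarrow> bool" where
  "tensor_field_11 M \<phi> \<longleftrightarrow>
     (\<forall>p\<in>points M. \<forall>u\<in>tangent_space M p. \<forall>v\<in>tangent_space M p. \<forall>a.
        \<phi> p u \<in> tangent_space M p \<and>
        \<phi> p (u +\<^sub>t v) = \<phi> p u +\<^sub>t \<phi> p v \<and> \<phi> p (a *\<^sub>t u) = a *\<^sub>t \<phi> p u) \<and>
     (\<forall>U X. openin (mtop M) U \<longrightarrow> smooth_vfield_on M U X \<longrightarrow> smooth_vfield_on M U (\<lambda>p. \<phi> p (X p)))"

definition riemannian_metric ::
    "('a, 'e::euclidean_space) mfd \<Rightarrow> ('a \<Rightarrow> 'a tvec \<Rightarrow> 'a tvec \<Rightarrow> real) \<Rightarrow> bool" where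
  "riemannian_metric M g \<longleftrightarrow>
     (\<forall>p\<in>points M. \<forall>u\<in>tangent_space M p. \<forall>v\<in>tangent_space M p. \<forall>w\<in>tangent_space M p. \<forall>a.
        g p (u +\<^sub>t v) w = g p u w + g p v w \<and> g p (a *\<^sub>t u) w = a * g p u w \<and>
        g p u v = g p v u \<and> (u \<noteq> 0\<^sub>t \<longrightarrow> g p u u > 0)) \<and>
     (\<forall>U X Y. openin (mtop M) U \<longrightarrow> smooth_vfield_on M U X \<longrightarrow> smooth_vfield_on M U Y \<longrightarrow>
        smooth_fun M U (\<lambda>p. g p (X p) (Y p)))"

(* Normalization: 2 d\<eta>(X, Y) = X \<eta>(Y) - Y \<eta>(X) - \<eta>([X, Y]). *)
definition ext_deriv :: "('a, 'e::euclidean_space) mfd \<Rightarrow> ('a \<Rightarrow> 'a tvec \<Rightarrow> real) \<Rightarrow>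
    ('a \<Rightarrow> 'a tvec) \<Rightarrow> ('a \<Rightarrow> 'a tvec) \<Rightarrow> 'a \<Rightarrow> real" where
  "ext_deriv M \<eta> X Y p =
     (X p (\<lambda>q. \<eta> q (Y q)) - Y p (\<lambda>q. \<eta> q (X q)) - \<eta> p (lie_bracket M X Y p)) / 2"

section \<open>Almost Hermitian and contact metric manifolds\<close>

definition almost_hermitian_manifold :: "('a, 'e::euclidean_space) mfd \<Rightarrow>
    ('a \<Rightarrow> 'a tvec \<Rightarrow> 'a tvec) \<Rightarrow> ('a \<Rightarrow> 'a tvec \<Rightarrow> 'a tvec \<Rightarrow> real) \<Rightarrow> bool" where
  "almost_hermitian_manifold M J g \<longleftrightarrow>
     smooth_manifold M \<and> tensor_field_11 M J \<and> riemannian_metric M g \<and>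
     (\<forall>p\<in>points M. \<forall>u\<in>tangent_space M p. J p (J p u) = (-1) *\<^sub>t u) \<and>
     (\<forall>p\<in>points M. \<forall>u\<in>tangent_space M p. \<forall>v\<in>tangent_space M p. g p (J p u) (J p v) = g p u v)"

definition fundamental_form :: "('a \<Rightarrow> 'a tvec \<Rightarrow> 'a tvec) \<Rightarrow> ('a \<Rightarrow> 'a tvec \<Rightarrow> 'a tvec \<Rightarrow> real) \<Rightarrow>
    'a \<Rightarrow> 'a tvec \<Rightarrow> 'a tvec \<Rightarrow> real" where
  "fundamental_form J g p u v = g p u (J p v)"

definition almost_contact_metric_manifold :: "('a, 'e::euclidean_space) mfd \<Rightarrow>
    ('a \<Rightarrow> 'a tvec \<Rightarrow> 'a tvec) \<Rightarrow> ('a \<Rightarrow> 'a tvec) \<Rightarrow> ('a \<Rightarrow> 'a tvec \<Rightarrow> real) \<Rightarrow>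
    ('a \<Rightarrow> 'a tvec \<Rightarrow> 'a tvec \<Rightarrow> real) \<Rightarrow> bool" where
  "almost_contact_metric_manifold M \<phi> \<xi> \<eta> g \<longleftrightarrow>
     smooth_manifold M \<and> odd DIM('e) \<and>
     tensor_field_11 M \<phi> \<and> \<xi> \<in> \<chi> M \<and> one_form M \<eta> \<and> riemannian_metric M g \<and>
     (\<forall>p\<in>points M. \<forall>u\<in>tangent_space M p. \<phi> p (\<phi> p u) = (-1) *\<^sub>t u +\<^sub>t \<eta> p u *\<^sub>t \<xi> p) \<and>
     (\<forall>p\<in>points M. \<eta> p (\<xi> p) = 1) \<and>
     (\<forall>p\<in>points M. \<forall>u\<in>tangent_space M p. \<forall>v\<in>tangent_space M p.
        g p (\<phi> p u) (\<phi> p v) = g p u v - \<eta> p u * \<eta> p v)"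

definition contact_metric_manifold :: "('a, 'e::euclidean_space) mfd \<Rightarrow>
    ('a \<Rightarrow> 'a tvec \<Rightarrow> 'a tvec) \<Rightarrow> ('a \<Rightarrow> 'a tvec) \<Rightarrow> ('a \<Rightarrow> 'a tvec \<Rightarrow> real) \<Rightarrow>
    ('a \<Rightarrow> 'a tvec \<Rightarrow> 'a tvec \<Rightarrow> real) \<Rightarrow> bool" where
  "contact_metric_manifold M \<phi> \<xi> \<eta> g \<longleftrightarrow>
     almost_contact_metric_manifold M \<phi> \<xi> \<eta> g \<and>
     (\<forall>X\<in>\<chi> M. \<forall>Y\<in>\<chi> M. \<forall>p\<in>points M. ext_deriv M \<eta> X Y p = g p (X p) (\<phi> p (Y p)))"

section \<open>Open curves\<close>

(* For a subset C of a Euclidean space: the inverses of regular local parametrizations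
   \<gamma> : V \<rightarrow> C of relatively open pieces of C, V open in the reals. *)
definition curve_charts :: "'m::euclidean_space set \<Rightarrow> ('m set \<times> ('m \<Rightarrow> real)) set" where
  "curve_charts C = {(\<gamma> ` V, inv_into V \<gamma>) | \<gamma> V.
     open V \<and> smooth_on V \<gamma> \<and> (\<forall>t\<in>V. vector_derivative \<gamma> (at t) \<noteq> 0) \<and>
     openin (top_of_set C) (\<gamma> ` V) \<and>
     homeomorphic_map (top_of_set V) (top_of_set (\<gamma> ` V)) \<gamma>}"

definition embedded_1_manifold :: "'m::euclidean_space set \<Rightarrow> bool" where
  "embedded_1_manifold C \<longleftrightarrow> (\<forall>q\<in>C. \<exists>(U, c)\<in>curve_charts C. q \<in> U)"

definition curve_mfd :: "'m::euclidean_space set \<Rightarrow> ('m, real) mfd" where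
  "curve_mfd C = \<lparr>mtop = top_of_set C, atlas = curve_charts C\<rparr>"

definition open_curve :: "real set \<Rightarrow> (real \<Rightarrow> 'm::euclidean_space) \<Rightarrow> bool" where
  "open_curve I \<beta> \<longleftrightarrow> open I \<and> is_interval I \<and> I \<noteq> {} \<and> smooth_on I \<beta> \<and> embedded_1_manifold (\<beta> ` I)"

(* The vector in the ambient space corresponding to a tangent vector of a submanifold, i.e. its
   image under the differential of the inclusion: its i-th coordinate is the derivative of the i-th
   coordinate function. *)
definition ambient_vector :: "'m::euclidean_space tvec \<Rightarrow> 'm" where
  "ambient_vector v = (\<Sum>b\<in>Basis. v (\<lambda>x. x \<bullet> b) *\<^sub>R b)"

definition unit_tangent_field :: "'m::euclidean_space set \<Rightarrow> ('m \<Rightarrow> 'm tvec) \<Rightarrow> bool" where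
  "unit_tangent_field C T \<longleftrightarrow> T \<in> \<chi> (curve_mfd C) \<and> (\<forall>q\<in>C. norm (ambient_vector (T q)) = 1)"

section \<open>Products\<close>

definition prod_mfd :: "('a, 'e) mfd \<Rightarrow> ('b, 'f) mfd \<Rightarrow> ('a \<times> 'b, 'e \<times> 'f) mfd" where
  "prod_mfd M N = \<lparr>mtop = prod_topology (mtop M) (mtop N),
     atlas = {(U \<times> V, map_prod c d) | U c V d. (U, c) \<in> atlas M \<and> (V, d) \<in> atlas N}\<rparr>"

definition differential ::
    "('b, 'f::euclidean_space) mfd \<Rightarrow> ('a \<Rightarrow> 'b) \<Rightarrow> 'a \<Rightarrow> 'a tvec \<Rightarrow> 'b tvec" where
  "differential N F p v = (\<lambda>f. if smooth_at N (F p) f then v (f \<circ> F) else 0)"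

(* The tangent vector (u, w) of M \<times> N at z, for u tangent to M at fst z and w tangent to N at
   snd z. *)
definition tpair :: "('a, 'e::euclidean_space) mfd \<Rightarrow> ('b, 'f::euclidean_space) mfd \<Rightarrow>
    'a \<times> 'b \<Rightarrow> 'a tvec \<Rightarrow> 'b tvec \<Rightarrow> ('a \<times> 'b) tvec" where
  "tpair M N z u w = (\<lambda>f. if smooth_at (prod_mfd M N) z f
     then u (\<lambda>x. f (x, snd z)) + w (\<lambda>y. f (fst z, y)) else 0)"

section \<open>The structure on the product with a curve\<close>

(* comp_M and comp_h extract X1 and h from a tangent vector v = (X1, h T) of M1 \<times> C. *)
definition comp_M :: "('a, 'e::euclidean_space) mfd \<Rightarrow> 'a \<times> 'm \<Rightarrow> ('a \<times> 'm) tvec \<Rightarrow> 'a tvec" where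
  "comp_M M1 z v = differential M1 fst z v"

definition comp_h :: "'m::euclidean_space set \<Rightarrow> ('m \<Rightarrow> 'm tvec) \<Rightarrow> 'a \<times> 'm \<Rightarrow>
    ('a \<times> 'm) tvec \<Rightarrow> real" where
  "comp_h C T z v = (THE h. differential (curve_mfd C) snd z v = h *\<^sub>t T (snd z))"

definition phi_bar :: "('a, 'e::euclidean_space) mfd \<Rightarrow> ('a \<Rightarrow> 'a tvec \<Rightarrow> 'a tvec) \<Rightarrow>
    ('a \<Rightarrow> 'a tvec \<Rightarrow> real) \<Rightarrow> 'm::euclidean_space set \<Rightarrow> ('m \<Rightarrow> 'm tvec) \<Rightarrow> real \<Rightarrow>
    'a \<times> 'm \<Rightarrow> ('a \<times> 'm) tvec \<Rightarrow> ('a \<times> 'm) tvec" where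
  "phi_bar M1 J \<omega> C T \<alpha> z v = (let p = fst z; X1 = comp_M M1 z v in
     tpair M1 (curve_mfd C) z (J p X1) ((- \<alpha> * \<omega> p (J p X1)) *\<^sub>t T (snd z)))"

definition eta_bar :: "('a, 'e::euclidean_space) mfd \<Rightarrow> ('a \<Rightarrow> 'a tvec \<Rightarrow> real) \<Rightarrow>
    'm::euclidean_space set \<Rightarrow> ('m \<Rightarrow> 'm tvec) \<Rightarrow> real \<Rightarrow> 'a \<times> 'm \<Rightarrow> ('a \<times> 'm) tvec \<Rightarrow> real" where
  "eta_bar M1 \<omega> C T \<alpha> z v = \<alpha> * \<omega> (fst z) (comp_M M1 z v) + comp_h C T z v"

definition xi_bar :: "('a, 'e::euclidean_space) mfd \<Rightarrow> 'm::euclidean_space set \<Rightarrow>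
    ('m \<Rightarrow> 'm tvec) \<Rightarrow> 'a \<times> 'm \<Rightarrow> ('a \<times> 'm) tvec" where
  "xi_bar M1 C T z = tpair M1 (curve_mfd C) z 0\<^sub>t (T (snd z))"

definition g_bar :: "('a, 'e::euclidean_space) mfd \<Rightarrow> ('a \<Rightarrow> 'a tvec \<Rightarrow> 'a tvec \<Rightarrow> real) \<Rightarrow>
    ('a \<Rightarrow> 'a tvec \<Rightarrow> real) \<Rightarrow> 'm::euclidean_space set \<Rightarrow> ('m \<Rightarrow> 'm tvec) \<Rightarrow> real \<Rightarrow>
    'a \<times> 'm \<Rightarrow> ('a \<times> 'm) tvec \<Rightarrow> ('a \<times> 'm) tvec \<Rightarrow> real" where
  "g_bar M1 g1 \<omega> C T \<alpha> z v w = g1 (fst z) (comp_M M1 z v) (comp_M M1 z w)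
     + eta_bar M1 \<omega> C T \<alpha> z v * eta_bar M1 \<omega> C T \<alpha> z w"

end

theory Submission
  imports Defs "HOL-Real_Asymp.Real_Asymp"
begin

text \<open>
  A tangent vector of \<open>M = M\<^sub>1 \<times> C\<close> is a pair \<open>(u, h T)\<close>, because a derivation is determined by its
  values on the coordinates (Hadamard's lemma) and \<open>T\<close> spans the tangent lines of the curve. The almost
  contact metric identities are then pointwise algebra and hold for every \<open>\<alpha>\<close>. As \<open>d\<eta>\<close> is tensorial,
  it can be evaluated on extensions \<open>(X\<^sub>1, a T)\<close>, \<open>(Y\<^sub>1, b T)\<close> with constant \<open>a\<close>, \<open>b\<close>, whose bracket is
  \<open>([X\<^sub>1, Y\<^sub>1], 0)\<close>; this gives \<open>d\<eta> = \<alpha> d\<omega> = \<alpha> \<Phi>\<^sub>1\<close>, whereas \<open>g(X, \<phi> Y) = \<Phi>\<^sub>1(X\<^sub>1, Y\<^sub>1)\<close>. Since \<open>\<Phi>\<^sub>1\<close> does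
  not vanish, the two agree exactly when \<open>\<alpha> = 1\<close>.
\<close>

section \<open>Calculus of smooth maps\<close>

text \<open>The algebra is short; the weight lies in the encoding. Tangent vectors are derivations
  of germs, so components and even \<open>v = (X1, h T)\<close> are reached only through
  coordinates. \<open>\<chi>\<close> contains global fields only: the hypothesis on
  \<open>d\<omega>\<close> says something about two given tangent vectors only after these are
  extended with a bump function, and Hausdorffness makes the support of the extension closed.
  Moreover, the component \<open>X1\<close> of a field on the product is not a field on
  \<open>M1\<close>, since it also varies along the curve; smoothness of \<open>\<omega>\<close>,
  \<open>J\<close> and \<open>g1\<close> has to be transferred by expansion in coordinate fields.
  The T-component of \<open>phi_bar\<close> is exactly the value that makes
  \<open>\<eta> (\<phi> v) = 0\<close>. This is why \<open>\<alpha>\<close> disappears from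
  \<open>g(X, \<phi> Y)\<close> and survives only as the factor in \<open>d\<eta>\<close>. Both
  exterior derivatives carry the same factor 1/2, so no other constant enters. The form is seen to
  be nonzero on a pair \<open>u\<close>, \<open>J u\<close>, where it equals
  \<open>- g1(u, u)\<close>.\<close>

lemma Ck_on_0D: "Ck_on k f S \<Longrightarrow> continuous_on S f"
  by (cases k) (auto intro!: continuous_at_imp_continuous_on differentiable_imp_continuous_within)

lemma Ck_on_SucD: "Ck_on (Suc k) f S \<Longrightarrow> Ck_on k f S"
proof (induction k arbitrary: f)
  case 0
  then show ?case
    by (auto intro!: continuous_at_imp_continuous_on differentiable_imp_continuous_within)
next
  case (Suc k)
  show ?case
    unfolding Ck_on.simps(2)[of k]
  proof (intro conjI allI)
    show "\<forall>x\<in>S. f differentiable at x"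
      using Suc.prems by simp
    fix v
    have "Ck_on (Suc k) (\<lambda>x. frechet_derivative f (at x) v) S"
      using Suc.prems by (subst (asm) Ck_on.simps(2)) blast
    then show "Ck_on k (\<lambda>x. frechet_derivative f (at x) v) S"
      by (rule Suc.IH)
  qed
qed

lemma Ck_on_subset: "Ck_on k f S \<Longrightarrow> S' \<subseteq> S \<Longrightarrow> Ck_on k f S'"
  by (induction k arbitrary: f) (auto intro: continuous_on_subset)

text \<open>\<open>frechet_derivative\<close> is a choice among the maps satisfying
  \<open>has_derivative\<close>. Functions that agree near \<open>x\<close> have the same such maps,
  hence the same choice, differentiable or not.\<close>

lemma frechet_derivative_cong_open:
  assumes "open S" "x \<in> S" "\<And>y. y \<in> S \<Longrightarrow> f y = g y"
  shows "frechet_derivative f (at x) = frechet_derivative g (at x)"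
proof -
  have "(f has_derivative D) (at x) \<longleftrightarrow> (g has_derivative D) (at x)" for D
    using assms by (auto elim!: has_derivative_transform_within_open)
  then show ?thesis
    by (simp add: frechet_derivative_def)
qed

lemma Ck_on_cong:
  assumes "open S" "\<And>x. x \<in> S \<Longrightarrow> f x = g x" "Ck_on k f S"
  shows "Ck_on k g S"
  using assms(2,3)
proof (induction k arbitrary: f g)
  case 0
  then show ?case by (auto cong: continuous_on_cong)
next
  case (Suc k)
  show ?case
    unfolding Ck_on.simps(2)
  proof (intro conjI allI ballI)
    show "g differentiable at x" if "x \<in> S" for x
      using Suc.prems that assms(1) unfolding differentiable_def Ck_on.simps(2)
      by (meson has_derivative_transform_within_open)
    show "Ck_on k (\<lambda>x. frechet_derivative g (at x) v) S" for v
    proof (rule Suc.IH)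
      show "Ck_on k (\<lambda>x. frechet_derivative f (at x) v) S"
        using Suc.prems(2) by simp
      show "frechet_derivative f (at x) v = frechet_derivative g (at x) v" if "x \<in> S" for x
        using frechet_derivative_cong_open[OF assms(1) that] Suc.prems(1) by metis
    qed
  qed
qed

text \<open>The derivative in the recursion is taken at \<open>x\<close> in the whole space and does
  not mention \<open>S\<close>, so nothing has to be glued.\<close>

lemma Ck_on_local:
  assumes "\<And>x. x \<in> S \<Longrightarrow> \<exists>U. open U \<and> x \<in> U \<and> Ck_on k f U"
  shows "Ck_on k f S"
  using assms
proof (induction k arbitrary: f)
  case 0
  show ?case unfolding Ck_on.simps(1)
    by (rule continuous_at_imp_continuous_on)
      (metis 0 Ck_on.simps(1) continuous_on_eq_continuous_at)
next
  case (Suc k)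
  show ?case
    unfolding Ck_on.simps(2)
  proof (intro conjI allI ballI)
    show "f differentiable at x" if "x \<in> S" for x
      using Suc.prems[OF that] by auto
    show "Ck_on k (\<lambda>x. frechet_derivative f (at x) v) S" for v
    proof (rule Suc.IH)
      fix x assume "x \<in> S"
      from Suc.prems[OF this] obtain U where "open U" "x \<in> U" "Ck_on (Suc k) f U"
        by blast
      then show "\<exists>U. open U \<and> x \<in> U \<and> Ck_on k (\<lambda>x. frechet_derivative f (at x) v) U"
        by (intro exI[of _ U]) simp
    qed
  qed
qed

text \<open>The tool for the inductions on \<open>k\<close> below: a derivative known in closed form
  replaces the chosen \<open>frechet_derivative\<close>, and its class can be read off the
  formula.\<close>

lemma Ck_on_SucI:
  assumes "open S" "\<And>x. x \<in> S \<Longrightarrow> (f has_derivative f' x) (at x)"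
    and "\<And>v. Ck_on k (\<lambda>x. f' x v) S"
  shows "Ck_on (Suc k) f S"
  unfolding Ck_on.simps(2)
proof (intro conjI allI ballI)
  show "f differentiable at x" if "x \<in> S" for x
    using assms(2)[OF that] by (auto simp: differentiable_def)
  show "Ck_on k (\<lambda>x. frechet_derivative f (at x) v) S" for v
    by (rule Ck_on_cong[OF assms(1) _ assms(3)[of v]])
      (simp add: frechet_derivative_at[OF assms(2), symmetric])
qed

lemma Ck_on_Suc_has_derivative:
  assumes "Ck_on (Suc k) f S" "x \<in> S"
  shows "(f has_derivative frechet_derivative f (at x)) (at x)"
  using assms by (auto simp: frechet_derivative_works[symmetric])

lemma Ck_on_Suc_derivative:
  "Ck_on (Suc k) f S \<Longrightarrow> Ck_on k (\<lambda>x. frechet_derivative f (at x) v) S"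
  by simp

lemma Ck_on_const: "open S \<Longrightarrow> Ck_on k (\<lambda>x. c) S"
proof (induction k arbitrary: c)
  case (Suc k)
  then show ?case by (intro Ck_on_SucI[where f' = "\<lambda>x v. 0"]) auto
qed simp

lemma Ck_on_linear_compose:
  assumes "bounded_linear L" "open S" "Ck_on k f S"
  shows "Ck_on k (\<lambda>x. L (f x)) S"
  using assms(3)
proof (induction k arbitrary: f)
  case 0
  then show ?case using bounded_linear.continuous_on[OF assms(1)] by auto
next
  case (Suc k)
  show ?case
    by (rule Ck_on_SucI[OF assms(2) bounded_linear.has_derivative[OF assms(1)
        Ck_on_Suc_has_derivative[OF Suc.prems]] Suc.IH[OF Ck_on_Suc_derivative[OF Suc.prems]]])
qed

lemma Ck_on_add:
  assumes "open S" "Ck_on k f S" "Ck_on k g S"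
  shows "Ck_on k (\<lambda>x. f x + g x) S"
  using assms(2,3)
proof (induction k arbitrary: f g)
  case 0
  then show ?case by (auto intro: continuous_on_add)
next
  case (Suc k)
  show ?case
    by (rule Ck_on_SucI[OF assms(1) has_derivative_add[OF
        Ck_on_Suc_has_derivative[OF Suc.prems(1)] Ck_on_Suc_has_derivative[OF Suc.prems(2)]]
        Suc.IH[OF Suc.prems[THEN Ck_on_Suc_derivative]]])
qed

lemma Ck_on_sum:
  assumes "open S" "\<And>i. i \<in> A \<Longrightarrow> Ck_on k (f i) S"
  shows "Ck_on k (\<lambda>x. \<Sum>i\<in>A. f i x) S"
proof (cases "finite A")
  case True
  then show ?thesis using assms(2)
    by induction (auto intro: Ck_on_const Ck_on_add assms(1))
qed (simp add: Ck_on_const assms(1))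

lemma Ck_on_bilinear:
  assumes "bounded_bilinear B" "open S" "Ck_on k f S" "Ck_on k g S"
  shows "Ck_on k (\<lambda>x. B (f x) (g x)) S"
  using assms(3,4)
proof (induction k arbitrary: f g)
  case 0
  then show ?case using bounded_bilinear.continuous_on[OF assms(1)] by auto
next
  case (Suc k)
  show ?case
  proof (rule Ck_on_SucI[OF assms(2) bounded_bilinear.FDERIV[OF assms(1)
        Ck_on_Suc_has_derivative[OF Suc.prems(1)] Ck_on_Suc_has_derivative[OF Suc.prems(2)]]])
    show "Ck_on k (\<lambda>x. B (f x) (frechet_derivative g (at x) v) +
        B (frechet_derivative f (at x) v) (g x)) S" for v
      by (rule Ck_on_add[OF assms(2) Suc.IH[OF Ck_on_SucD[OF Suc.prems(1)]
            Ck_on_Suc_derivative[OF Suc.prems(2)]]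
          Suc.IH[OF Ck_on_Suc_derivative[OF Suc.prems(1)] Ck_on_SucD[OF Suc.prems(2)]]])
  qed
qed

text \<open>\<open>Ck_on\<close> speaks of derivatives in fixed directions, whereas the chain rule
  produces the direction \<open>Df(x) v\<close>, which varies with \<open>x\<close>. Expanding it in
  the basis separates the two dependences; Hadamard's lemma uses the same expansion.\<close>

lemma linear_compose_sum_basis:
  fixes L :: "'e::euclidean_space \<Rightarrow> 'f::real_normed_vector"
  assumes "linear L"
  shows "L v = (\<Sum>b\<in>Basis. (v \<bullet> b) *\<^sub>R L b)"
proof -
  have "L v = L (\<Sum>b\<in>Basis. (v \<bullet> b) *\<^sub>R b)"
    by (simp add: euclidean_representation)
  then show ?thesis
    by (simp add: linear_sum[OF assms] linear_scale[OF assms])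
qed

lemma Ck_on_compose:
  fixes f :: "'e::euclidean_space \<Rightarrow> 'f::euclidean_space" and g :: "'f \<Rightarrow> 'g::real_normed_vector"
  assumes "open S" "open S'" "Ck_on k f S" "Ck_on k g S'" "f ` S \<subseteq> S'"
  shows "Ck_on k (\<lambda>x. g (f x)) S"
  using assms(3,4)
proof (induction k arbitrary: g)
  case 0
  then show ?case using assms(5) by (auto intro: continuous_on_compose2)
next
  case (Suc k)
  have g: "(g has_derivative frechet_derivative g (at (f x))) (at (f x))" if "x \<in> S" for x
    using that Ck_on_Suc_has_derivative[OF Suc.prems(2)] assms(5) by auto
  have f: "(f has_derivative frechet_derivative f (at x)) (at x)" if "x \<in> S" for x
    using that Ck_on_Suc_has_derivative[OF Suc.prems(1)] by auto
  have "frechet_derivative g (at (f x)) (frechet_derivative f (at x) v) =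
      (\<Sum>b\<in>Basis. (frechet_derivative f (at x) v \<bullet> b) *\<^sub>R frechet_derivative g (at (f x)) b)"
    if "x \<in> S" for x v
    using linear_compose_sum_basis[OF has_derivative_linear[OF g[OF that]]] .
  then have *: "((\<lambda>x. g (f x)) has_derivative (\<lambda>v. \<Sum>b\<in>Basis.
      (frechet_derivative f (at x) v \<bullet> b) *\<^sub>R frechet_derivative g (at (f x)) b)) (at x)"
    if "x \<in> S" for x
    using has_derivative_compose[OF f[OF that] g[OF that]] that by simp
  show ?case
  proof (rule Ck_on_SucI[OF assms(1) *])
    show "Ck_on k (\<lambda>x. \<Sum>b\<in>Basis. (frechet_derivative f (at x) v \<bullet> b) *\<^sub>R
        frechet_derivative g (at (f x)) b) S" for v
      by (intro Ck_on_sum assms(1) Ck_on_bilinear[OF bounded_bilinear_scaleR assms(1)]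
          Ck_on_linear_compose[OF bounded_linear_inner_left assms(1)
            Ck_on_Suc_derivative[OF Suc.prems(1)]]
          Suc.IH[OF Ck_on_SucD[OF Suc.prems(1)] Ck_on_Suc_derivative[OF Suc.prems(2)]])
  qed
qed

section \<open>Infinitely differentiable maps\<close>

lemma smooth_on_Ck: "smooth_on S f \<Longrightarrow> Ck_on k f S"
  by (simp add: smooth_on_def)

lemma smooth_on_subset: "smooth_on S f \<Longrightarrow> S' \<subseteq> S \<Longrightarrow> smooth_on S' f"
  unfolding smooth_on_def using Ck_on_subset by blast

lemma smooth_on_cong:
  "open S \<Longrightarrow> (\<And>x. x \<in> S \<Longrightarrow> f x = g x) \<Longrightarrow> smooth_on S f \<Longrightarrow> smooth_on S g"
  unfolding smooth_on_def using Ck_on_cong by blast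

lemma smooth_on_local:
  "(\<And>x. x \<in> S \<Longrightarrow> \<exists>U. open U \<and> x \<in> U \<and> smooth_on U f) \<Longrightarrow> smooth_on S f"
  unfolding smooth_on_def using Ck_on_local by meson

lemma smooth_on_differentiable: "smooth_on S f \<Longrightarrow> x \<in> S \<Longrightarrow> f differentiable at x"
  using smooth_on_Ck[of S f "Suc 0"] by auto

lemma smooth_on_has_derivative:
  "smooth_on S f \<Longrightarrow> x \<in> S \<Longrightarrow> (f has_derivative frechet_derivative f (at x)) (at x)"
  using smooth_on_differentiable frechet_derivative_works by blast

lemma smooth_on_derivative:
  "smooth_on S f \<Longrightarrow> smooth_on S (\<lambda>x. frechet_derivative f (at x) v)"
  unfolding smooth_on_def using Ck_on_Suc_derivative by blast

lemma smooth_on_continuous_on: "smooth_on S f \<Longrightarrow> continuous_on S f"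
  using smooth_on_Ck[of S f 0] by simp

lemma smooth_on_const: "open S \<Longrightarrow> smooth_on S (\<lambda>x. c)"
  by (simp add: smooth_on_def Ck_on_const)

lemma smooth_on_linear_compose:
  "bounded_linear L \<Longrightarrow> open S \<Longrightarrow> smooth_on S f \<Longrightarrow> smooth_on S (\<lambda>x. L (f x))"
  by (simp add: smooth_on_def Ck_on_linear_compose)

lemma smooth_on_id: "open S \<Longrightarrow> smooth_on S (\<lambda>x. x)"
  unfolding smooth_on_def
proof
  fix k assume "open S"
  then show "Ck_on k (\<lambda>x. x) S"
    by (cases k) (auto intro!: Ck_on_SucI[where f' = "\<lambda>x v. v"] Ck_on_const)
qed

lemma smooth_on_linear: "bounded_linear L \<Longrightarrow> open S \<Longrightarrow> smooth_on S L"
  using smooth_on_linear_compose[OF _ _ smooth_on_id] .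

lemma smooth_on_add:
  "open S \<Longrightarrow> smooth_on S f \<Longrightarrow> smooth_on S g \<Longrightarrow> smooth_on S (\<lambda>x. f x + g x)"
  by (simp add: smooth_on_def Ck_on_add)

lemma smooth_on_mult:
  fixes f g :: "'e::euclidean_space \<Rightarrow> real"
  shows "open S \<Longrightarrow> smooth_on S f \<Longrightarrow> smooth_on S g \<Longrightarrow> smooth_on S (\<lambda>x. f x * g x)"
  by (simp add: smooth_on_def Ck_on_bilinear[OF bounded_bilinear_mult])

lemma smooth_on_inner:
  "open S \<Longrightarrow> smooth_on S f \<Longrightarrow> smooth_on S g \<Longrightarrow> smooth_on S (\<lambda>x. f x \<bullet> g x)"
  by (simp add: smooth_on_def Ck_on_bilinear[OF bounded_bilinear_inner])

lemma smooth_on_compose: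
  fixes f :: "'e::euclidean_space \<Rightarrow> 'f::euclidean_space"
  shows "open S \<Longrightarrow> open S' \<Longrightarrow> smooth_on S f \<Longrightarrow> smooth_on S' g \<Longrightarrow> f ` S \<subseteq> S' \<Longrightarrow>
    smooth_on S (\<lambda>x. g (f x))"
  by (simp add: smooth_on_def Ck_on_compose)

lemma smooth_on_Pair:
  assumes "open S" "smooth_on S f" "smooth_on S g"
  shows "smooth_on S (\<lambda>x. (f x, g x))"
proof -
  have "bounded_linear (\<lambda>x. (x, 0))" "bounded_linear (\<lambda>x. (0, x))"
    by (simp_all add: bounded_linear_Pair bounded_linear_ident bounded_linear_zero)
  then have "smooth_on S (\<lambda>x. (f x, 0) + (0, g x))"
    using assms by (intro smooth_on_add smooth_on_linear_compose[of "\<lambda>x. (x, 0)"]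
        smooth_on_linear_compose[of "\<lambda>x. (0, x)"])
  then show ?thesis by simp
qed

text \<open>Up to sign the derivative is the product of the function with itself, so class
  \<open>k\<close> yields class \<open>Suc k\<close>.\<close>

lemma smooth_on_inverse: "smooth_on (- {0}) (inverse :: real \<Rightarrow> real)"
  unfolding smooth_on_def
proof
  fix k show "Ck_on k (inverse :: real \<Rightarrow> real) (- {0})"
  proof (induction k)
    case 0
    then show ?case by (auto intro!: continuous_intros)
  next
    case (Suc k)
    have "(inverse has_derivative (\<lambda>v. inverse x * inverse x * (- v))) (at x)"
      if "x \<in> - {0}" for x :: real
      using that by (auto intro!: derivative_eq_intros simp: power2_eq_square)
    moreover have "Ck_on k (\<lambda>x. inverse x * inverse x * (- v)) (- {0})" for v :: real
      by (intro Ck_on_bilinear[OF bounded_bilinear_mult] Ck_on_const Suc) auto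
    ultimately show ?case
      by (intro Ck_on_SucI) auto
  qed
qed

text \<open>The integrals below are the coefficients in Hadamard's lemma; carrying the weight \<open>s ^ m\<close>
  makes their derivatives integrals of the same form.\<close>

lemma Ck_on_weighted_integral:
  fixes f :: "'e::euclidean_space \<Rightarrow> real"
  assumes "Ck_on k f (ball x0 r)"
  shows "Ck_on k (\<lambda>x. integral (cbox 0 1) (\<lambda>s::real. s ^ m * f (x0 + s *\<^sub>R (x - x0)))) (ball x0 r)"
  using assms
proof (induction k arbitrary: f m)
  have segment: "x0 + s *\<^sub>R (x - x0) \<in> ball x0 r" if "x \<in> ball x0 r" "s \<in> cbox 0 1" for x and s :: real
  proof -
    have "norm (s *\<^sub>R (x - x0)) \<le> 1 * norm (x - x0)"
      using that unfolding norm_scaleR by (intro mult_right_mono) auto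
    then show ?thesis
      using that by (simp add: dist_norm norm_minus_commute)
  qed
  have cont: "continuous_on (ball x0 r \<times> cbox 0 1) (\<lambda>(x, s::real). s ^ m * h (x0 + s *\<^sub>R (x - x0)))"
    if "continuous_on (ball x0 r) h" for h :: "'e \<Rightarrow> real" and m
    unfolding case_prod_beta
    by (intro continuous_intros continuous_on_compose2[OF that])
      (use segment in auto)
  {
    case (0 f m)
    then show ?case
      using integral_continuous_on_param[OF cont] by simp
  next
    case (Suc k f m)
    let ?pt = "\<lambda>x s. x0 + s *\<^sub>R (x - x0)"
    let ?D = "\<lambda>v s x. s ^ Suc m * frechet_derivative f (at (?pt x s)) v"
    \<comment> \<open>\<open>leibniz_rule\<close> wants the derivative in \<open>x\<close> as a
      \<open>blinfun\<close> continuous in both variables, so it is assembled from the partial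
      derivatives. The inner derivative contributes a factor \<open>s\<close>, which raises the
      weight to \<open>Suc m\<close>.\<close>
    define fx where "fx = (\<lambda>x s. \<Sum>b\<in>Basis. ?D b s x *\<^sub>R blinfun_inner_right b)"
    have fx: "blinfun_apply (fx x s) v = ?D v s x" if "x \<in> ball x0 r" "s \<in> cbox 0 1" for x s v
    proof -
      have "frechet_derivative f (at (?pt x s)) v =
          (\<Sum>b\<in>Basis. (v \<bullet> b) *\<^sub>R frechet_derivative f (at (?pt x s)) b)"
        using segment[OF that] Suc.prems
        by (intro linear_compose_sum_basis has_derivative_linear[OF Ck_on_Suc_has_derivative])
      then show ?thesis
        by (simp add: fx_def blinfun.sum_left blinfun.scaleR_left sum_distrib_left
            inner_commute algebra_simps)
    qed
    have der: "((\<lambda>x. integral (cbox 0 1) (\<lambda>s. s ^ m * f (?pt x s))) has_derivative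
        blinfun_apply (integral (cbox 0 1) (fx x))) (at x within ball x0 r)" if "x \<in> ball x0 r" for x
    proof (rule leibniz_rule)
      show "((\<lambda>x. t ^ m * f (?pt x t)) has_derivative blinfun_apply (fx x t)) (at x within ball x0 r)"
        if "x \<in> ball x0 r" "t \<in> cbox 0 1" for x and t :: real
      proof -
        have f: "(f has_derivative frechet_derivative f (at (?pt x t))) (at (?pt x t))"
          using segment[OF that] Suc.prems by (intro Ck_on_Suc_has_derivative)
        have "((\<lambda>x. t ^ m * f (?pt x t)) has_derivative
            (\<lambda>v. t ^ m * frechet_derivative f (at (?pt x t)) (t *\<^sub>R v))) (at x)"
          by (rule has_derivative_mult_right, rule has_derivative_compose[where f = "\<lambda>x. ?pt x t", OF _ f])
            (auto intro!: derivative_eq_intros)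
        moreover have "t ^ m * frechet_derivative f (at (?pt x t)) (t *\<^sub>R v) = blinfun_apply (fx x t) v" for v
          using fx[OF that] linear_scale[OF has_derivative_linear[OF f]] by simp
        ultimately show ?thesis
          by (auto intro: has_derivative_at_withinI)
      qed
      show "(\<lambda>s. s ^ m * f (?pt x s)) integrable_on cbox 0 1" if "x \<in> ball x0 r" for x
      proof (rule integrable_continuous)
        have "continuous_on (cbox 0 1) (\<lambda>s. (\<lambda>(x, s). s ^ m * f (?pt x s)) (x, s))"
          by (rule continuous_on_compose2[OF cont[OF Ck_on_0D[OF Suc.prems], of m]])
            (use that in \<open>auto intro!: continuous_intros\<close>)
        then show "continuous_on (cbox 0 1) (\<lambda>s. s ^ m * f (?pt x s))" by simp
      qed
      show "continuous_on (ball x0 r \<times> cbox 0 1) (\<lambda>(x, s). fx x s)"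
        unfolding fx_def case_prod_beta
        by (intro continuous_on_sum continuous_on_scaleR continuous_on_const)
          (use cont[OF Ck_on_0D[OF Ck_on_Suc_derivative[OF Suc.prems]], of "Suc m"] in
            \<open>simp add: case_prod_beta\<close>)
    qed (use that in auto)
    \<comment> \<open>Evaluation at \<open>v\<close> is bounded linear and commutes with the
      integral. This turns the operator-valued integral into a real one of the shape covered by the
      induction hypothesis.\<close>
    have der_eq: "blinfun_apply (integral (cbox 0 1) (fx x)) v = integral (cbox 0 1) (\<lambda>s. ?D v s x)"
      if "x \<in> ball x0 r" for x v
    proof -
      have "continuous_on (cbox 0 1) (\<lambda>s. (\<lambda>(x, s). s ^ Suc m * frechet_derivative f (at (?pt x s)) b) (x, s))" for b
        by (rule continuous_on_compose2[OF cont[OF Ck_on_0D[OF Ck_on_Suc_derivative[OF Suc.prems]], of "Suc m"]])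
          (use that in \<open>auto intro!: continuous_intros\<close>)
      then have "fx x integrable_on cbox 0 1"
        unfolding fx_def
        by (intro integrable_continuous continuous_on_sum continuous_on_scaleR continuous_on_const) simp
      then have "integral (cbox 0 1) ((\<lambda>L. blinfun_apply L v) \<circ> fx x) = blinfun_apply (integral (cbox 0 1) (fx x)) v"
        by (rule integral_linear) (rule blinfun.bounded_linear_left)
      moreover have "integral (cbox 0 1) ((\<lambda>L. blinfun_apply L v) \<circ> fx x) = integral (cbox 0 1) (\<lambda>s. ?D v s x)"
        using fx[OF that] by (intro integral_cong) simp
      ultimately show ?thesis by simp
    qed
    have *: "((\<lambda>x. integral (cbox 0 1) (\<lambda>s. s ^ m * f (?pt x s))) has_derivative
        (\<lambda>v. integral (cbox 0 1) (\<lambda>s. ?D v s x))) (at x)" if "x \<in> ball x0 r" for x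
      unfolding der_eq[OF that, symmetric]
      using der[OF that] that by (simp only: at_within_open[OF _ open_ball])
    show ?case
      by (rule Ck_on_SucI[OF open_ball * Suc.IH[OF Ck_on_Suc_derivative[OF Suc.prems]]])
  }
qed

text \<open>The derivative of \<open>f\<close> is integrated along the segment from
  \<open>x0\<close> to \<open>x\<close>, which stays in the ball. The coefficients are the averages
  of the partial derivatives over that segment, smooth by \<open>Ck_on_weighted_integral\<close>
  with \<open>m = 0\<close>.\<close>

lemma hadamard:
  fixes f :: "'e::euclidean_space \<Rightarrow> real"
  assumes "smooth_on (ball x0 r) f" "r > 0"
  obtains G where "\<And>b. smooth_on (ball x0 r) (G b)" "\<And>b. G b x0 = frechet_derivative f (at x0) b"
    "\<And>x. x \<in> ball x0 r \<Longrightarrow> f x = f x0 + (\<Sum>b\<in>Basis. ((x - x0) \<bullet> b) * G b x)"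
proof -
  define G where "G b x = integral (cbox 0 1) (\<lambda>s::real. s ^ 0 * frechet_derivative f (at (x0 + s *\<^sub>R (x - x0))) b)" for b x
  have G: "smooth_on (ball x0 r) (G b)" for b
    unfolding smooth_on_def
  proof
    fix k
    have "Ck_on k (\<lambda>x. frechet_derivative f (at x) b) (ball x0 r)"
      using smooth_on_derivative[OF assms(1)] smooth_on_Ck by blast
    from Ck_on_weighted_integral[OF this, of 0] show "Ck_on k (G b) (ball x0 r)"
      unfolding G_def .
  qed
  have G0: "G b x0 = frechet_derivative f (at x0) b" for b
    by (simp add: G_def)
  have "f x = f x0 + (\<Sum>b\<in>Basis. ((x - x0) \<bullet> b) * G b x)" if x: "x \<in> ball x0 r" for x
  proof -
  let ?pt = "\<lambda>s. x0 + s *\<^sub>R (x - x0)"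
    have segment: "?pt s \<in> ball x0 r" if "s \<in> {0..1}" for s
    proof -
      have "norm (s *\<^sub>R (x - x0)) \<le> 1 * norm (x - x0)"
        using that unfolding norm_scaleR by (intro mult_right_mono) auto
      then show ?thesis
        using x by (simp add: dist_norm norm_minus_commute)
    qed
    have D: "(f has_derivative frechet_derivative f (at (?pt s))) (at (?pt s))" if "s \<in> {0..1}" for s
      using smooth_on_has_derivative[OF assms(1) segment[OF that]] .
    have int: "(\<lambda>s. frechet_derivative f (at (?pt s)) b) integrable_on {0..1}" for b
      by (intro integrable_continuous_real
          continuous_on_compose2[OF smooth_on_continuous_on[OF smooth_on_derivative[OF assms(1)]]])
        (use segment in \<open>auto intro!: continuous_intros\<close>)
    have "((\<lambda>s. frechet_derivative f (at (?pt s)) (x - x0)) has_integral f (?pt 1) - f (?pt 0)) {0..1}"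
    proof (rule fundamental_theorem_of_calculus)
      fix s :: real assume s: "s \<in> {0..1}"
      have "((\<lambda>s. f (?pt s)) has_derivative (\<lambda>h. frechet_derivative f (at (?pt s)) (h *\<^sub>R (x - x0)))) (at s)"
        by (rule has_derivative_compose[where f = ?pt, OF _ D[OF s]]) (auto intro!: derivative_eq_intros)
      then show "((\<lambda>s. f (?pt s)) has_vector_derivative frechet_derivative f (at (?pt s)) (x - x0)) (at s within {0..1})"
        unfolding has_vector_derivative_def
        using linear_scale[OF has_derivative_linear[OF D[OF s]]]
        by (auto intro: has_derivative_at_withinI)
    qed simp
    moreover have "integral {0..1} (\<lambda>s. frechet_derivative f (at (?pt s)) (x - x0)) =
        integral {0..1} (\<lambda>s. \<Sum>b\<in>Basis. ((x - x0) \<bullet> b) * frechet_derivative f (at (?pt s)) b)"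
      using linear_compose_sum_basis[OF has_derivative_linear[OF D], of _ "x - x0"]
      by (intro integral_cong) simp
    moreover have "\<dots> = (\<Sum>b\<in>Basis. ((x - x0) \<bullet> b) * G b x)"
      by (simp add: integral_sum int integrable_on_mult_right G_def)
    ultimately show "f x = f x0 + (\<Sum>b\<in>Basis. ((x - x0) \<bullet> b) * G b x)"
      by (simp add: has_integral_iff)
  qed
  with G G0 show thesis by (rule that)
qed

section \<open>Auxiliary real functions: implicit equations, flat functions, bumps\<close>

text \<open>Differentiating \<open>\<phi> (\<psi> t) = F t\<close> gives \<open>\<psi>'\<close> as
  the quotient of \<open>F'\<close> by \<open>\<phi>'\<close> at \<open>\<psi> t\<close>. If
  \<open>\<psi>\<close> has class \<open>k\<close>, so has this quotient, and \<open>\<psi>\<close>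
  gains one class; the assumed continuity of \<open>\<psi>\<close> starts the bootstrap.\<close>

lemma smooth_on_implicit_real:
  fixes \<phi> \<psi> F :: "real \<Rightarrow> real"
  assumes A: "open A" and B: "open B" and \<psi>: "continuous_on A \<psi>" "\<psi> ` A \<subseteq> B"
    and \<phi>: "smooth_on B \<phi>" "\<And>s. s \<in> B \<Longrightarrow> frechet_derivative \<phi> (at s) 1 \<noteq> 0"
    and F: "smooth_on A F" "\<And>t. t \<in> A \<Longrightarrow> \<phi> (\<psi> t) = F t"
  shows "smooth_on A \<psi>"
proof -
  let ?d\<phi> = "\<lambda>s. frechet_derivative \<phi> (at s) 1" and ?dF = "\<lambda>t. frechet_derivative F (at t) 1"
  have has_der: "DERIV h t :> frechet_derivative h (at t) 1"
    if "smooth_on S h" "t \<in> S" for h :: "real \<Rightarrow> real" and S t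
  proof -
    have "frechet_derivative h (at t) c = frechet_derivative h (at t) 1 * c" for c
      using linear_scale[OF has_derivative_linear[OF smooth_on_has_derivative[OF that]], of c 1]
      by (simp add: mult.commute)
    then have eq: "frechet_derivative h (at t) = (*) (frechet_derivative h (at t) 1)"
      by (rule ext)
    show ?thesis
      unfolding has_field_derivative_def eq[symmetric] by (rule smooth_on_has_derivative[OF that])
  qed
  have der: "DERIV \<psi> t :> ?dF t * inverse (?d\<phi> (\<psi> t))" if t: "t \<in> A" for t
  proof -
    have "\<psi> t \<in> B" using t \<psi> by auto
    \<comment> \<open>Caratheodory's form of the derivative: the increment of the function is a
      factor, continuous at the point, times the increment of the argument. It avoids a division by
      \<open>\<psi> z - \<psi> t\<close>, which may vanish for \<open>z \<noteq> t\<close>.\<close>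
    obtain g where g: "\<And>z. \<phi> z - \<phi> (\<psi> t) = g z * (z - \<psi> t)" "isCont g (\<psi> t)" "g (\<psi> t) = ?d\<phi> (\<psi> t)"
      using has_der[OF \<phi>(1) \<open>\<psi> t \<in> B\<close>] unfolding CARAT_DERIV by blast
    obtain k where k: "\<And>z. F z - F t = k z * (z - t)" "isCont k t" "k t = ?dF t"
      using has_der[OF F(1) t] unfolding CARAT_DERIV by blast
    have "isCont \<psi> t"
      using \<psi>(1) A t by (simp add: continuous_on_eq_continuous_at)
    then have g\<psi>: "isCont (\<lambda>z. g (\<psi> z)) t"
      by (rule isCont_o2) (rule g(2))
    have nz: "g (\<psi> t) \<noteq> 0" using g(3) \<phi>(2)[OF \<open>\<psi> t \<in> B\<close>] by simp
    \<comment> \<open>\<open>q\<close> is the difference quotient of \<open>\<psi>\<close>, with the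
      expected derivative filled in at \<open>t\<close>. Near \<open>t\<close> it is
      \<open>k z\<close> divided by \<open>g (\<psi> z)\<close>, hence continuous at
      \<open>t\<close>.\<close>
    define q where "q z = (if z = t then ?dF t * inverse (?d\<phi> (\<psi> t)) else (\<psi> z - \<psi> t) / (z - t))" for z
    have "\<forall>\<^sub>F z in nhds t. g (\<psi> z) \<noteq> 0"
      using tendsto_imp_eventually_ne[OF g\<psi>[unfolded isCont_def] nz] nz
      by (simp add: eventually_nhds_conv_at)
    then have ev: "\<forall>\<^sub>F z in nhds t. q z = k z * inverse (g (\<psi> z))"
      using eventually_nhds_in_open[OF A t]
    proof eventually_elim
      case (elim z)
      have "g (\<psi> z) * (\<psi> z - \<psi> t) = k z * (z - t)"
        using g(1)[of "\<psi> z"] k(1)[of z] F(2)[OF t] F(2)[of z] elim by simp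
      then show ?case
        using elim k(3) g(3) by (auto simp: q_def field_simps)
    qed
    have "isCont (\<lambda>z. k z * inverse (g (\<psi> z))) t"
      using k(2) g\<psi> nz by (intro continuous_intros)
    then have "isCont q t"
      using isCont_cong[OF ev] by simp
    moreover have "\<psi> z - \<psi> t = q z * (z - t)" for z
      by (simp add: q_def)
    ultimately show ?thesis
      unfolding CARAT_DERIV by (intro exI[of _ q]) (simp add: q_def)
  qed
  have "Ck_on k \<psi> A" for k
  proof (induction k)
    case 0
    then show ?case using \<psi> by simp
  next
    case (Suc k)
    have "Ck_on k (\<lambda>t. ?dF t * inverse (?d\<phi> (\<psi> t)) * v) A" for v
      by (intro Ck_on_bilinear[OF bounded_bilinear_mult] Ck_on_const A
          Ck_on_compose[OF A _ _ smooth_on_Ck[OF smooth_on_inverse]]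
          Ck_on_compose[OF A B Suc smooth_on_Ck] smooth_on_Ck smooth_on_derivative F \<phi> \<psi>)
        (use \<phi>(2) \<psi>(2) in auto)
    then show ?case
      using der by (intro Ck_on_SucI[OF A, where f' = "\<lambda>t v. ?dF t * inverse (?d\<phi> (\<psi> t)) * v"])
        (auto simp: has_field_derivative_def)
  qed
  then show ?thesis by (simp add: smooth_on_def)
qed

text \<open>The derivative of \<open>exp (- 1 / t) / t ^ n\<close> is a combination of two functions of the same form.\<close>

definition flat_exp :: "nat \<Rightarrow> real \<Rightarrow> real" where
  "flat_exp n t = (if t > 0 then inverse t ^ n * exp (- inverse t) else 0)"

text \<open>Away from 0 this is calculus. At 0 the exponential beats every power of
  \<open>inverse t\<close>, so both one-sided difference quotients tend to 0, matching the value 0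
  of the right-hand side.\<close>

lemma flat_exp_has_derivative:
  "DERIV (flat_exp n) t :> flat_exp (n + 2) t - real n * flat_exp (n + 1) t"
proof (cases t "0 :: real" rule: linorder_cases)
  case less
  have "DERIV (\<lambda>t. 0) t :> (0 :: real)" by simp
  then have "DERIV (flat_exp n) t :> 0"
    by (rule DERIV_cong_ev[THEN iffD1, rotated -1, OF _ refl _ refl])
      (use less in \<open>auto simp: flat_exp_def eventually_nhds intro!: exI[of _ "{..<0}"]\<close>)
  then show ?thesis using less by (simp add: flat_exp_def)
next
  case equal
  have "((\<lambda>h. flat_exp n h / h) \<longlongrightarrow> 0) (at 0)"
  proof (rule filterlim_split_at)
    have "\<forall>\<^sub>F h in at_left 0. 0 = flat_exp n h / h"
      by (auto simp: flat_exp_def eventually_at_filter)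
    then show "((\<lambda>h. flat_exp n h / h) \<longlongrightarrow> 0) (at_left 0)"
      by (rule Lim_transform_eventually[OF tendsto_const])
    have "((\<lambda>h::real. inverse h ^ n * exp (- inverse h) / h) \<longlongrightarrow> 0) (at_right 0)"
      by real_asymp
    moreover have "\<forall>\<^sub>F h in at_right 0. inverse h ^ n * exp (- inverse h) / h = flat_exp n h / h"
      by (auto simp: flat_exp_def eventually_at_filter)
    ultimately show "((\<lambda>h. flat_exp n h / h) \<longlongrightarrow> 0) (at_right 0)"
      by (rule Lim_transform_eventually)
  qed
  then show ?thesis using equal
    by (simp add: has_field_derivative_def has_derivative_at flat_exp_def DERIV_def flip: has_field_derivative_def)
next
  case greater
  have "DERIV (\<lambda>t. inverse t ^ n * exp (- inverse t)) t :>
      inverse t ^ (n + 2) * exp (- inverse t) - real n * (inverse t ^ (n + 1) * exp (- inverse t))"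
  proof (cases n)
    case (Suc m)
    \<comment> \<open>Differentiating \<open>inverse t ^ m\<close> yields the truncated exponent
      \<open>m - Suc 0\<close>. It misbehaves only for \<open>m = 0\<close>, where its coefficient
      is 0.\<close>
    have "m = 0 \<or> inverse t * inverse t ^ (m - Suc 0) = inverse t ^ m"
      by (cases m) auto
    then show ?thesis using greater Suc
      by (auto intro!: derivative_eq_intros simp: algebra_simps)
  qed (use greater in \<open>auto intro!: derivative_eq_intros simp: algebra_simps\<close>)
  then have "DERIV (flat_exp n) t :>
      inverse t ^ (n + 2) * exp (- inverse t) - real n * (inverse t ^ (n + 1) * exp (- inverse t))"
    by (rule DERIV_cong_ev[THEN iffD1, rotated -1, OF _ refl _ refl])
      (use greater in \<open>auto simp: flat_exp_def eventually_nhds intro!: exI[of _ "{0<..}"]\<close>)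
  then show ?thesis using greater by (simp add: flat_exp_def)
qed

text \<open>\<open>n\<close> varies in the induction, since the derivative leads from
  \<open>n\<close> to \<open>n + 1\<close> and \<open>n + 2\<close>.\<close>

lemma smooth_on_flat_exp: "smooth_on UNIV (flat_exp n)"
  unfolding smooth_on_def
proof
  fix k show "Ck_on k (flat_exp n) UNIV"
  proof (induction k arbitrary: n)
    case 0
    have "isCont (flat_exp n) t" for t
      using flat_exp_has_derivative DERIV_isCont by blast
    then show ?case by (simp add: continuous_at_imp_continuous_on)
  next
    case (Suc k)
    have "Ck_on k (\<lambda>t. (flat_exp (n + 2) t + (- real n) * flat_exp (n + 1) t) * v) UNIV" for v
      by (intro Ck_on_bilinear[OF bounded_bilinear_mult] Ck_on_const Ck_on_add Suc) auto
    then show ?case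
      using flat_exp_has_derivative
      by (intro Ck_on_SucI[where f' = "\<lambda>t v. (flat_exp (n + 2) t + (- real n) * flat_exp (n + 1) t) * v"])
        (auto simp: has_field_derivative_def)
  qed
qed

text \<open>\<open>flat_exp 0\<close> vanishes exactly on the nonpositive numbers and is applied to
  \<open>r\<^sup>2\<close> minus the squared distance from \<open>x0\<close>; unlike the distance,
  its square is smooth at \<open>x0\<close> too. The leading factor normalizes the value at
  \<open>x0\<close> to 1.\<close>

lemma smooth_bump:
  fixes x0 :: "'e::euclidean_space"
  assumes "r > 0"
  obtains \<rho> :: "'e \<Rightarrow> real" where "smooth_on UNIV \<rho>" "\<rho> x0 = 1" "\<And>x. x \<notin> ball x0 r \<Longrightarrow> \<rho> x = 0"
proof
  define \<rho> where "\<rho> x = inverse (flat_exp 0 (r\<^sup>2)) * flat_exp 0 (r\<^sup>2 + (-1) * ((x - x0) \<bullet> (x - x0)))" for x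
  have "smooth_on UNIV (\<lambda>x::'e. x - x0)"
    using smooth_on_add[OF open_UNIV smooth_on_id[OF open_UNIV] smooth_on_const[OF open_UNIV, of "- x0"]]
    by simp
  then show "smooth_on UNIV \<rho>"
    unfolding \<rho>_def
    by (intro smooth_on_mult smooth_on_const smooth_on_compose[OF _ _ _ smooth_on_flat_exp]
        smooth_on_add smooth_on_inner) auto
  show "\<rho> x0 = 1"
    using assms by (simp add: \<rho>_def flat_exp_def)
  show "\<rho> x = 0" if "x \<notin> ball x0 r" for x
  proof -
    have "r \<le> norm (x - x0)"
      using that by (simp add: dist_norm norm_minus_commute)
    then have "r\<^sup>2 \<le> (x - x0) \<bullet> (x - x0)"
      using assms by (simp add: power2_norm_eq_inner[symmetric] power_mono)
    then show ?thesis by (simp add: \<rho>_def flat_exp_def)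
  qed
qed

section \<open>Charts and smooth functions\<close>

lemma smooth_fun_subset: "smooth_fun M U f \<Longrightarrow> W \<subseteq> U \<Longrightarrow> smooth_fun M W f"
  unfolding smooth_fun_def by (blast intro: smooth_on_subset)

context
  fixes M :: "('a, 'e::euclidean_space) mfd"
  assumes M: "smooth_manifold M"
begin

lemma Hausdorff_mtop: "Hausdorff_space (mtop M)"
  using M by (simp add: smooth_manifold_def)

lemma chart_openin: "(U, c) \<in> atlas M \<Longrightarrow> openin (mtop M) U"
  using M by (auto simp: smooth_manifold_def)

lemma chart_subset: "(U, c) \<in> atlas M \<Longrightarrow> U \<subseteq> points M"
  using chart_openin openin_subset by blast

lemma chart_homeomorphic:
  "(U, c) \<in> atlas M \<Longrightarrow> homeomorphic_map (subtopology (mtop M) U) (top_of_set (c ` U)) c"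
  using M by (auto simp: smooth_manifold_def)

lemma chart_open_range: "(U, c) \<in> atlas M \<Longrightarrow> open (c ` U)"
  using M by (auto simp: smooth_manifold_def)

lemma chart_exists:
  assumes "p \<in> points M"
  obtains U c where "(U, c) \<in> atlas M" "p \<in> U"
proof -
  have "p \<in> (\<Union>(U, c)\<in>atlas M. U)"
    using M assms by (simp add: smooth_manifold_def)
  then show thesis using that by auto
qed

lemma chart_inj_on: "(U, c) \<in> atlas M \<Longrightarrow> inj_on c U"
  using chart_homeomorphic[of U c] chart_subset[of U c]
  by (auto simp: homeomorphic_eq_everything_map inf.absorb2)

lemma chart_inverse: "(U, c) \<in> atlas M \<Longrightarrow> p \<in> U \<Longrightarrow> inv_into U c (c p) = p"
  using chart_inj_on by (auto intro: inv_into_f_f)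

lemma chart_image_open:
  assumes "(U, c) \<in> atlas M" "openin (mtop M) W" "W \<subseteq> U"
  shows "open (c ` W)"
proof -
  have "openin (subtopology (mtop M) U) W"
    using assms chart_openin by (simp add: openin_open_subtopology)
  then have "openin (top_of_set (c ` U)) (c ` W)"
    using chart_homeomorphic[OF assms(1)] unfolding homeomorphic_eq_everything_map open_map_def by blast
  then show ?thesis
    using chart_open_range[OF assms(1)] openin_open_eq by blast
qed

lemma chart_preimage_openin:
  assumes "(U, c) \<in> atlas M" "open A"
  shows "openin (mtop M) {p \<in> U. c p \<in> A}"
proof -
  have "continuous_map (subtopology (mtop M) U) (top_of_set (c ` U)) c"
    using chart_homeomorphic[OF assms(1)] by (simp add: homeomorphic_eq_everything_map)
  moreover have "openin (top_of_set (c ` U)) (c ` U \<inter> A)"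
    using assms(2) by (rule openin_open_Int)
  ultimately have "openin (subtopology (mtop M) U)
      {p \<in> topspace (subtopology (mtop M) U). c p \<in> c ` U \<inter> A}"
    by (rule openin_continuous_map_preimage)
  moreover have "{p \<in> topspace (subtopology (mtop M) U). c p \<in> c ` U \<inter> A} = {p \<in> U. c p \<in> A}"
    using chart_subset[OF assms(1)] by auto
  ultimately show ?thesis
    using chart_openin[OF assms(1)] by (simp add: openin_open_subtopology)
qed

lemma chart_transition:
  "(U, c) \<in> atlas M \<Longrightarrow> (V, d) \<in> atlas M \<Longrightarrow> smooth_on (c ` (U \<inter> V)) (d \<circ> inv_into U c)"
  using M by (auto simp: smooth_manifold_def)

lemma smooth_fun_local:
  assumes "\<And>p. p \<in> U \<Longrightarrow> \<exists>W. openin (mtop M) W \<and> p \<in> W \<and> smooth_fun M W f"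
  shows "smooth_fun M U f"
  unfolding smooth_fun_def
proof clarify
  fix V c assume V: "(V, c) \<in> atlas M"
  show "smooth_on (c ` (U \<inter> V)) (f \<circ> inv_into V c)"
  proof (rule smooth_on_local)
    fix x assume "x \<in> c ` (U \<inter> V)"
    then obtain p where p: "p \<in> U" "p \<in> V" "x = c p" by auto
    obtain W where W: "openin (mtop M) W" "p \<in> W" "smooth_fun M W f"
      using assms[OF p(1)] by auto
    have "open (c ` (W \<inter> V))"
      using V W(1) chart_openin by (intro chart_image_open[OF V]) auto
    then show "\<exists>S. open S \<and> x \<in> S \<and> smooth_on S (f \<circ> inv_into V c)"
      using W p V unfolding smooth_fun_def by (intro exI[of _ "c ` (W \<inter> V)"]) auto
  qed
qed

text \<open>\<open>smooth_fun\<close> quantifies over all charts of the atlas. Smooth transition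
  maps make the test in one chart enough, as long as \<open>U\<close> lies in its domain.\<close>

lemma smooth_fun_chartI:
  assumes V: "(V, c) \<in> atlas M" and U: "openin (mtop M) U" "U \<subseteq> V"
    and f: "smooth_on (c ` U) (f \<circ> inv_into V c)"
  shows "smooth_fun M U f"
  unfolding smooth_fun_def
proof clarify
  fix W d assume W: "(W, d) \<in> atlas M"
  have UW: "openin (mtop M) (U \<inter> W)"
    using U(1) chart_openin[OF W] by auto
  have open_UW: "open (d ` (U \<inter> W))"
    using chart_image_open[OF W UW] by auto
  have transition: "smooth_on (d ` (U \<inter> W)) (c \<circ> inv_into W d)"
    using U(2) by (intro smooth_on_subset[OF chart_transition[OF W V]]) auto
  have "smooth_on (d ` (U \<inter> W)) (\<lambda>x. (f \<circ> inv_into V c) ((c \<circ> inv_into W d) x))"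
  proof (rule smooth_on_compose[OF open_UW chart_image_open[OF V U] transition f])
    show "(c \<circ> inv_into W d) ` d ` (U \<inter> W) \<subseteq> c ` U"
      using chart_inverse[OF W] by auto
  qed
  then show "smooth_on (d ` (U \<inter> W)) (f \<circ> inv_into W d)"
    by (rule smooth_on_cong[OF open_UW, rotated])
      (use U(2) chart_inverse[OF W] chart_inverse[OF V] in auto)
qed

lemma smooth_fun_in_chart:
  assumes "smooth_fun M U f" "(V, c) \<in> atlas M" "U \<subseteq> V"
  shows "smooth_on (c ` U) (f \<circ> inv_into V c)"
proof -
  have "U \<inter> V = U" using assms(3) by auto
  then show ?thesis using assms(1,2) unfolding smooth_fun_def by (metis (no_types, lifting) case_prodD)
qed

lemma chart_Int_open:
  "openin (mtop M) U \<Longrightarrow> (V, c) \<in> atlas M \<Longrightarrow> open (c ` (U \<inter> V))"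
  using chart_openin by (intro chart_image_open) auto

lemma smooth_fun_cong:
  assumes "openin (mtop M) U" "\<And>p. p \<in> U \<Longrightarrow> f p = g p" "smooth_fun M U f"
  shows "smooth_fun M U g"
  unfolding smooth_fun_def
proof clarify
  fix V c assume V: "(V, c) \<in> atlas M"
  show "smooth_on (c ` (U \<inter> V)) (g \<circ> inv_into V c)"
    by (rule smooth_on_cong[OF chart_Int_open[OF assms(1) V], of "f \<circ> inv_into V c"])
      (use assms V chart_inverse[OF V] in \<open>auto simp: smooth_fun_def\<close>)
qed

lemma smooth_fun_const: "openin (mtop M) U \<Longrightarrow> smooth_fun M U (\<lambda>p. a)"
  unfolding smooth_fun_def comp_def using chart_Int_open smooth_on_const by blast

lemma smooth_fun_add:
  "openin (mtop M) U \<Longrightarrow> smooth_fun M U f \<Longrightarrow> smooth_fun M U g \<Longrightarrow> smooth_fun M U (\<lambda>p. f p + g p)"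
  unfolding smooth_fun_def comp_def using chart_Int_open by (fast intro: smooth_on_add)

lemma smooth_fun_mult:
  "openin (mtop M) U \<Longrightarrow> smooth_fun M U f \<Longrightarrow> smooth_fun M U g \<Longrightarrow> smooth_fun M U (\<lambda>p. f p * g p)"
  unfolding smooth_fun_def comp_def using chart_Int_open by (fast intro: smooth_on_mult)

lemma smooth_fun_sum:
  assumes "openin (mtop M) U" "\<And>i. i \<in> A \<Longrightarrow> smooth_fun M U (f i)"
  shows "smooth_fun M U (\<lambda>p. \<Sum>i\<in>A. f i p)"
proof (cases "finite A")
  case True
  then show ?thesis using assms(2)
    by induction (auto intro: smooth_fun_const smooth_fun_add assms(1))
qed (simp add: smooth_fun_const assms(1))

lemma smooth_fun_compose:
  fixes h :: "real \<Rightarrow> real"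
  assumes "openin (mtop M) U" "smooth_fun M U f" "open A" "smooth_on A h" "f ` U \<subseteq> A"
  shows "smooth_fun M U (\<lambda>p. h (f p))"
  unfolding smooth_fun_def
proof clarify
  fix V c assume V: "(V, c) \<in> atlas M"
  have f: "smooth_on (c ` (U \<inter> V)) (f \<circ> inv_into V c)"
    using assms(2) V by (auto simp: smooth_fun_def)
  have "smooth_on (c ` (U \<inter> V)) (\<lambda>x. h ((f \<circ> inv_into V c) x))"
  proof (rule smooth_on_compose[OF chart_Int_open[OF assms(1) V] assms(3) f assms(4)])
    show "(f \<circ> inv_into V c) ` c ` (U \<inter> V) \<subseteq> A"
      using assms(5) chart_inverse[OF V] by auto
  qed
  then show "smooth_on (c ` (U \<inter> V)) ((\<lambda>p. h (f p)) \<circ> inv_into V c)"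
    by (simp add: comp_def)
qed

lemma smooth_fun_inverse:
  "openin (mtop M) U \<Longrightarrow> smooth_fun M U f \<Longrightarrow> (\<And>p. p \<in> U \<Longrightarrow> f p \<noteq> 0) \<Longrightarrow>
    smooth_fun M U (\<lambda>p. inverse (f p))"
  by (rule smooth_fun_compose[OF _ _ _ smooth_on_inverse]) auto

lemma smooth_fun_coordinate:
  assumes V: "(V, c) \<in> atlas M"
  shows "smooth_fun M V (\<lambda>p. c p \<bullet> b)"
proof (rule smooth_fun_chartI[OF V chart_openin[OF V] subset_refl])
  have "smooth_on (c ` V) (\<lambda>x. x \<bullet> b)"
    by (rule smooth_on_linear[OF bounded_linear_inner_left chart_open_range[OF V]])
  then show "smooth_on (c ` V) ((\<lambda>p. c p \<bullet> b) \<circ> inv_into V c)"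
    by (rule smooth_on_cong[OF chart_open_range[OF V], rotated])
      (use chart_inverse[OF V] in auto)
qed

lemma smooth_atI: "openin (mtop M) U \<Longrightarrow> p \<in> U \<Longrightarrow> smooth_fun M U f \<Longrightarrow> smooth_at M p f"
  by (auto simp: smooth_at_def)

lemma smooth_at_coordinate:
  "(V, c) \<in> atlas M \<Longrightarrow> p \<in> V \<Longrightarrow> smooth_at M p (\<lambda>q. c q \<bullet> b)"
  using smooth_fun_coordinate chart_openin smooth_atI by blast

lemma smooth_at_const: "p \<in> points M \<Longrightarrow> smooth_at M p (\<lambda>q. a)"
  using smooth_atI smooth_fun_const openin_topspace by blast

lemma smooth_at_common:
  assumes "smooth_at M p f" "smooth_at M p g"
  obtains U where "openin (mtop M) U" "p \<in> U" "smooth_fun M U f" "smooth_fun M U g"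
proof -
  obtain U V where "openin (mtop M) U" "p \<in> U" "smooth_fun M U f"
    "openin (mtop M) V" "p \<in> V" "smooth_fun M V g"
    using assms unfolding smooth_at_def by blast
  then show thesis
    using that[of "U \<inter> V"] smooth_fun_subset by (metis IntI inf_le1 inf_le2 openin_Int)
qed

lemma smooth_at_add:
  assumes "smooth_at M p f" "smooth_at M p g"
  shows "smooth_at M p (\<lambda>q. f q + g q)"
proof -
  obtain U where U: "openin (mtop M) U" "p \<in> U" "smooth_fun M U f" "smooth_fun M U g"
    using smooth_at_common[OF assms] .
  show ?thesis
    by (rule smooth_atI[OF U(1,2) smooth_fun_add[OF U(1,3,4)]])
qed

lemma smooth_at_mult:
  assumes "smooth_at M p f" "smooth_at M p g"
  shows "smooth_at M p (\<lambda>q. f q * g q)"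
proof -
  obtain U where U: "openin (mtop M) U" "p \<in> U" "smooth_fun M U f" "smooth_fun M U g"
    using smooth_at_common[OF assms] .
  show ?thesis
    by (rule smooth_atI[OF U(1,2) smooth_fun_mult[OF U(1,3,4)]])
qed

lemma smooth_at_scale:
  assumes "smooth_at M p f"
  shows "smooth_at M p (\<lambda>q. a * f q)"
proof -
  obtain U where U: "openin (mtop M) U" "p \<in> U" "smooth_fun M U f"
    using assms by (auto simp: smooth_at_def)
  show ?thesis
    by (rule smooth_atI[OF U(1,2) smooth_fun_mult[OF U(1) smooth_fun_const[OF U(1)] U(3)]])
qed

lemma smooth_at_sum:
  assumes "p \<in> points M" "finite A" "\<And>i. i \<in> A \<Longrightarrow> smooth_at M p (f i)"
  shows "smooth_at M p (\<lambda>q. \<Sum>i\<in>A. f i q)"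
  using assms(2,3)
  by (induction A rule: finite_induct) (auto intro: smooth_at_const smooth_at_add assms(1))

lemma smooth_at_cong:
  assumes "smooth_at M p f" "openin (mtop M) U" "p \<in> U" "\<And>q. q \<in> U \<Longrightarrow> f q = g q"
  shows "smooth_at M p g"
proof -
  obtain W where W: "openin (mtop M) W" "p \<in> W" "smooth_fun M W f"
    using assms(1) by (auto simp: smooth_at_def)
  have "smooth_fun M (U \<inter> W) g"
    using W assms by (intro smooth_fun_cong[of _ f g] smooth_fun_subset[OF W(3)]) auto
  then show ?thesis
    using W assms by (intro smooth_atI[of "U \<inter> W"]) auto
qed

section \<open>Tangent vectors\<close>

text \<open>The locality clause of \<open>tangent_space\<close> demands smoothness of
  \<open>f\<close> only. Here \<open>g\<close> may be assumed smooth as well, because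
  \<open>smooth_at_cong\<close> supplies it.\<close>

lemma tangent_spaceI:
  assumes "\<And>f g. smooth_at M p f \<Longrightarrow> smooth_at M p g \<Longrightarrow> v (\<lambda>x. f x + g x) = v f + v g"
    and "\<And>a f. smooth_at M p f \<Longrightarrow> v (\<lambda>x. a * f x) = a * v f"
    and "\<And>f g. smooth_at M p f \<Longrightarrow> smooth_at M p g \<Longrightarrow> v (\<lambda>x. f x * g x) = v f * g p + f p * v g"
    and "\<And>f g U. smooth_at M p f \<Longrightarrow> smooth_at M p g \<Longrightarrow> openin (mtop M) U \<Longrightarrow> p \<in> U \<Longrightarrow>
      (\<And>x. x \<in> U \<Longrightarrow> f x = g x) \<Longrightarrow> v f = v g"
    and "\<And>f. \<not> smooth_at M p f \<Longrightarrow> v f = 0"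
  shows "v \<in> tangent_space M p"
proof -
  have "v f = v g" if "smooth_at M p f" "openin (mtop M) U" "p \<in> U" "\<forall>x\<in>U. f x = g x" for f g U
    using that by (intro assms(4)[OF that(1) smooth_at_cong[OF that(1-3)] that(2,3)]) auto
  then show ?thesis
    unfolding tangent_space_def mem_Collect_eq by (intro conjI allI impI assms(1,2,3,5))
qed

lemma tangent_add:
  assumes "v \<in> tangent_space M p"
  shows "smooth_at M p f \<Longrightarrow> smooth_at M p g \<Longrightarrow> v (\<lambda>x. f x + g x) = v f + v g"
  by (rule assms[unfolded tangent_space_def mem_Collect_eq, THEN conjunct1, rule_format])

lemma tangent_scale:
  assumes "v \<in> tangent_space M p"
  shows "smooth_at M p f \<Longrightarrow> v (\<lambda>x. a * f x) = a * v f"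
  by (rule assms[unfolded tangent_space_def mem_Collect_eq, THEN conjunct2, THEN conjunct1, rule_format])

lemma tangent_mult:
  assumes "v \<in> tangent_space M p"
  shows "smooth_at M p f \<Longrightarrow> smooth_at M p g \<Longrightarrow> v (\<lambda>x. f x * g x) = v f * g p + f p * v g"
  by (rule assms[unfolded tangent_space_def mem_Collect_eq, THEN conjunct2, THEN conjunct2, THEN conjunct1, rule_format])

lemma tangent_cong:
  assumes "v \<in> tangent_space M p"
  shows "smooth_at M p f \<Longrightarrow> openin (mtop M) U \<Longrightarrow> p \<in> U \<Longrightarrow>
    (\<And>x. x \<in> U \<Longrightarrow> f x = g x) \<Longrightarrow> v f = v g"
  by (rule assms[unfolded tangent_space_def mem_Collect_eq, THEN conjunct2, THEN conjunct2, THEN conjunct2, THEN conjunct1, rule_format])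

lemma tangent_nonsmooth:
  assumes "v \<in> tangent_space M p"
  shows "\<not> smooth_at M p f \<Longrightarrow> v f = 0"
  by (rule assms[unfolded tangent_space_def mem_Collect_eq, THEN conjunct2, THEN conjunct2, THEN conjunct2, THEN conjunct2, rule_format])

text \<open>The Leibniz rule for \<open>1 * 1\<close> reads \<open>v 1 = v 1 + v 1\<close>.\<close>

lemma tangent_const:
  assumes "v \<in> tangent_space M p" "p \<in> points M"
  shows "v (\<lambda>x. a) = 0"
proof -
  have "v (\<lambda>x. 1 * 1) = v (\<lambda>x. 1) * 1 + 1 * v (\<lambda>x. 1)"
    using tangent_mult[OF assms(1) smooth_at_const smooth_at_const] assms(2) by blast
  then have "v (\<lambda>x. 1) = 0" by simp
  moreover have "v (\<lambda>x. a * 1) = a * v (\<lambda>x. 1)"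
    using tangent_scale[OF assms(1) smooth_at_const] assms(2) by blast
  ultimately show ?thesis by simp
qed

lemma tangent_sum:
  assumes "v \<in> tangent_space M p" "p \<in> points M" "finite A" "\<And>i. i \<in> A \<Longrightarrow> smooth_at M p (f i)"
  shows "v (\<lambda>q. \<Sum>i\<in>A. f i q) = (\<Sum>i\<in>A. v (f i))"
  using assms(3,4)
proof (induction A rule: finite_induct)
  case empty
  show ?case using tangent_const[OF assms(1,2)] by simp
next
  case (insert i A)
  then have "v (\<lambda>q. f i q + (\<Sum>i\<in>A. f i q)) = v (f i) + v (\<lambda>q. \<Sum>i\<in>A. f i q)"
    using assms by (intro tangent_add[OF assms(1)] smooth_at_sum) auto
  with insert show ?case by simp
qed

lemma tangent_zero: "0\<^sub>t \<in> tangent_space M p"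
  by (simp add: tangent_space_def)

lemma tangent_space_add:
  assumes "u \<in> tangent_space M p" "v \<in> tangent_space M p"
  shows "u +\<^sub>t v \<in> tangent_space M p"
proof (rule tangent_spaceI)
  show "u f + v f = u g + v g"
    if "smooth_at M p f" "openin (mtop M) U" "p \<in> U" "\<And>x. x \<in> U \<Longrightarrow> f x = g x" for f g U
    using tangent_cong[OF assms(1) that] tangent_cong[OF assms(2) that] by simp
qed (simp_all add: assms[THEN tangent_add] assms[THEN tangent_scale] assms[THEN tangent_mult]
    assms[THEN tangent_nonsmooth] algebra_simps)

lemma tangent_space_scale:
  assumes "u \<in> tangent_space M p"
  shows "a *\<^sub>t u \<in> tangent_space M p"
proof (rule tangent_spaceI)
  show "a * u f = a * u g"
    if "smooth_at M p f" "openin (mtop M) U" "p \<in> U" "\<And>x. x \<in> U \<Longrightarrow> f x = g x" for f g U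
    using tangent_cong[OF assms that] by simp
qed (simp_all add: tangent_add[OF assms] tangent_scale[OF assms] tangent_mult[OF assms]
    tangent_nonsmooth[OF assms] algebra_simps)

lemma tangent_space_sum:
  "finite A \<Longrightarrow> (\<And>i. i \<in> A \<Longrightarrow> e i \<in> tangent_space M p) \<Longrightarrow>
    (\<lambda>f. \<Sum>i\<in>A. a i * e i f) \<in> tangent_space M p"
proof (induction A rule: finite_induct)
  case (insert i A)
  then have "a i *\<^sub>t e i +\<^sub>t (\<lambda>f. \<Sum>i\<in>A. a i * e i f) \<in> tangent_space M p"
    by (intro tangent_space_add tangent_space_scale) auto
  with insert show ?case by simp
qed (simp add: tangent_zero)

end

text \<open>The partial derivative in direction \<open>b\<close> in the chart \<open>(V, c)\<close>.
  The value 0 on functions that are not smooth at \<open>p\<close> follows the convention of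
  \<open>tangent_space\<close>, so that equality of tangent vectors stays equality of
  functions.\<close>

definition coord_vec ::
    "('a, 'e::euclidean_space) mfd \<Rightarrow> 'a set \<Rightarrow> ('a \<Rightarrow> 'e) \<Rightarrow> 'e \<Rightarrow> 'a \<Rightarrow> 'a tvec" where
  "coord_vec M V c b p = (\<lambda>f. if smooth_at M p f
     then frechet_derivative (f \<circ> inv_into V c) (at (c p)) b else 0)"

context
  fixes M :: "('a, 'e::euclidean_space) mfd"
  assumes M: "smooth_manifold M"
begin

lemma smooth_at_chart_differentiable:
  assumes V: "(V, c) \<in> atlas M" "p \<in> V" and f: "smooth_at M p f"
  shows "((f \<circ> inv_into V c) has_derivative frechet_derivative (f \<circ> inv_into V c) (at (c p))) (at (c p))"
proof -
  obtain U where U: "openin (mtop M) U" "p \<in> U" "smooth_fun M U f"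
    using f by (auto simp: smooth_at_def)
  have "smooth_on (c ` (U \<inter> V)) (f \<circ> inv_into V c)"
    using U(3) V(1) unfolding smooth_fun_def by blast
  then show ?thesis
    using U V by (intro smooth_on_has_derivative) auto
qed

lemma coord_vec_tangent:
  assumes V: "(V, c) \<in> atlas M" "p \<in> V"
  shows "coord_vec M V c b p \<in> tangent_space M p"
proof -
  note D = smooth_at_chart_differentiable[OF V]
  have inv: "inv_into V c (c p) = p"
    using chart_inverse[OF M V] .
  have p: "p \<in> points M"
    using chart_subset[OF M V(1)] V(2) by auto
  have 1: "coord_vec M V c b p (\<lambda>x. f x + g x) = coord_vec M V c b p f + coord_vec M V c b p g"
    if "smooth_at M p f" "smooth_at M p g" for f g
    using frechet_derivative_at[OF has_derivative_add[OF D[OF that(1)] D[OF that(2)]], symmetric]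
      that smooth_at_add[OF M that]
    by (simp add: coord_vec_def comp_def)
  have 2: "coord_vec M V c b p (\<lambda>x. a * f x) = a * coord_vec M V c b p f"
    if "smooth_at M p f" for f a
    using frechet_derivative_at[OF has_derivative_mult_right[OF D[OF that(1)], of a], symmetric]
      that smooth_at_scale[OF M that]
    by (simp add: coord_vec_def comp_def)
  have 3: "coord_vec M V c b p (\<lambda>x. f x * g x) = coord_vec M V c b p f * g p + f p * coord_vec M V c b p g"
    if "smooth_at M p f" "smooth_at M p g" for f g
    using frechet_derivative_at[OF has_derivative_mult[OF D[OF that(1)] D[OF that(2)]], symmetric]
      that smooth_at_mult[OF M that] inv
    by (simp add: coord_vec_def comp_def)
  have 4: "coord_vec M V c b p f = coord_vec M V c b p g"
    if "smooth_at M p f" "openin (mtop M) U" "p \<in> U" "\<forall>x\<in>U. f x = g x" for f g U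
  proof -
    have "frechet_derivative (f \<circ> inv_into V c) (at (c p)) = frechet_derivative (g \<circ> inv_into V c) (at (c p))"
      by (rule frechet_derivative_cong_open[OF chart_Int_open[OF M that(2) V(1)]])
        (use V that chart_inverse[OF M V(1)] in auto)
    moreover have "smooth_at M p g"
      using smooth_at_cong[OF M that(1-3)] that(4) by blast
    ultimately show ?thesis
      using that(1) by (simp add: coord_vec_def)
  qed
  show ?thesis
    by (rule tangent_spaceI[OF M 1 2 3 4]) (auto simp: coord_vec_def)
qed

lemma coord_vec_eq_derivative:
  assumes "(V, c) \<in> atlas M" "p \<in> W" "openin (mtop M) W" "smooth_fun M W f"
  shows "coord_vec M V c b p f = frechet_derivative (f \<circ> inv_into V c) (at (c p)) b"
  using smooth_atI[OF M assms(3,2,4)] by (simp add: coord_vec_def)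

lemma smooth_vfield_coord_vec:
  assumes V: "(V, c) \<in> atlas M"
  shows "smooth_vfield_on M V (coord_vec M V c b)"
  unfolding smooth_vfield_on_def
proof (intro conjI ballI allI impI)
  show "coord_vec M V c b p \<in> tangent_space M p" if "p \<in> V" for p
    using coord_vec_tangent[OF V that] .
  fix W f assume W: "openin (mtop M) W" "W \<subseteq> V" "smooth_fun M W f"
  show "smooth_fun M W (\<lambda>p. coord_vec M V c b p f)"
  proof (rule smooth_fun_chartI[OF M V W(1,2)])
    have "smooth_on (c ` W) (\<lambda>x. frechet_derivative (f \<circ> inv_into V c) (at x) b)"
      by (rule smooth_on_derivative[OF smooth_fun_in_chart[OF M W(3) V W(2)]])
    then show "smooth_on (c ` W) ((\<lambda>p. coord_vec M V c b p f) \<circ> inv_into V c)"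
    proof (rule smooth_on_cong[OF chart_image_open[OF M V W(1,2)], rotated])
      fix x assume "x \<in> c ` W"
      then obtain p where "p \<in> W" "x = c p" by auto
      then show "frechet_derivative (f \<circ> inv_into V c) (at x) b = ((\<lambda>p. coord_vec M V c b p f) \<circ> inv_into V c) x"
        using coord_vec_eq_derivative[OF V _ W(1,3)] chart_inverse[OF M V] W(2) by auto
    qed
  qed
qed

lemma coord_vec_coordinate:
  assumes V: "(V, c) \<in> atlas M" "p \<in> V"
  shows "coord_vec M V c b p (\<lambda>q. c q \<bullet> b') = b \<bullet> b'"
proof -
  have "frechet_derivative ((\<lambda>q. c q \<bullet> b') \<circ> inv_into V c) (at (c p)) = frechet_derivative (\<lambda>x. x \<bullet> b') (at (c p))"
    by (rule frechet_derivative_cong_open[OF chart_open_range[OF M V(1)]])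
      (use V chart_inverse[OF M V(1)] in auto)
  moreover have "((\<lambda>x. x \<bullet> b') has_derivative (\<lambda>v. v \<bullet> b')) (at (c p))"
    by (auto intro!: derivative_eq_intros)
  ultimately show ?thesis
    using smooth_at_coordinate[OF M V] frechet_derivative_at by (fastforce simp: coord_vec_def)
qed

text \<open>By Hadamard's lemma a germ is, up to a constant, a combination of the coordinates
  with smooth coefficients, and a derivation sees only the values of these at \<open>p\<close>.\<close>

lemma tangent_expansion:
  assumes V: "(V, c) \<in> atlas M" "p \<in> V" and v: "v \<in> tangent_space M p"
  shows "v f = (\<Sum>b\<in>Basis. v (\<lambda>q. c q \<bullet> b) * coord_vec M V c b p f)"
proof (cases "smooth_at M p f")
  case True
  obtain U where U: "openin (mtop M) U" "p \<in> U" "smooth_fun M U f"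
    using True by (auto simp: smooth_at_def)
  have p: "p \<in> points M"
    using chart_subset[OF M V(1)] V(2) by auto
  have sm: "smooth_on (c ` (U \<inter> V)) (f \<circ> inv_into V c)"
    using U(3) V(1) unfolding smooth_fun_def by blast
  obtain r where r: "r > 0" "ball (c p) r \<subseteq> c ` (U \<inter> V)"
    using open_contains_ball chart_Int_open[OF M U(1) V(1)] U(2) V(2) by (metis IntI imageI)
  obtain G where G: "\<And>b. smooth_on (ball (c p) r) (G b)"
    "\<And>b. G b (c p) = frechet_derivative (f \<circ> inv_into V c) (at (c p)) b"
    "\<And>x. x \<in> ball (c p) r \<Longrightarrow> (f \<circ> inv_into V c) x = (f \<circ> inv_into V c) (c p) + (\<Sum>b\<in>Basis. ((x - c p) \<bullet> b) * G b x)"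
    by (rule hadamard[OF smooth_on_subset[OF sm r(2)] r(1)]) (rule that; assumption)
  define W where "W = {q \<in> V. c q \<in> ball (c p) r}"
  have W: "openin (mtop M) W" "p \<in> W" "W \<subseteq> V"
    unfolding W_def using chart_preimage_openin[OF M V(1) open_ball] V(2) r(1) by auto
  have "smooth_fun M W (\<lambda>q. G b (c q))" for b
  proof (rule smooth_fun_chartI[OF M V(1) W(1,3)])
    show "smooth_on (c ` W) ((\<lambda>q. G b (c q)) \<circ> inv_into V c)"
      by (rule smooth_on_cong[OF chart_image_open[OF M V(1) W(1,3)] _ smooth_on_subset[OF G(1)[of b]]])
        (use chart_inverse[OF M V(1)] in \<open>auto simp: W_def\<close>)
  qed
  then have Gc: "smooth_at M p (\<lambda>q. G b (c q))" for b
    using smooth_atI[OF M W(1,2)] by blast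
  have c: "smooth_at M p (\<lambda>q. c q \<bullet> b + - (c p \<bullet> b))" for b
    by (intro smooth_at_add[OF M] smooth_at_coordinate[OF M V] smooth_at_const[OF M p])
  have vc: "v (\<lambda>q. c q \<bullet> b + - (c p \<bullet> b)) = v (\<lambda>q. c q \<bullet> b)" for b
  proof -
    have "v (\<lambda>q. c q \<bullet> b + - (c p \<bullet> b)) = v (\<lambda>q. c q \<bullet> b) + v (\<lambda>q. - (c p \<bullet> b))"
      by (rule tangent_add[OF M v smooth_at_coordinate[OF M V] smooth_at_const[OF M p]])
    then show ?thesis
      by (simp only: tangent_const[OF M v p] add_0_right)
  qed
  have "v f = v (\<lambda>q. f p + (\<Sum>b\<in>Basis. (c q \<bullet> b + - (c p \<bullet> b)) * G b (c q)))"
  proof (rule tangent_cong[OF M v True W(1,2)])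
    fix q assume "q \<in> W"
    then show "f q = f p + (\<Sum>b\<in>Basis. (c q \<bullet> b + - (c p \<bullet> b)) * G b (c q))"
      using G(3)[of "c q"] chart_inverse[OF M V(1)] V(2) by (auto simp: W_def inner_diff_left)
  qed
  also have "\<dots> = v (\<lambda>q. f p) + v (\<lambda>q. \<Sum>b\<in>Basis. (c q \<bullet> b + - (c p \<bullet> b)) * G b (c q))"
    by (intro tangent_add[OF M v] smooth_at_const[OF M p] smooth_at_sum[OF M p] smooth_at_mult[OF M] c Gc finite_Basis)
  also have "\<dots> = (\<Sum>b\<in>Basis. v (\<lambda>q. (c q \<bullet> b + - (c p \<bullet> b)) * G b (c q)))"
    using tangent_const[OF M v p] tangent_sum[OF M v p finite_Basis smooth_at_mult[OF M c Gc]] by simp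
  \<comment> \<open>In the Leibniz rule the term containing \<open>v\<close> of the coefficient is
    multiplied by the centred coordinate, which is 0 at \<open>p\<close>.\<close>
  also have "\<dots> = (\<Sum>b\<in>Basis. v (\<lambda>q. c q \<bullet> b) * G b (c p))"
    using tangent_mult[OF M v c Gc] by (simp add: vc[simplified])
  finally show ?thesis
    using True by (simp add: coord_vec_def G(2))
next
  case False
  then show ?thesis
    using tangent_nonsmooth[OF M v] by (simp add: coord_vec_def)
qed

lemma tangent_eqI:
  assumes "(V, c) \<in> atlas M" "p \<in> V" "u \<in> tangent_space M p" "v \<in> tangent_space M p"
    and "\<And>b. b \<in> Basis \<Longrightarrow> u (\<lambda>q. c q \<bullet> b) = v (\<lambda>q. c q \<bullet> b)"
  shows "u = v"
proof
  show "u f = v f" for f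
    unfolding tangent_expansion[OF assms(1,2,3), of f] tangent_expansion[OF assms(1,2,4), of f]
    by (intro sum.cong) (simp_all add: assms(5))
qed

section \<open>Vector fields\<close>

lemma smooth_vfield_on_subset: "smooth_vfield_on M U X \<Longrightarrow> W \<subseteq> U \<Longrightarrow> smooth_vfield_on M W X"
  unfolding smooth_vfield_on_def by blast

lemma smooth_vfieldD:
  "smooth_vfield_on M U X \<Longrightarrow> p \<in> U \<Longrightarrow> X p \<in> tangent_space M p"
  "smooth_vfield_on M U X \<Longrightarrow> openin (mtop M) V \<Longrightarrow> V \<subseteq> U \<Longrightarrow> smooth_fun M V f \<Longrightarrow>
    smooth_fun M V (\<lambda>p. X p f)"
  unfolding smooth_vfield_on_def by blast+

text \<open>By \<open>tangent_expansion\<close>, \<open>X p f\<close> is a sum of components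
  \<open>X p (\<lambda>q. c q \<bullet> b)\<close> times partial derivatives of \<open>f\<close>.
  Hence smooth components in one chart around each point suffice.\<close>

lemma smooth_vfieldI:
  assumes U: "openin (mtop M) U" and X: "\<And>p. p \<in> U \<Longrightarrow> X p \<in> tangent_space M p"
    and sm: "\<And>p. p \<in> U \<Longrightarrow> \<exists>V c W. (V, c) \<in> atlas M \<and> openin (mtop M) W \<and> p \<in> W \<and> W \<subseteq> V \<and>
      (\<forall>b\<in>Basis. smooth_fun M (U \<inter> W) (\<lambda>p. X p (\<lambda>q. c q \<bullet> b)))"
  shows "smooth_vfield_on M U X"
  unfolding smooth_vfield_on_def
proof (intro conjI ballI allI impI X)
  fix A f assume A: "openin (mtop M) A" "A \<subseteq> U" "smooth_fun M A f"
  show "smooth_fun M A (\<lambda>p. X p f)"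
  proof (rule smooth_fun_local[OF M])
    fix p assume p: "p \<in> A"
    with A(2) have "p \<in> U" by auto
    from sm[OF this] obtain V c W where V: "(V, c) \<in> atlas M"
      and W: "openin (mtop M) W" "p \<in> W" "W \<subseteq> V"
      and *: "\<forall>b\<in>Basis. smooth_fun M (U \<inter> W) (\<lambda>p. X p (\<lambda>q. c q \<bullet> b))"
      by (elim exE conjE)
    note sm = bspec[OF *]
    have AW: "openin (mtop M) (A \<inter> W)"
      using A(1) W(1) by auto
    have "smooth_fun M (A \<inter> W) (\<lambda>p. \<Sum>b\<in>Basis. X p (\<lambda>q. c q \<bullet> b) * coord_vec M V c b p f)"
      using A W by (intro smooth_fun_sum[OF M AW] smooth_fun_mult[OF M AW]
          smooth_vfieldD(2)[OF smooth_vfield_coord_vec[OF V] AW] smooth_fun_subset[OF A(3)]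
          smooth_fun_subset[OF sm]) auto
    then have "smooth_fun M (A \<inter> W) (\<lambda>p. X p f)"
      by (rule smooth_fun_cong[OF M AW, rotated])
        (use A W X in \<open>auto intro!: tangent_expansion[OF V, symmetric]\<close>)
    then show "\<exists>W. openin (mtop M) W \<and> p \<in> W \<and> smooth_fun M W (\<lambda>p. X p f)"
      using AW p W(2) by blast
  qed
qed

lemma smooth_vfield_on_local:
  assumes "openin (mtop M) U"
    and "\<And>p. p \<in> U \<Longrightarrow> \<exists>W. openin (mtop M) W \<and> p \<in> W \<and> smooth_vfield_on M W X"
  shows "smooth_vfield_on M U X"
  unfolding smooth_vfield_on_def
proof (intro conjI ballI allI impI)
  show "X p \<in> tangent_space M p" if "p \<in> U" for p
    using assms(2)[OF that] smooth_vfieldD(1) by blast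
  fix A f assume A: "openin (mtop M) A" "A \<subseteq> U" "smooth_fun M A f"
  show "smooth_fun M A (\<lambda>p. X p f)"
  proof (rule smooth_fun_local[OF M])
    fix p assume p: "p \<in> A"
    then obtain W where W: "openin (mtop M) W" "p \<in> W" "smooth_vfield_on M W X"
      using assms(2) A(2) by blast
    have "smooth_fun M (A \<inter> W) (\<lambda>p. X p f)"
      using A W by (intro smooth_vfieldD(2)[OF W(3)] smooth_fun_subset[OF A(3)]) auto
    then show "\<exists>W. openin (mtop M) W \<and> p \<in> W \<and> smooth_fun M W (\<lambda>p. X p f)"
      using A W p by (intro exI[of _ "A \<inter> W"]) auto
  qed
qed

lemma smooth_vfield_on_cong:
  assumes "openin (mtop M) U" "\<And>p. p \<in> U \<Longrightarrow> X p = Y p" "smooth_vfield_on M U X"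
  shows "smooth_vfield_on M U Y"
  unfolding smooth_vfield_on_def
proof (intro conjI ballI allI impI)
  show "Y p \<in> tangent_space M p" if "p \<in> U" for p
    using assms that smooth_vfieldD(1) by metis
  fix A f assume A: "openin (mtop M) A" "A \<subseteq> U" "smooth_fun M A f"
  show "smooth_fun M A (\<lambda>p. Y p f)"
    by (rule smooth_fun_cong[OF M A(1) _ smooth_vfieldD(2)[OF assms(3) A]]) (use A assms in auto)
qed

text \<open>\<open>\<chi>\<close> contains global fields only, so this is the passage from tangent
  vectors to assertions about \<open>\<chi>\<close>. The components of \<open>u\<close> are kept
  constant in a chart and cut off by a bump function.\<close>

lemma vector_field_extension:
  assumes p: "p \<in> points M" and u: "u \<in> tangent_space M p"
  obtains X where "X \<in> \<chi> M" "X p = u"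
proof -
  obtain V c where V: "(V, c) \<in> atlas M" "p \<in> V"
    using chart_exists[OF M p] .
  \<comment> \<open>A closed ball, so that \<open>K\<close>, its image under the inverse chart, is
    compact and therefore closed in the Hausdorff space. \<open>V\<close>, where the formula for
    \<open>X\<close> is smooth, and the open complement of \<open>K\<close>, where \<open>X\<close>
    vanishes, then cover \<open>M\<close>.\<close>
  obtain r where r: "r > 0" "cball (c p) r \<subseteq> c ` V"
    using open_contains_cball chart_open_range[OF M V(1)] V(2) by (metis imageI)
  obtain \<rho> :: "'e \<Rightarrow> real" where \<rho>: "smooth_on UNIV \<rho>" "\<rho> (c p) = 1" "\<And>x. x \<notin> ball (c p) r \<Longrightarrow> \<rho> x = 0"
    using smooth_bump[OF r(1), of "c p"] by metis
  define K where "K = inv_into V c ` cball (c p) r"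
  have "continuous_map (top_of_set (c ` V)) (subtopology (mtop M) V) (inv_into V c)"
  proof -
    have "homeomorphic_map (subtopology (mtop M) V) (top_of_set (c ` V)) c"
      by (rule chart_homeomorphic[OF M V(1)])
    then obtain g where g: "homeomorphic_maps (subtopology (mtop M) V) (top_of_set (c ` V)) c g"
      unfolding homeomorphic_map_maps by blast
    then have "continuous_map (top_of_set (c ` V)) (subtopology (mtop M) V) g"
      by (simp add: homeomorphic_maps_def)
    then show ?thesis
    proof (rule continuous_map_eq)
      fix x assume "x \<in> topspace (top_of_set (c ` V))"
      then obtain q where "q \<in> V" "x = c q" by auto
      then show "g x = inv_into V c x"
        using g chart_inverse[OF M V(1)] chart_subset[OF M V(1)]
        by (auto simp: homeomorphic_maps_def inf.absorb2)
    qed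
  qed
  moreover have "compactin (top_of_set (c ` V)) (cball (c p) r)"
    using r(2) by (simp add: compactin_subtopology)
  ultimately have "compactin (subtopology (mtop M) V) K"
    unfolding K_def by (rule image_compactin[rotated])
  then have "compactin (mtop M) K"
    by (simp add: compactin_subtopology)
  then have "closedin (mtop M) K"
    by (rule compactin_imp_closedin[OF Hausdorff_mtop[OF M]])
  then have outside: "openin (mtop M) (points M - K)"
    by (simp add: openin_diff)
  define X where "X q = (\<lambda>f. if q \<in> V
      then \<Sum>b\<in>Basis. (\<rho> (c q) * u (\<lambda>q. c q \<bullet> b)) * coord_vec M V c b q f else 0)" for q
  have X_tangent: "X q \<in> tangent_space M q" for q
    using tangent_space_sum[OF M finite_Basis coord_vec_tangent[OF V(1)]] tangent_zero[OF M]
    by (cases "q \<in> V") (auto simp: X_def)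
  have zero: "X q = 0\<^sub>t" if "q \<in> points M - K" for q
  proof (cases "q \<in> V")
    case True
    then have "c q \<notin> ball (c p) r"
      using that chart_inverse[OF M V(1) True] unfolding K_def by (metis DiffD2 ball_subset_cball imageI subsetD)
    from \<rho>(3)[OF this] show ?thesis by (simp add: X_def True)
  qed (simp add: X_def)
  have "smooth_vfield_on M (points M) X"
  proof (rule smooth_vfield_on_local)
    fix q assume "q \<in> points M"
    then consider "q \<in> V" | "q \<in> points M - K"
      using r(2) inv_into_into[of _ c V] unfolding K_def by blast
    then show "\<exists>W. openin (mtop M) W \<and> q \<in> W \<and> smooth_vfield_on M W X"
    proof cases
      case 1
      have "smooth_vfield_on M V X"
      proof (rule smooth_vfieldI[OF chart_openin[OF M V(1)] X_tangent], intro exI conjI ballI)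
        fix q b assume "q \<in> V" and b: "b \<in> (Basis :: 'e set)"
        have "smooth_fun M V (\<lambda>q. \<rho> (c q))"
          by (rule smooth_fun_chartI[OF M V(1) chart_openin[OF M V(1)] subset_refl],
              rule smooth_on_cong[OF chart_open_range[OF M V(1)] _ smooth_on_subset[OF \<rho>(1)]])
            (use chart_inverse[OF M V(1)] in auto)
        then have "smooth_fun M V (\<lambda>q. \<rho> (c q) * u (\<lambda>q. c q \<bullet> b))"
          by (intro smooth_fun_mult[OF M] smooth_fun_const[OF M] chart_openin[OF M V(1)])
        then have "smooth_fun M V (\<lambda>q. X q (\<lambda>q. c q \<bullet> b))"
          by (rule smooth_fun_cong[OF M chart_openin[OF M V(1)], rotated])
            (use b in \<open>auto simp: X_def coord_vec_coordinate[OF V(1)] inner_Basis if_distrib sum.delta cong: if_cong\<close>)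
        then show "smooth_fun M (V \<inter> V) (\<lambda>q. X q (\<lambda>q. c q \<bullet> b))"
          by simp
      qed (use V chart_openin[OF M V(1)] in auto)
      then show ?thesis
        using 1 chart_openin[OF M V(1)] by blast
    next
      case 2
      have "smooth_vfield_on M (points M - K) (\<lambda>q. 0\<^sub>t)"
        using tangent_zero[OF M] smooth_fun_const[OF M] by (simp add: smooth_vfield_on_def)
      then have "smooth_vfield_on M (points M - K) X"
        by (rule smooth_vfield_on_cong[OF outside, rotated]) (simp add: zero)
      then show ?thesis
        using 2 outside by blast
    qed
  qed simp
  moreover have "X p = u"
  proof
    show "X p f = u f" for f
      unfolding tangent_expansion[OF V u, of f] by (simp add: X_def \<rho>(2) V(2))
  qed
  ultimately show thesis
    using that by (simp add: vector_fields_def)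
qed

end

section \<open>Fibrewise linear maps, Lie brackets, tensoriality of the exterior derivative\<close>

text \<open>Singled out so that one expansion lemma serves 1-forms, the metric with one argument
  fixed, and a single coordinate of \<open>J\<close>.\<close>

definition linear_on_tangent :: "('a, 'e::euclidean_space) mfd \<Rightarrow> 'a \<Rightarrow> ('a tvec \<Rightarrow> real) \<Rightarrow> bool" where
  "linear_on_tangent M p L \<longleftrightarrow> (\<forall>u\<in>tangent_space M p. \<forall>v\<in>tangent_space M p. \<forall>a.
     L (u +\<^sub>t v) = L u + L v \<and> L (a *\<^sub>t u) = a * L u)"

lemma one_form_linear: "one_form M \<eta> \<Longrightarrow> p \<in> points M \<Longrightarrow> linear_on_tangent M p (\<eta> p)"
  by (simp add: one_form_def linear_on_tangent_def)

lemma linear_on_tangent_add: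
  assumes "linear_on_tangent M p L" "u \<in> tangent_space M p" "v \<in> tangent_space M p"
  shows "L (u +\<^sub>t v) = L u + L v"
  by (rule assms(1)[unfolded linear_on_tangent_def, THEN bspec, OF assms(2), THEN bspec, OF assms(3),
        THEN spec, THEN conjunct1])

lemma linear_on_tangent_scale:
  assumes "linear_on_tangent M p L" "u \<in> tangent_space M p"
  shows "L (a *\<^sub>t u) = a * L u"
  by (rule assms(1)[unfolded linear_on_tangent_def, THEN bspec, OF assms(2), THEN bspec, OF assms(2),
        THEN spec, THEN conjunct2])

context
  fixes M :: "('a, 'e::euclidean_space) mfd"
  assumes M: "smooth_manifold M"
begin

lemma linear_on_tangent_sum:
  assumes L: "linear_on_tangent M p L" and "finite A" "\<And>i. i \<in> A \<Longrightarrow> e i \<in> tangent_space M p"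
  shows "L (\<lambda>f. \<Sum>i\<in>A. a i * e i f) = (\<Sum>i\<in>A. a i * L (e i))"
  using assms(2,3)
proof (induction A rule: finite_induct)
  case empty
  have "L (0 *\<^sub>t 0\<^sub>t) = 0 * L 0\<^sub>t"
    by (rule linear_on_tangent_scale[OF L tangent_zero[OF M]])
  then show ?case by simp
next
  case (insert i A)
  have "L (a i *\<^sub>t e i +\<^sub>t (\<lambda>f. \<Sum>i\<in>A. a i * e i f)) = L (a i *\<^sub>t e i) + L (\<lambda>f. \<Sum>i\<in>A. a i * e i f)"
    using insert.prems insert.hyps
    by (intro linear_on_tangent_add[OF L] tangent_space_sum[OF M] tangent_space_scale[OF M]) auto
  moreover have "L (a i *\<^sub>t e i) = a i * L (e i)"
    using insert.prems by (intro linear_on_tangent_scale[OF L]) auto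
  ultimately show ?case
    using insert by simp
qed

lemma linear_on_tangent_expansion:
  assumes V: "(V, c) \<in> atlas M" "p \<in> V" and L: "linear_on_tangent M p L" and v: "v \<in> tangent_space M p"
  shows "L v = (\<Sum>b\<in>Basis. v (\<lambda>q. c q \<bullet> b) * L (coord_vec M V c b p))"
proof -
  have "L v = L (\<lambda>f. \<Sum>b\<in>Basis. v (\<lambda>q. c q \<bullet> b) * coord_vec M V c b p f)"
    by (rule arg_cong[of _ _ L], rule ext) (rule tangent_expansion[OF M V v])
  also have "\<dots> = (\<Sum>b\<in>Basis. v (\<lambda>q. c q \<bullet> b) * L (coord_vec M V c b p))"
    by (rule linear_on_tangent_sum[OF L finite_Basis coord_vec_tangent[OF M V]])
  finally show ?thesis .
qed

lemma vector_fieldD: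
  assumes "X \<in> \<chi> M"
  shows "p \<in> points M \<Longrightarrow> X p \<in> tangent_space M p"
    and "openin (mtop M) U \<Longrightarrow> smooth_fun M U f \<Longrightarrow> smooth_fun M U (\<lambda>q. X q f)"
    and "U \<subseteq> points M \<Longrightarrow> smooth_vfield_on M U X"
proof -
  have X: "smooth_vfield_on M (points M) X"
    using assms by (simp add: vector_fields_def)
  show "p \<in> points M \<Longrightarrow> X p \<in> tangent_space M p"
    by (rule smooth_vfieldD(1)[OF M X])
  show "smooth_fun M U (\<lambda>q. X q f)" if "openin (mtop M) U" "smooth_fun M U f"
    by (rule smooth_vfieldD(2)[OF M X that(1) openin_subset[OF that(1)] that(2)])
  show "smooth_vfield_on M U X" if "U \<subseteq> points M"
    by (rule smooth_vfield_on_subset[OF M X that])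
qed

lemma smooth_at_vector_field:
  assumes "X \<in> \<chi> M" "smooth_at M p f"
  shows "smooth_at M p (\<lambda>q. X q f)"
proof -
  obtain U where U: "openin (mtop M) U" "p \<in> U" "smooth_fun M U f"
    using assms(2) by (auto simp: smooth_at_def)
  show ?thesis
    by (rule smooth_atI[OF M U(1,2) vector_fieldD(2)[OF assms(1) U(1,3)]])
qed

text \<open>Needed in order to expand \<open>\<eta> p\<close> on the bracket. An iterated derivative
  is not a derivation, but the extra terms \<open>B f * A g + A f * B g\<close> in its product rule
  are symmetric in \<open>A\<close> and \<open>B\<close> and cancel in the commutator.\<close>

lemma lie_bracket_tangent:
  assumes X: "X \<in> \<chi> M" and Y: "Y \<in> \<chi> M" and p: "p \<in> points M"
  shows "lie_bracket M X Y p \<in> tangent_space M p"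
proof -
  have second_add: "A p (\<lambda>q. B q (\<lambda>x. f x + g x)) = A p (\<lambda>q. B q f) + A p (\<lambda>q. B q g)"
    and second_mult: "A p (\<lambda>q. B q (\<lambda>x. f x * g x)) =
      A p (\<lambda>q. B q f) * g p + B p f * A p g + A p f * B p g + f p * A p (\<lambda>q. B q g)"
    if A: "A \<in> \<chi> M" and B: "B \<in> \<chi> M" and f: "smooth_at M p f" and g: "smooth_at M p g" for A B f g
  proof -
    obtain U where U: "openin (mtop M) U" "p \<in> U" "smooth_fun M U f" "smooth_fun M U g"
      using smooth_at_common[OF M f g] .
    have at: "q \<in> U \<Longrightarrow> smooth_at M q f" "q \<in> U \<Longrightarrow> smooth_at M q g" "q \<in> U \<Longrightarrow> B q \<in> tangent_space M q" for q
      using U smooth_atI[OF M U(1)] openin_subset[OF U(1)] vector_fieldD(1)[OF B] by auto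
    note Ap = vector_fieldD(1)[OF A p]
    note Bf = smooth_at_vector_field[OF B f] and Bg = smooth_at_vector_field[OF B g]
    \<comment> \<open>The rules for \<open>B q\<close> are available only at points where
      \<open>f\<close> and \<open>g\<close> are smooth, that is on \<open>U\<close>.
      \<open>tangent_cong\<close> lets \<open>A p\<close> see nothing beyond
      \<open>U\<close>.\<close>
    have "A p (\<lambda>q. B q (\<lambda>x. f x + g x)) = A p (\<lambda>q. B q f + B q g)"
      by (rule tangent_cong[OF M Ap smooth_at_vector_field[OF B smooth_at_add[OF M f g]] U(1,2)])
        (rule tangent_add[OF M at(3,1,2)])
    also have "\<dots> = A p (\<lambda>q. B q f) + A p (\<lambda>q. B q g)"
      by (rule tangent_add[OF M Ap Bf Bg])
    finally show "A p (\<lambda>q. B q (\<lambda>x. f x + g x)) = A p (\<lambda>q. B q f) + A p (\<lambda>q. B q g)" .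
    have "A p (\<lambda>q. B q (\<lambda>x. f x * g x)) = A p (\<lambda>q. B q f * g q + f q * B q g)"
      by (rule tangent_cong[OF M Ap smooth_at_vector_field[OF B smooth_at_mult[OF M f g]] U(1,2)])
        (rule tangent_mult[OF M at(3,1,2)])
    also have "\<dots> = A p (\<lambda>q. B q f * g q) + A p (\<lambda>q. f q * B q g)"
      by (rule tangent_add[OF M Ap smooth_at_mult[OF M Bf g] smooth_at_mult[OF M f Bg]])
    also have "\<dots> = A p (\<lambda>q. B q f) * g p + B p f * A p g + A p f * B p g + f p * A p (\<lambda>q. B q g)"
      by (simp add: tangent_mult[OF M Ap Bf g] tangent_mult[OF M Ap f Bg])
    finally show "A p (\<lambda>q. B q (\<lambda>x. f x * g x)) =
      A p (\<lambda>q. B q f) * g p + B p f * A p g + A p f * B p g + f p * A p (\<lambda>q. B q g)" .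
  qed
  have second_scale: "A p (\<lambda>q. B q (\<lambda>x. a * f x)) = a * A p (\<lambda>q. B q f)"
    if A: "A \<in> \<chi> M" and B: "B \<in> \<chi> M" and f: "smooth_at M p f" for A B a f
  proof -
    obtain U where U: "openin (mtop M) U" "p \<in> U" "smooth_fun M U f"
      using f by (auto simp: smooth_at_def)
    have at: "q \<in> U \<Longrightarrow> smooth_at M q f" "q \<in> U \<Longrightarrow> B q \<in> tangent_space M q" for q
      using U smooth_atI[OF M U(1)] openin_subset[OF U(1)] vector_fieldD(1)[OF B] by auto
    have "A p (\<lambda>q. B q (\<lambda>x. a * f x)) = A p (\<lambda>q. a * B q f)"
      by (rule tangent_cong[OF M vector_fieldD(1)[OF A p]
            smooth_at_vector_field[OF B smooth_at_scale[OF M f]] U(1,2)])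
        (rule tangent_scale[OF M at(2,1)])
    also have "\<dots> = a * A p (\<lambda>q. B q f)"
      by (rule tangent_scale[OF M vector_fieldD(1)[OF A p] smooth_at_vector_field[OF B f]])
    finally show ?thesis .
  qed
  have second_cong: "A p (\<lambda>q. B q f) = A p (\<lambda>q. B q g)"
    if A: "A \<in> \<chi> M" and B: "B \<in> \<chi> M" and f: "smooth_at M p f" and U: "openin (mtop M) U" "p \<in> U"
      and eq: "\<And>x. x \<in> U \<Longrightarrow> f x = g x" for A B f g U
  proof -
    obtain W where W: "openin (mtop M) W" "p \<in> W" "smooth_fun M W f"
      using f by (auto simp: smooth_at_def)
    show ?thesis
    proof (rule tangent_cong[OF M vector_fieldD(1)[OF A p] smooth_at_vector_field[OF B f]])
      show "openin (mtop M) (U \<inter> W)" "p \<in> U \<inter> W"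
        using U W by auto
      show "B q f = B q g" if "q \<in> U \<inter> W" for q
        using that W openin_subset[OF W(1)] smooth_atI[OF M W(1) _ W(3)] eq
        by (intro tangent_cong[OF M vector_fieldD(1)[OF B] _ U(1)]) auto
    qed
  qed
  show ?thesis
  proof (rule tangent_spaceI[OF M])
    fix f g assume fg: "smooth_at M p f" "smooth_at M p g"
    show "lie_bracket M X Y p (\<lambda>x. f x + g x) = lie_bracket M X Y p f + lie_bracket M X Y p g"
      using second_add[OF X Y fg] second_add[OF Y X fg] fg smooth_at_add[OF M fg]
      by (simp add: lie_bracket_def)
    show "lie_bracket M X Y p (\<lambda>x. f x * g x) = lie_bracket M X Y p f * g p + f p * lie_bracket M X Y p g"
      using second_mult[OF X Y fg] second_mult[OF Y X fg] fg smooth_at_mult[OF M fg]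
      by (simp add: lie_bracket_def algebra_simps)
    fix U assume U: "openin (mtop M) U" "p \<in> U" and eq: "\<And>x. x \<in> U \<Longrightarrow> f x = g x"
    show "lie_bracket M X Y p f = lie_bracket M X Y p g"
      using second_cong[OF X Y fg(1) U eq] second_cong[OF Y X fg(1) U eq] fg
      by (simp add: lie_bracket_def)
  next
    fix a f assume f: "smooth_at M p f"
    show "lie_bracket M X Y p (\<lambda>x. a * f x) = a * lie_bracket M X Y p f"
      using second_scale[OF X Y f] second_scale[OF Y X f] f smooth_at_scale[OF M f]
      by (simp add: lie_bracket_def right_diff_distrib)
  qed (simp add: lie_bracket_def)
qed

text \<open>With \<open>Y\<close> expanded in coordinate fields, \<open>X \<eta>(Y)\<close> contains
  the derivatives of the components of \<open>Y\<close>; likewise with the roles exchanged. These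
  terms are exactly \<open>\<eta>([X, Y])\<close> and drop out, leaving an expression free of
  derivatives of components.\<close>

lemma ext_deriv_in_chart:
  assumes \<eta>: "one_form M \<eta>" and X: "X \<in> \<chi> M" and Y: "Y \<in> \<chi> M" and V: "(V, c) \<in> atlas M" "p \<in> V"
  shows "2 * ext_deriv M \<eta> X Y p = (\<Sum>b\<in>Basis.
      Y p (\<lambda>q. c q \<bullet> b) * X p (\<lambda>q. \<eta> q (coord_vec M V c b q)) -
      X p (\<lambda>q. c q \<bullet> b) * Y p (\<lambda>q. \<eta> q (coord_vec M V c b q)))"
proof -
  have VM: "V \<subseteq> points M" and Vo: "openin (mtop M) V" and p: "p \<in> points M"
    using chart_subset[OF M V(1)] chart_openin[OF M V(1)] V(2) by auto
  let ?\<eta> = "\<lambda>b q. \<eta> q (coord_vec M V c b q)"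
  have \<eta>_smooth: "smooth_at M p (?\<eta> b)" for b
    using \<eta> smooth_vfield_coord_vec[OF M V(1)] Vo unfolding one_form_def
    by (intro smooth_atI[OF M Vo V(2)]) blast
  have derivative: "A p (\<lambda>q. \<eta> q (B q)) = (\<Sum>b\<in>Basis. A p (\<lambda>q. B q (\<lambda>q. c q \<bullet> b)) * ?\<eta> b p +
      B p (\<lambda>q. c q \<bullet> b) * A p (?\<eta> b))" if A: "A \<in> \<chi> M" and B: "B \<in> \<chi> M" for A B
  proof -
    note Ap = vector_fieldD(1)[OF A p]
    have Bc: "smooth_at M p (\<lambda>q. B q (\<lambda>q. c q \<bullet> b))" for b
      by (rule smooth_at_vector_field[OF B smooth_at_coordinate[OF M V]])
    have "smooth_fun M (points M) (\<lambda>q. \<eta> q (B q))"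
      using \<eta> vector_fieldD(3)[OF B subset_refl] openin_topspace unfolding one_form_def by blast
    then have "smooth_at M p (\<lambda>q. \<eta> q (B q))"
      by (rule smooth_atI[OF M openin_topspace p])
    then have "A p (\<lambda>q. \<eta> q (B q)) = A p (\<lambda>q. \<Sum>b\<in>Basis. B q (\<lambda>q. c q \<bullet> b) * ?\<eta> b q)"
    proof (rule tangent_cong[OF M Ap _ Vo V(2)])
      fix q assume q: "q \<in> V"
      with VM have "q \<in> points M" by auto
      then show "\<eta> q (B q) = (\<Sum>b\<in>Basis. B q (\<lambda>q. c q \<bullet> b) * ?\<eta> b q)"
        by (intro linear_on_tangent_expansion[OF V(1) q one_form_linear[OF \<eta>] vector_fieldD(1)[OF B]])
    qed
    also have "\<dots> = (\<Sum>b\<in>Basis. A p (\<lambda>q. B q (\<lambda>q. c q \<bullet> b) * ?\<eta> b q))"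
      by (rule tangent_sum[OF M Ap p finite_Basis smooth_at_mult[OF M Bc \<eta>_smooth]])
    also have "\<dots> = (\<Sum>b\<in>Basis. A p (\<lambda>q. B q (\<lambda>q. c q \<bullet> b)) * ?\<eta> b p + B p (\<lambda>q. c q \<bullet> b) * A p (?\<eta> b))"
      by (rule sum.cong[OF refl tangent_mult[OF M Ap Bc \<eta>_smooth]])
    finally show ?thesis .
  qed
  have bracket: "\<eta> p (lie_bracket M X Y p) = (\<Sum>b\<in>Basis.
      (X p (\<lambda>q. Y q (\<lambda>q. c q \<bullet> b)) - Y p (\<lambda>q. X q (\<lambda>q. c q \<bullet> b))) * ?\<eta> b p)"
    unfolding linear_on_tangent_expansion[OF V one_form_linear[OF \<eta> p] lie_bracket_tangent[OF X Y p]]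
    by (simp add: lie_bracket_def smooth_at_coordinate[OF M V])
  show ?thesis
    unfolding ext_deriv_def derivative[OF X Y] derivative[OF Y X] bracket
    by (simp add: sum_subtractf[symmetric] algebra_simps)
qed

text \<open>The chart formula involves the two fields only through their values at \<open>p\<close>.
  This permits replacing arbitrary fields by convenient extensions of these values.\<close>

lemma ext_deriv_tensorial:
  assumes \<eta>: "one_form M \<eta>" and "X \<in> \<chi> M" "Y \<in> \<chi> M" "X' \<in> \<chi> M" "Y' \<in> \<chi> M"
    and p: "p \<in> points M" and "X p = X' p" "Y p = Y' p"
  shows "ext_deriv M \<eta> X Y p = ext_deriv M \<eta> X' Y' p"
proof -
  obtain V c where V: "(V, c) \<in> atlas M" "p \<in> V"
    using chart_exists[OF M p] .
  show ?thesis
    using ext_deriv_in_chart[OF \<eta> assms(2,3) V] ext_deriv_in_chart[OF \<eta> assms(4,5) V] assms(7,8) by simp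
qed

end

section \<open>Differentials\<close>

text \<open>Smoothness is phrased as pulling back smooth germs, the only property that pushing
  forward a derivation requires; no charts of the target are involved.\<close>

definition smooth_map ::
    "('a, 'e::euclidean_space) mfd \<Rightarrow> ('b, 'f::euclidean_space) mfd \<Rightarrow> ('a \<Rightarrow> 'b) \<Rightarrow> bool" where
  "smooth_map M N F \<longleftrightarrow> continuous_map (mtop M) (mtop N) F \<and>
     (\<forall>p\<in>points M. \<forall>f. smooth_at N (F p) f \<longrightarrow> smooth_at M p (\<lambda>x. f (F x)))"

lemma differential_tangent:
  assumes M: "smooth_manifold M" and N: "smooth_manifold N" and F: "smooth_map M N F"
    and p: "p \<in> points M" and v: "v \<in> tangent_space M p"
  shows "differential N F p v \<in> tangent_space N (F p)"
proof -
  have pull: "smooth_at M p (\<lambda>x. f (F x))" if "smooth_at N (F p) f" for f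
    using F p that by (simp add: smooth_map_def)
  have cong: "v (\<lambda>x. f (F x)) = v (\<lambda>x. g (F x))"
    if "smooth_at N (F p) f" "openin (mtop N) U" "F p \<in> U" "\<And>x. x \<in> U \<Longrightarrow> f x = g x" for f g U
  proof (rule tangent_cong[OF M v pull[OF that(1)]])
    show "openin (mtop M) {x \<in> points M. F x \<in> U}"
      using F that(2) by (auto simp: smooth_map_def intro: openin_continuous_map_preimage)
  qed (use p that in auto)
  show ?thesis
  proof (rule tangent_spaceI[OF N])
    fix f g U assume "smooth_at N (F p) f" "smooth_at N (F p) g" "openin (mtop N) U" "F p \<in> U"
      "\<And>x. x \<in> U \<Longrightarrow> f x = g x"
    with cong[of f U g] show "differential N F p v f = differential N F p v g"
      by (simp add: differential_def comp_def)
  qed (simp_all add: differential_def comp_def smooth_at_add[OF N] smooth_at_scale[OF N]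
      smooth_at_mult[OF N] tangent_add[OF M v pull pull] tangent_scale[OF M v pull]
      tangent_mult[OF M v pull pull])
qed

section \<open>Products of manifolds\<close>

lemma second_countable_prod_topology:
  assumes "second_countable X" "second_countable Y"
  shows "second_countable (prod_topology X Y)"
proof -
  obtain A B where A: "countable A" "\<forall>V\<in>A. openin X V"
    "\<forall>U x. openin X U \<and> x \<in> U \<longrightarrow> (\<exists>V\<in>A. x \<in> V \<and> V \<subseteq> U)"
    and B: "countable B" "\<forall>V\<in>B. openin Y V"
    "\<forall>U x. openin Y U \<and> x \<in> U \<longrightarrow> (\<exists>V\<in>B. x \<in> V \<and> V \<subseteq> U)"
    using assms unfolding second_countable_def by auto
  show ?thesis
    unfolding second_countable_def
  proof (intro exI[of _ "(\<lambda>(U, V). U \<times> V) ` (A \<times> B)"] conjI allI impI)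
    show "countable ((\<lambda>(U, V). U \<times> V) ` (A \<times> B))"
      using A(1) B(1) by auto
    show "\<forall>V\<in>(\<lambda>(U, V). U \<times> V) ` (A \<times> B). openin (prod_topology X Y) V"
      using A(2) B(2) by (auto simp: openin_prod_Times_iff)
    fix U z assume U: "openin (prod_topology X Y) U \<and> z \<in> U"
    then obtain S T where S: "openin X S" "fst z \<in> S" and T: "openin Y T" "snd z \<in> T" and ST: "S \<times> T \<subseteq> U"
      unfolding openin_prod_topology_alt by (metis prod.collapse)
    obtain S' where S': "S' \<in> A" "fst z \<in> S'" "S' \<subseteq> S"
      using A(3) S by blast
    obtain T' where T': "T' \<in> B" "snd z \<in> T'" "T' \<subseteq> T"
      using B(3) T by blast
    show "\<exists>V\<in>(\<lambda>(U, V). U \<times> V) ` (A \<times> B). z \<in> V \<and> V \<subseteq> U"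
      using S' T' ST by (intro bexI[of _ "S' \<times> T'"]) (auto simp: mem_Times_iff)
  qed
qed

lemma smooth_on_fst:
  assumes "open A" "open B" "smooth_on A f"
  shows "smooth_on (A \<times> B) (\<lambda>z. f (fst z))"
  by (rule smooth_on_compose[OF open_Times[OF assms(1,2)] assms(1)
        smooth_on_linear[OF bounded_linear_fst open_Times[OF assms(1,2)]] assms(3)]) auto

lemma smooth_on_snd:
  assumes "open A" "open B" "smooth_on B f"
  shows "smooth_on (A \<times> B) (\<lambda>z. f (snd z))"
  by (rule smooth_on_compose[OF open_Times[OF assms(1,2)] assms(2)
        smooth_on_linear[OF bounded_linear_snd open_Times[OF assms(1,2)]] assms(3)]) auto

text \<open>The smoothness notions refer to \<open>inv_into\<close> of a chart; for product charts
  it can thus be computed factor by factor.\<close>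

lemma inv_into_map_prod:
  assumes "inj_on c U" "inj_on d V" "x \<in> c ` U" "y \<in> d ` V"
  shows "inv_into (U \<times> V) (map_prod c d) (x, y) = (inv_into U c x, inv_into V d y)"
  using assms by (intro inv_into_f_eq map_prod_inj_on) (auto intro: inv_into_into simp: f_inv_into_f)

lemma map_prod_image_Int:
  "map_prod c d ` ((U \<times> V) \<inter> (U' \<times> V')) = c ` (U \<inter> U') \<times> d ` (V \<inter> V')"
  unfolding Times_Int_Times map_prod_surj_on[OF refl refl] ..

lemma mtop_prod [simp]: "mtop (prod_mfd M N) = prod_topology (mtop M) (mtop N)"
  by (simp add: prod_mfd_def)

lemma prod_chart:
  "(U, c) \<in> atlas M \<Longrightarrow> (V, d) \<in> atlas N \<Longrightarrow> (U \<times> V, map_prod c d) \<in> atlas (prod_mfd M N)"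
  by (auto simp: prod_mfd_def)

lemma prod_chartE:
  assumes "(A, e) \<in> atlas (prod_mfd M N)"
  obtains U c V d where "A = U \<times> V" "e = map_prod c d" "(U, c) \<in> atlas M" "(V, d) \<in> atlas N"
  using assms by (auto simp: prod_mfd_def)

context
  fixes M :: "('a, 'e::euclidean_space) mfd" and N :: "('b, 'f::euclidean_space) mfd"
  assumes M: "smooth_manifold M" and N: "smooth_manifold N"
begin

lemma smooth_manifold_prod: "smooth_manifold (prod_mfd M N)"
  unfolding smooth_manifold_def
proof (intro conjI)
  show "points (prod_mfd M N) \<noteq> {}"
    using M N by (auto simp: smooth_manifold_def)
  show "Hausdorff_space (mtop (prod_mfd M N))"
    using Hausdorff_mtop[OF M] Hausdorff_mtop[OF N] by (simp add: Hausdorff_space_prod_topology)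
  show "second_countable (mtop (prod_mfd M N))"
    using M N by (simp add: smooth_manifold_def second_countable_prod_topology)
  show "\<forall>(A, e)\<in>atlas (prod_mfd M N). openin (mtop (prod_mfd M N)) A \<and> open (e ` A) \<and>
      homeomorphic_map (subtopology (mtop (prod_mfd M N)) A) (top_of_set (e ` A)) e"
  proof clarify
    fix A e assume "(A, e) \<in> atlas (prod_mfd M N)"
    then obtain U c V d where eq: "A = U \<times> V" "e = map_prod c d"
      and U: "(U, c) \<in> atlas M" and V: "(V, d) \<in> atlas N"
      by (rule prod_chartE)
    have image: "e ` A = c ` U \<times> d ` V"
      unfolding eq by (rule map_prod_surj_on[OF refl refl])
    obtain c' d' where "homeomorphic_maps (subtopology (mtop M) U) (top_of_set (c ` U)) c c'"
      "homeomorphic_maps (subtopology (mtop N) V) (top_of_set (d ` V)) d d'"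
      using chart_homeomorphic[OF M U] chart_homeomorphic[OF N V] unfolding homeomorphic_map_maps by auto
    then have "homeomorphic_maps (prod_topology (subtopology (mtop M) U) (subtopology (mtop N) V))
        (prod_topology (top_of_set (c ` U)) (top_of_set (d ` V))) (\<lambda>(x, y). (c x, d y)) (\<lambda>(x, y). (c' x, d' y))"
      by (simp add: homeomorphic_maps_prod del: prod_topology_subtopology_eu)
    then have "homeomorphic_map (subtopology (mtop (prod_mfd M N)) A) (top_of_set (e ` A)) e"
      unfolding image unfolding eq map_prod_def mtop_prod subtopology_Times
      by (simp add: homeomorphic_maps_imp_map)
    then show "openin (mtop (prod_mfd M N)) A \<and> open (e ` A) \<and>
        homeomorphic_map (subtopology (mtop (prod_mfd M N)) A) (top_of_set (e ` A)) e"
      unfolding image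
      using chart_openin[OF M U] chart_openin[OF N V] chart_open_range[OF M U] chart_open_range[OF N V]
      by (simp add: eq openin_prod_Times_iff open_Times)
  qed
  show "(\<Union>(A, e)\<in>atlas (prod_mfd M N). A) = points (prod_mfd M N)"
  proof (rule set_eqI, rule iffI)
    fix z assume "z \<in> points (prod_mfd M N)"
    then have "fst z \<in> points M" "snd z \<in> points N" by auto
    then obtain U c V d where "(U, c) \<in> atlas M" "fst z \<in> U" "(V, d) \<in> atlas N" "snd z \<in> V"
      using chart_exists[OF M] chart_exists[OF N] by metis
    then show "z \<in> (\<Union>(A, e)\<in>atlas (prod_mfd M N). A)"
      using prod_chart by (intro UN_I[of "(U \<times> V, map_prod c d)"]) (auto simp: mem_Times_iff)
  next
    fix z assume "z \<in> (\<Union>(A, e)\<in>atlas (prod_mfd M N). A)"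
    then show "z \<in> points (prod_mfd M N)"
      using chart_subset[OF M] chart_subset[OF N] by (auto elim!: prod_chartE) blast+
  qed
  show "\<forall>(A, e)\<in>atlas (prod_mfd M N). \<forall>(A', e')\<in>atlas (prod_mfd M N).
      smooth_on (e ` (A \<inter> A')) (e' \<circ> inv_into A e)"
  proof clarify
    fix A e A' e' assume "(A, e) \<in> atlas (prod_mfd M N)" "(A', e') \<in> atlas (prod_mfd M N)"
    then obtain U c V d U' c' V' d' where eq: "A = U \<times> V" "e = map_prod c d" "A' = U' \<times> V'" "e' = map_prod c' d'"
      and U: "(U, c) \<in> atlas M" and V: "(V, d) \<in> atlas N" and U': "(U', c') \<in> atlas M" and V': "(V', d') \<in> atlas N"
      by (metis prod_chartE)
    have o: "open (c ` (U \<inter> U'))" "open (d ` (V \<inter> V'))"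
      using chart_Int_open[OF M chart_openin[OF M U'] U] chart_Int_open[OF N chart_openin[OF N V'] V]
      by (simp_all add: Int_commute)
    have "smooth_on (c ` (U \<inter> U') \<times> d ` (V \<inter> V'))
        (\<lambda>z. ((c' \<circ> inv_into U c) (fst z), (d' \<circ> inv_into V d) (snd z)))"
      by (rule smooth_on_Pair[OF open_Times[OF o] smooth_on_fst[OF o chart_transition[OF M U U']]
            smooth_on_snd[OF o chart_transition[OF N V V']]])
    then show "smooth_on (e ` (A \<inter> A')) (e' \<circ> inv_into A e)"
      unfolding eq map_prod_image_Int
      by (rule smooth_on_cong[OF open_Times[OF o], rotated])
        (auto simp: inv_into_map_prod chart_inj_on[OF M U] chart_inj_on[OF N V])
  qed
qed

lemma smooth_fun_fst:
  assumes U: "openin (mtop M) U" and f: "smooth_fun M U f"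
  shows "smooth_fun (prod_mfd M N) (U \<times> points N) (\<lambda>z. f (fst z))"
  unfolding smooth_fun_def
proof clarify
  fix A e assume "(A, e) \<in> atlas (prod_mfd M N)"
  then obtain V c W d where eq: "A = V \<times> W" "e = map_prod c d"
    and V: "(V, c) \<in> atlas M" and W: "(W, d) \<in> atlas N"
    by (rule prod_chartE)
  have o: "open (c ` (U \<inter> V))" "open (d ` (points N \<inter> W))"
    by (rule chart_Int_open[OF M U V], rule chart_Int_open[OF N openin_topspace W])
  have "smooth_on (c ` (U \<inter> V)) (f \<circ> inv_into V c)"
    using f V by (auto simp: smooth_fun_def)
  then have "smooth_on (c ` (U \<inter> V) \<times> d ` (points N \<inter> W)) (\<lambda>z. (f \<circ> inv_into V c) (fst z))"
    by (rule smooth_on_fst[OF o])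
  then show "smooth_on (e ` (U \<times> points N \<inter> A)) ((\<lambda>z. f (fst z)) \<circ> inv_into A e)"
    unfolding eq map_prod_image_Int
    by (rule smooth_on_cong[OF open_Times[OF o], rotated])
      (auto simp: inv_into_map_prod chart_inj_on[OF M V] chart_inj_on[OF N W])
qed

lemma smooth_fun_snd:
  assumes U: "openin (mtop N) U" and f: "smooth_fun N U f"
  shows "smooth_fun (prod_mfd M N) (points M \<times> U) (\<lambda>z. f (snd z))"
  unfolding smooth_fun_def
proof clarify
  fix A e assume "(A, e) \<in> atlas (prod_mfd M N)"
  then obtain V c W d where eq: "A = V \<times> W" "e = map_prod c d"
    and V: "(V, c) \<in> atlas M" and W: "(W, d) \<in> atlas N"
    by (rule prod_chartE)
  have o: "open (c ` (points M \<inter> V))" "open (d ` (U \<inter> W))"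
    by (rule chart_Int_open[OF M openin_topspace V], rule chart_Int_open[OF N U W])
  have "smooth_on (d ` (U \<inter> W)) (f \<circ> inv_into W d)"
    using f W by (auto simp: smooth_fun_def)
  then have "smooth_on (c ` (points M \<inter> V) \<times> d ` (U \<inter> W)) (\<lambda>z. (f \<circ> inv_into W d) (snd z))"
    by (rule smooth_on_snd[OF o])
  then show "smooth_on (e ` (points M \<times> U \<inter> A)) ((\<lambda>z. f (snd z)) \<circ> inv_into A e)"
    unfolding eq map_prod_image_Int
    by (rule smooth_on_cong[OF open_Times[OF o], rotated])
      (auto simp: inv_into_map_prod chart_inj_on[OF M V] chart_inj_on[OF N W])
qed

lemma smooth_map_fst: "smooth_map (prod_mfd M N) M fst"
  unfolding smooth_map_def
proof (intro conjI ballI allI impI)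
  show "continuous_map (mtop (prod_mfd M N)) (mtop M) fst"
    by (simp add: continuous_map_fst)
  fix z f assume "z \<in> points (prod_mfd M N)" "smooth_at M (fst z) f"
  then obtain U where U: "openin (mtop M) U" "fst z \<in> U" "smooth_fun M U f" and "snd z \<in> points N"
    by (auto simp: smooth_at_def)
  then show "smooth_at (prod_mfd M N) z (\<lambda>x. f (fst x))"
    by (intro smooth_atI[OF smooth_manifold_prod _ _ smooth_fun_fst[OF U(1,3)]])
      (auto simp: openin_prod_Times_iff mem_Times_iff)
qed

lemma smooth_map_snd: "smooth_map (prod_mfd M N) N snd"
  unfolding smooth_map_def
proof (intro conjI ballI allI impI)
  show "continuous_map (mtop (prod_mfd M N)) (mtop N) snd"
    by (simp add: continuous_map_snd)
  fix z f assume "z \<in> points (prod_mfd M N)" "smooth_at N (snd z) f"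
  then obtain U where U: "openin (mtop N) U" "snd z \<in> U" "smooth_fun N U f" and "fst z \<in> points M"
    by (auto simp: smooth_at_def)
  then show "smooth_at (prod_mfd M N) z (\<lambda>x. f (snd x))"
    by (intro smooth_atI[OF smooth_manifold_prod _ _ smooth_fun_snd[OF U(1,3)]])
      (auto simp: openin_prod_Times_iff mem_Times_iff)
qed

text \<open>A neighbourhood in the product topology contains a box inside a product chart. There the
  two groups of variables are independent, and slices become compositions with affine
  inclusions.\<close>

lemma smooth_at_box:
  assumes z: "(p, q) \<in> points (prod_mfd M N)" and F: "smooth_at (prod_mfd M N) (p, q) F"
  obtains V c A W d B where "(V, c) \<in> atlas M" "openin (mtop M) A" "A \<subseteq> V" "p \<in> A"
    "(W, d) \<in> atlas N" "openin (mtop N) B" "B \<subseteq> W" "q \<in> B"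
    "smooth_on (c ` A \<times> d ` B) (\<lambda>(x, y). F (inv_into V c x, inv_into W d y))"
proof -
  obtain U where U: "openin (prod_topology (mtop M) (mtop N)) U" "(p, q) \<in> U" "smooth_fun (prod_mfd M N) U F"
    using F by (auto simp: smooth_at_def)
  obtain A B where AB: "openin (mtop M) A" "openin (mtop N) B" "p \<in> A" "q \<in> B" "A \<times> B \<subseteq> U"
    using U(1,2) unfolding openin_prod_topology_alt by meson
  obtain V c where V: "(V, c) \<in> atlas M" "p \<in> V"
    using chart_exists[OF M, of p] z by auto
  obtain W d where W: "(W, d) \<in> atlas N" "q \<in> W"
    using chart_exists[OF N, of q] z by auto
  have o: "open (c ` (A \<inter> V))" "open (d ` (B \<inter> W))"
    by (rule chart_Int_open[OF M AB(1) V(1)], rule chart_Int_open[OF N AB(2) W(1)])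
  have "smooth_on (map_prod c d ` (U \<inter> (V \<times> W))) (F \<circ> inv_into (V \<times> W) (map_prod c d))"
    using U(3) prod_chart[OF V(1) W(1)] unfolding smooth_fun_def by blast
  moreover have "c ` (A \<inter> V) \<times> d ` (B \<inter> W) \<subseteq> map_prod c d ` (U \<inter> (V \<times> W))"
    using AB(5) unfolding map_prod_image_Int[symmetric] by auto
  ultimately have "smooth_on (c ` (A \<inter> V) \<times> d ` (B \<inter> W)) (F \<circ> inv_into (V \<times> W) (map_prod c d))"
    by (rule smooth_on_subset)
  then have "smooth_on (c ` (A \<inter> V) \<times> d ` (B \<inter> W)) (\<lambda>(x, y). F (inv_into V c x, inv_into W d y))"
    by (rule smooth_on_cong[OF open_Times[OF o], rotated])
      (auto simp: inv_into_map_prod chart_inj_on[OF M V(1)] chart_inj_on[OF N W(1)])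
  moreover have "openin (mtop M) (A \<inter> V)" "openin (mtop N) (B \<inter> W)"
    using AB chart_openin[OF M V(1)] chart_openin[OF N W(1)] by auto
  ultimately show thesis
    using that[of V c "A \<inter> V" W d "B \<inter> W"] V W AB by auto
qed

lemma smooth_at_slice_fst:
  assumes z: "(p, q) \<in> points (prod_mfd M N)" and F: "smooth_at (prod_mfd M N) (p, q) F"
  shows "smooth_at M p (\<lambda>x. F (x, q))"
proof -
  obtain V c A W d B where V: "(V, c) \<in> atlas M" and A: "openin (mtop M) A" "A \<subseteq> V" "p \<in> A"
    and W: "(W, d) \<in> atlas N" and B: "openin (mtop N) B" "B \<subseteq> W" "q \<in> B"
    and sm: "smooth_on (c ` A \<times> d ` B) (\<lambda>(x, y). F (inv_into V c x, inv_into W d y))"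
    using smooth_at_box[OF z F] .
  have o: "open (c ` A)" "open (d ` B)"
    by (rule chart_image_open[OF M V A(1,2)], rule chart_image_open[OF N W B(1,2)])
  have "smooth_on (c ` A) (\<lambda>x. (\<lambda>(x, y). F (inv_into V c x, inv_into W d y)) (x, d q))"
    by (rule smooth_on_compose[OF o(1) open_Times[OF o]
          smooth_on_Pair[OF o(1) smooth_on_id[OF o(1)] smooth_on_const[OF o(1)]] sm]) (use B in auto)
  then have "smooth_on (c ` A) ((\<lambda>x. F (x, q)) \<circ> inv_into V c)"
    using B chart_inverse[OF N W, of q] by (auto simp: comp_def)
  then show ?thesis
    by (rule smooth_atI[OF M A(1,3) smooth_fun_chartI[OF M V A(1,2)]])
qed

lemma smooth_at_slice_snd:
  assumes z: "(p, q) \<in> points (prod_mfd M N)" and F: "smooth_at (prod_mfd M N) (p, q) F"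
  shows "smooth_at N q (\<lambda>y. F (p, y))"
proof -
  obtain V c A W d B where V: "(V, c) \<in> atlas M" and A: "openin (mtop M) A" "A \<subseteq> V" "p \<in> A"
    and W: "(W, d) \<in> atlas N" and B: "openin (mtop N) B" "B \<subseteq> W" "q \<in> B"
    and sm: "smooth_on (c ` A \<times> d ` B) (\<lambda>(x, y). F (inv_into V c x, inv_into W d y))"
    using smooth_at_box[OF z F] .
  have o: "open (c ` A)" "open (d ` B)"
    by (rule chart_image_open[OF M V A(1,2)], rule chart_image_open[OF N W B(1,2)])
  have "smooth_on (d ` B) (\<lambda>y. (\<lambda>(x, y). F (inv_into V c x, inv_into W d y)) (c p, y))"
    by (rule smooth_on_compose[OF o(2) open_Times[OF o]
          smooth_on_Pair[OF o(2) smooth_on_const[OF o(2)] smooth_on_id[OF o(2)]] sm]) (use A in auto)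
  then have "smooth_on (d ` B) ((\<lambda>y. F (p, y)) \<circ> inv_into W d)"
    using A chart_inverse[OF M V, of p] by (auto simp: comp_def)
  then show ?thesis
    by (rule smooth_atI[OF N B(1,3) smooth_fun_chartI[OF N W B(1,2)]])
qed

section \<open>The tangent space of a product\<close>

lemma smooth_map_slice_fst: "q \<in> points N \<Longrightarrow> smooth_map M (prod_mfd M N) (\<lambda>x. (x, q))"
  unfolding smooth_map_def using smooth_at_slice_fst
  by (auto intro!: continuous_map_pairedI simp: continuous_map_id[unfolded id_def])

lemma smooth_map_slice_snd: "p \<in> points M \<Longrightarrow> smooth_map N (prod_mfd M N) (\<lambda>y. (p, y))"
  unfolding smooth_map_def using smooth_at_slice_snd
  by (auto intro!: continuous_map_pairedI simp: continuous_map_id[unfolded id_def])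

lemma differential_fst_tangent:
  "z \<in> points (prod_mfd M N) \<Longrightarrow> v \<in> tangent_space (prod_mfd M N) z \<Longrightarrow>
    differential M fst z v \<in> tangent_space M (fst z)"
  by (rule differential_tangent[OF smooth_manifold_prod M smooth_map_fst])

lemma differential_snd_tangent:
  "z \<in> points (prod_mfd M N) \<Longrightarrow> v \<in> tangent_space (prod_mfd M N) z \<Longrightarrow>
    differential N snd z v \<in> tangent_space N (snd z)"
  by (rule differential_tangent[OF smooth_manifold_prod N smooth_map_snd])

text \<open>\<open>tpair\<close> is the sum of the pushforwards along the two slice inclusions
  through \<open>z\<close>.\<close>

lemma tpair_tangent:
  assumes z: "z \<in> points (prod_mfd M N)" and u: "u \<in> tangent_space M (fst z)" and w: "w \<in> tangent_space N (snd z)"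
  shows "tpair M N z u w \<in> tangent_space (prod_mfd M N) z"
proof -
  have p: "fst z \<in> points M" "snd z \<in> points N" using z by auto
  have "tpair M N z u w = differential (prod_mfd M N) (\<lambda>x. (x, snd z)) (fst z) u +\<^sub>t
      differential (prod_mfd M N) (\<lambda>y. (fst z, y)) (snd z) w"
    by (auto simp: tpair_def differential_def comp_def)
  moreover have "differential (prod_mfd M N) (\<lambda>x. (x, snd z)) (fst z) u \<in> tangent_space (prod_mfd M N) z"
    using differential_tangent[OF M smooth_manifold_prod smooth_map_slice_fst[OF p(2)] p(1) u] by simp
  moreover have "differential (prod_mfd M N) (\<lambda>y. (fst z, y)) (snd z) w \<in> tangent_space (prod_mfd M N) z"
    using differential_tangent[OF N smooth_manifold_prod smooth_map_slice_snd[OF p(1)] p(2) w] by simp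
  ultimately show ?thesis
    using tangent_space_add[OF smooth_manifold_prod] by simp
qed

lemma tpair_apply_fst:
  assumes z: "z \<in> points (prod_mfd M N)" and w: "w \<in> tangent_space N (snd z)" and f: "smooth_at M (fst z) f"
  shows "tpair M N z u w (\<lambda>x. f (fst x)) = u f"
proof -
  have "snd z \<in> points N" using z by auto
  then have "w (\<lambda>y. f (fst z)) = 0"
    by (rule tangent_const[OF N w])
  moreover have "smooth_at (prod_mfd M N) z (\<lambda>x. f (fst x))"
    using smooth_map_fst z f unfolding smooth_map_def by blast
  ultimately show ?thesis
    by (simp add: tpair_def)
qed

lemma tpair_apply_snd:
  assumes z: "z \<in> points (prod_mfd M N)" and u: "u \<in> tangent_space M (fst z)" and f: "smooth_at N (snd z) f"
  shows "tpair M N z u w (\<lambda>x. f (snd x)) = w f"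
proof -
  have "fst z \<in> points M" using z by auto
  then have "u (\<lambda>x. f (snd z)) = 0"
    by (rule tangent_const[OF M u])
  moreover have "smooth_at (prod_mfd M N) z (\<lambda>x. f (snd x))"
    using smooth_map_snd z f unfolding smooth_map_def by blast
  ultimately show ?thesis
    by (simp add: tpair_def)
qed

lemma differential_fst_tpair:
  assumes z: "z \<in> points (prod_mfd M N)" and u: "u \<in> tangent_space M (fst z)" and w: "w \<in> tangent_space N (snd z)"
  shows "differential M fst z (tpair M N z u w) = u"
proof
  show "differential M fst z (tpair M N z u w) f = u f" for f
    using tpair_apply_fst[OF z w] tangent_nonsmooth[OF M u] by (simp add: differential_def comp_def)
qed

lemma differential_snd_tpair:
  assumes z: "z \<in> points (prod_mfd M N)" and u: "u \<in> tangent_space M (fst z)" and w: "w \<in> tangent_space N (snd z)"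
  shows "differential N snd z (tpair M N z u w) = w"
proof
  show "differential N snd z (tpair M N z u w) f = w f" for f
    using tpair_apply_snd[OF z u] tangent_nonsmooth[OF N w] by (simp add: differential_def comp_def)
qed

lemma prod_coordinate_cases:
  assumes "b \<in> (Basis :: ('e \<times> 'f) set)"
  obtains b' where "b' \<in> Basis" "(\<lambda>x. map_prod c d x \<bullet> b) = (\<lambda>x. c (fst x) \<bullet> b')"
  | b' where "b' \<in> Basis" "(\<lambda>x. map_prod c d x \<bullet> b) = (\<lambda>x. d (snd x) \<bullet> b')"
proof -
  from assms consider b' where "b' \<in> Basis" "b = (b', 0)" | b' where "b' \<in> Basis" "b = (0, b')"
    by (auto simp: Basis_prod_def)
  then show thesis
    by cases (use that in \<open>auto simp: inner_prod_def\<close>)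
qed

text \<open>A germ on the product need not be a sum of germs on the factors, so the two sides cannot
  be compared on it directly. They agree on the coordinates of a product chart, each of which
  depends on one factor only, and coordinates determine a tangent vector.\<close>

lemma tangent_decompose:
  assumes z: "z \<in> points (prod_mfd M N)" and v: "v \<in> tangent_space (prod_mfd M N) z"
  shows "tpair M N z (differential M fst z v) (differential N snd z v) = v"
proof -
  have p: "fst z \<in> points M" "snd z \<in> points N" using z by auto
  obtain V c where V: "(V, c) \<in> atlas M" "fst z \<in> V" using chart_exists[OF M p(1)] .
  obtain W d where W: "(W, d) \<in> atlas N" "snd z \<in> W" using chart_exists[OF N p(2)] .
  note t = differential_fst_tangent[OF z v] differential_snd_tangent[OF z v]
  show ?thesis
  proof (rule tangent_eqI[OF smooth_manifold_prod prod_chart[OF V(1) W(1)] _ tpair_tangent[OF z t] v])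
    show "z \<in> V \<times> W" using V W by (simp add: mem_Times_iff)
    fix b :: "'e \<times> 'f" assume "b \<in> Basis"
    then show "tpair M N z (differential M fst z v) (differential N snd z v) (\<lambda>q. map_prod c d q \<bullet> b) =
        v (\<lambda>q. map_prod c d q \<bullet> b)"
    proof (cases rule: prod_coordinate_cases[of b c d])
      case (1 b')
      have sm: "smooth_at M (fst z) (\<lambda>x. c x \<bullet> b')"
        by (rule smooth_at_coordinate[OF M V])
      show ?thesis
        unfolding 1(2) using tpair_apply_fst[OF z t(2) sm] sm by (simp add: differential_def comp_def)
    next
      case (2 b')
      have sm: "smooth_at N (snd z) (\<lambda>x. d x \<bullet> b')"
        by (rule smooth_at_coordinate[OF N W])
      show ?thesis
        unfolding 2(2) using tpair_apply_snd[OF z t(1) sm] sm by (simp add: differential_def comp_def)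
    qed
  qed
qed

text \<open>\<open>smooth_vfieldI\<close> for product charts, whose coordinates are those of the two
  factors.\<close>

lemma prod_vfieldI:
  assumes U: "openin (prod_topology (mtop M) (mtop N)) U"
    and X: "\<And>z. z \<in> U \<Longrightarrow> X z \<in> tangent_space (prod_mfd M N) z"
    and fst: "\<And>V c W d b. (V, c) \<in> atlas M \<Longrightarrow> (W, d) \<in> atlas N \<Longrightarrow>
      smooth_fun (prod_mfd M N) (U \<inter> (V \<times> W)) (\<lambda>z. X z (\<lambda>x. c (fst x) \<bullet> b))"
    and snd: "\<And>V c W d b. (V, c) \<in> atlas M \<Longrightarrow> (W, d) \<in> atlas N \<Longrightarrow>
      smooth_fun (prod_mfd M N) (U \<inter> (V \<times> W)) (\<lambda>z. X z (\<lambda>x. d (snd x) \<bullet> b))"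
  shows "smooth_vfield_on (prod_mfd M N) U X"
proof (rule smooth_vfieldI[OF smooth_manifold_prod _ X])
  show "openin (mtop (prod_mfd M N)) U" using U by simp
  fix z assume z: "z \<in> U"
  then have "fst z \<in> points M" "snd z \<in> points N"
    using openin_subset[OF U] by auto
  then obtain V c W d where V: "(V, c) \<in> atlas M" "fst z \<in> V" and W: "(W, d) \<in> atlas N" "snd z \<in> W"
    using chart_exists[OF M] chart_exists[OF N] by metis
  have VW: "openin (mtop (prod_mfd M N)) (V \<times> W)"
    by (rule chart_openin[OF smooth_manifold_prod prod_chart[OF V(1) W(1)]])
  have "smooth_fun (prod_mfd M N) (U \<inter> (V \<times> W)) (\<lambda>z. X z (\<lambda>x. map_prod c d x \<bullet> b))" if b: "b \<in> Basis" for b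
    using b
  proof (cases rule: prod_coordinate_cases[of b c d])
    case (1 b')
    show ?thesis unfolding 1(2) by (rule fst[OF V(1) W(1)])
  next
    case (2 b')
    show ?thesis unfolding 2(2) by (rule snd[OF V(1) W(1)])
  qed
  then show "\<exists>A e B. (A, e) \<in> atlas (prod_mfd M N) \<and> openin (mtop (prod_mfd M N)) B \<and> z \<in> B \<and> B \<subseteq> A \<and>
      (\<forall>b\<in>Basis. smooth_fun (prod_mfd M N) (U \<inter> B) (\<lambda>z. X z (\<lambda>x. e x \<bullet> b)))"
    using prod_chart[OF V(1) W(1)] VW V(2) W(2)
    by (intro exI[of _ "V \<times> W"] exI[of _ "map_prod c d"]) (simp add: mem_Times_iff)
qed

lemma vector_field_tpair:
  assumes X: "X \<in> \<chi> M" and Y: "Y \<in> \<chi> N"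
  shows "(\<lambda>z. tpair M N z (X (fst z)) (Y (snd z))) \<in> \<chi> (prod_mfd M N)"
  unfolding vector_fields_def mem_Collect_eq
proof (rule prod_vfieldI)
  have t: "X (fst z) \<in> tangent_space M (fst z)" "Y (snd z) \<in> tangent_space N (snd z)"
    if "z \<in> points (prod_mfd M N)" for z
    using vector_fieldD(1)[OF M X] vector_fieldD(1)[OF N Y] that by auto
  show "openin (prod_topology (mtop M) (mtop N)) (points (prod_mfd M N))"
    using openin_topspace[of "mtop (prod_mfd M N)"] by simp
  show "tpair M N z (X (fst z)) (Y (snd z)) \<in> tangent_space (prod_mfd M N) z"
    if "z \<in> points (prod_mfd M N)" for z
    by (rule tpair_tangent[OF that t[OF that]])
  fix V c W d
  assume V: "(V, c) \<in> atlas M" and W: "(W, d) \<in> atlas N"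
  have open_VW: "openin (mtop (prod_mfd M N)) (points (prod_mfd M N) \<inter> (V \<times> W))"
    using chart_openin[OF smooth_manifold_prod prod_chart[OF V W]] openin_topspace by blast
  have VW: "points (prod_mfd M N) \<inter> (V \<times> W) \<subseteq> V \<times> points N"
    "points (prod_mfd M N) \<inter> (V \<times> W) \<subseteq> points M \<times> W"
    by auto
  show "smooth_fun (prod_mfd M N) (points (prod_mfd M N) \<inter> (V \<times> W))
      (\<lambda>z. tpair M N z (X (fst z)) (Y (snd z)) (\<lambda>x. c (fst x) \<bullet> b))" for b
  proof (rule smooth_fun_cong[OF smooth_manifold_prod open_VW])
    show "smooth_fun (prod_mfd M N) (points (prod_mfd M N) \<inter> (V \<times> W)) (\<lambda>z. X (fst z) (\<lambda>x. c x \<bullet> b))"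
      by (rule smooth_fun_subset[OF smooth_fun_fst[OF chart_openin[OF M V]
              vector_fieldD(2)[OF M X chart_openin[OF M V] smooth_fun_coordinate[OF M V]]] VW(1)])
    show "X (fst z) (\<lambda>x. c x \<bullet> b) = tpair M N z (X (fst z)) (Y (snd z)) (\<lambda>x. c (fst x) \<bullet> b)"
      if "z \<in> points (prod_mfd M N) \<inter> (V \<times> W)" for z
      using that t(2) by (intro tpair_apply_fst[symmetric] smooth_at_coordinate[OF M V]) auto
  qed
  show "smooth_fun (prod_mfd M N) (points (prod_mfd M N) \<inter> (V \<times> W))
      (\<lambda>z. tpair M N z (X (fst z)) (Y (snd z)) (\<lambda>x. d (snd x) \<bullet> b))" for b
  proof (rule smooth_fun_cong[OF smooth_manifold_prod open_VW])
    show "smooth_fun (prod_mfd M N) (points (prod_mfd M N) \<inter> (V \<times> W)) (\<lambda>z. Y (snd z) (\<lambda>x. d x \<bullet> b))"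
      by (rule smooth_fun_subset[OF smooth_fun_snd[OF chart_openin[OF N W]
              vector_fieldD(2)[OF N Y chart_openin[OF N W] smooth_fun_coordinate[OF N W]]] VW(2)])
    show "Y (snd z) (\<lambda>x. d x \<bullet> b) = tpair M N z (X (fst z)) (Y (snd z)) (\<lambda>x. d (snd x) \<bullet> b)"
      if "z \<in> points (prod_mfd M N) \<inter> (V \<times> W)" for z
      using that t(1) by (intro tpair_apply_snd[symmetric] smooth_at_coordinate[OF N W]) auto
  qed
qed

text \<open>The projection of \<open>X z\<close> to \<open>M\<close> depends on all of
  \<open>z\<close>, so it is a field along \<open>fst\<close> rather than a field on
  \<open>M\<close>, and smoothness of a tensor on \<open>M\<close> does not apply to it directly.
  Expansion in the coordinate fields of \<open>M\<close> leaves products of \<open>X z\<close>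
  applied to pulled-back coordinates and pulled-back functions on \<open>M\<close>.\<close>

lemma smooth_fun_contract_fst:
  assumes U: "openin (prod_topology (mtop M) (mtop N)) U" and X: "smooth_vfield_on (prod_mfd M N) U X"
    and V: "(V, c) \<in> atlas M"
    and L: "\<And>p. p \<in> V \<Longrightarrow> linear_on_tangent M p (L p)"
    and sm: "\<And>b. smooth_fun M V (\<lambda>p. L p (coord_vec M V c b p))"
  shows "smooth_fun (prod_mfd M N) (U \<inter> (V \<times> points N)) (\<lambda>z. L (fst z) (differential M fst z (X z)))"
proof -
  let ?A = "U \<inter> (V \<times> points N)"
  have VN: "openin (prod_topology (mtop M) (mtop N)) (V \<times> points N)"
    using chart_openin[OF M V] by (simp add: openin_prod_Times_iff)
  with U have A: "openin (mtop (prod_mfd M N)) ?A" by auto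
  have "smooth_fun (prod_mfd M N) ?A
      (\<lambda>z. \<Sum>b\<in>Basis. X z (\<lambda>x. c (fst x) \<bullet> b) * L (fst z) (coord_vec M V c b (fst z)))"
    by (intro smooth_fun_sum[OF smooth_manifold_prod A] smooth_fun_mult[OF smooth_manifold_prod A]
        smooth_vfieldD(2)[OF smooth_manifold_prod X A] Int_lower1
        smooth_fun_subset[OF smooth_fun_fst[OF chart_openin[OF M V] sm] Int_lower2]
        smooth_fun_subset[OF smooth_fun_fst[OF chart_openin[OF M V] smooth_fun_coordinate[OF M V]] Int_lower2])
  then show ?thesis
  proof (rule smooth_fun_cong[OF smooth_manifold_prod A, rotated])
    fix z assume "z \<in> ?A"
    then have z: "z \<in> U" "fst z \<in> V" "z \<in> points (prod_mfd M N)"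
      using openin_subset[OF U] by auto
    note t = differential_fst_tangent[OF z(3) smooth_vfieldD(1)[OF smooth_manifold_prod X z(1)]]
    show "(\<Sum>b\<in>Basis. X z (\<lambda>x. c (fst x) \<bullet> b) * L (fst z) (coord_vec M V c b (fst z))) =
        L (fst z) (differential M fst z (X z))"
      unfolding linear_on_tangent_expansion[OF M V z(2) L[OF z(2)] t]
      by (simp add: differential_def comp_def smooth_at_coordinate[OF M V z(2)])
  qed
qed

end

section \<open>Curves\<close>

lemma second_countable_euclidean: "second_countable (euclidean :: 'm::euclidean_space topology)"
proof -
  obtain B :: "'m set set" where B: "countable B" "\<And>C. C \<in> B \<Longrightarrow> open C"
    "\<And>S. open S \<Longrightarrow> \<exists>U. U \<subseteq> B \<and> S = \<Union>U"
    using univ_second_countable by blast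
  show ?thesis
    unfolding second_countable_def
  proof (intro exI[of _ B] conjI allI impI)
    fix U and x :: 'm assume U: "openin euclidean U \<and> x \<in> U"
    then obtain A where "A \<subseteq> B" "U = \<Union>A"
      using B(3) open_openin by metis
    with U show "\<exists>V\<in>B. x \<in> V \<and> V \<subseteq> U" by blast
  qed (use B in auto)
qed

lemma points_curve_mfd [simp]: "points (curve_mfd C) = C"
  by (simp add: curve_mfd_def)

lemma frechet_derivative_1_real:
  assumes "\<gamma> differentiable (at t)"
  shows "frechet_derivative \<gamma> (at t) 1 = vector_derivative \<gamma> (at t)"
proof -
  have "(\<gamma> has_derivative (\<lambda>x. x *\<^sub>R vector_derivative \<gamma> (at t))) (at t)"
    using vector_derivative_works[THEN iffD1, OF assms] by (simp add: has_vector_derivative_def)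
  from frechet_derivative_at[OF this, symmetric] show ?thesis by simp
qed

text \<open>Near a parameter where some coordinate of \<open>\<gamma>\<^sub>2\<close> has nonzero derivative, the transition map
  \<open>\<gamma>\<^sub>2\<inverse> \<circ> \<gamma>\<^sub>1\<close> is determined by an equation between real functions.\<close>

lemma curve_transition_smooth:
  fixes \<gamma>1 \<gamma>2 :: "real \<Rightarrow> 'm::euclidean_space"
  assumes A: "open A" and V: "open V" and sm: "smooth_on A \<gamma>1" "smooth_on V \<gamma>2"
    and reg: "\<And>s. s \<in> V \<Longrightarrow> vector_derivative \<gamma>2 (at s) \<noteq> 0"
    and \<psi>: "continuous_on A \<psi>" "\<psi> ` A \<subseteq> V" "\<And>t. t \<in> A \<Longrightarrow> \<gamma>2 (\<psi> t) = \<gamma>1 t"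
  shows "smooth_on A \<psi>"
proof (rule smooth_on_local)
  fix t0 assume t0: "t0 \<in> A"
  then have "\<psi> t0 \<in> V" using \<psi>(2) by auto
  from reg[OF this] obtain b where b: "b \<in> Basis" "vector_derivative \<gamma>2 (at (\<psi> t0)) \<bullet> b \<noteq> 0"
    by (metis euclidean_all_zero_iff)
  have D: "frechet_derivative (\<lambda>s. \<gamma>2 s \<bullet> b) (at s) 1 = vector_derivative \<gamma>2 (at s) \<bullet> b" if "s \<in> V" for s
  proof -
    have "((\<lambda>s. \<gamma>2 s \<bullet> b) has_derivative (\<lambda>v. frechet_derivative \<gamma>2 (at s) v \<bullet> b)) (at s)"
      by (rule bounded_linear.has_derivative[OF bounded_linear_inner_left smooth_on_has_derivative[OF sm(2) that]])
    from frechet_derivative_at[OF this, symmetric] show ?thesis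
      using frechet_derivative_1_real[OF smooth_on_differentiable[OF sm(2) that]] by simp
  qed
  have smb: "smooth_on V (\<lambda>s. \<gamma>2 s \<bullet> b)" "smooth_on A (\<lambda>t. \<gamma>1 t \<bullet> b)"
    by (rule smooth_on_linear_compose[OF bounded_linear_inner_left V sm(2)],
        rule smooth_on_linear_compose[OF bounded_linear_inner_left A sm(1)])
  define B where "B = V \<inter> (\<lambda>s. frechet_derivative (\<lambda>s. \<gamma>2 s \<bullet> b) (at s) 1) -` (- {0})"
  have B: "open B"
    unfolding B_def
    by (rule continuous_open_preimage[OF smooth_on_continuous_on[OF smooth_on_derivative[OF smb(1)]] V]) (simp add: open_Compl)
  have A': "open (A \<inter> \<psi> -` B)"
    by (rule continuous_open_preimage[OF \<psi>(1) A B])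
  have "smooth_on (A \<inter> \<psi> -` B) \<psi>"
  proof (rule smooth_on_implicit_real[OF A' B])
    show "continuous_on (A \<inter> \<psi> -` B) \<psi>" by (rule continuous_on_subset[OF \<psi>(1)]) auto
    show "smooth_on B (\<lambda>s. \<gamma>2 s \<bullet> b)" by (rule smooth_on_subset[OF smb(1)]) (auto simp: B_def)
    show "smooth_on (A \<inter> \<psi> -` B) (\<lambda>t. \<gamma>1 t \<bullet> b)" by (rule smooth_on_subset[OF smb(2)]) auto
  qed (use \<psi>(3) in \<open>auto simp: B_def\<close>)
  moreover have "t0 \<in> A \<inter> \<psi> -` B"
    using t0 \<open>\<psi> t0 \<in> V\<close> b(2) D by (simp add: B_def)
  ultimately show "\<exists>U. open U \<and> t0 \<in> U \<and> smooth_on U \<psi>"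
    using A' by blast
qed

text \<open>The charts are inverses of parametrizations, so \<open>inv_into U c\<close> is the
  parametrization again and a transition map is \<open>c2\<close> after \<open>\<gamma>1\<close>.
  Its continuity is topological; \<open>curve_transition_smooth\<close> upgrades it to
  smoothness.\<close>

lemma smooth_manifold_curve:
  assumes C: "embedded_1_manifold C" "C \<noteq> {}"
  shows "smooth_manifold (curve_mfd C)"
proof -
  have chart: "open V \<and> smooth_on V \<gamma> \<and> inj_on \<gamma> V \<and> openin (top_of_set C) (\<gamma> ` V) \<and> c ` U = V \<and>
      homeomorphic_map (top_of_set U) (top_of_set V) c \<and> (\<forall>t\<in>V. vector_derivative \<gamma> (at t) \<noteq> 0) \<and>
      (\<forall>t\<in>V. inv_into U c t = \<gamma> t)"
    if c: "U = \<gamma> ` V" "c = inv_into V \<gamma>" "open V" "smooth_on V \<gamma>"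
      "\<forall>t\<in>V. vector_derivative \<gamma> (at t) \<noteq> 0" "openin (top_of_set C) (\<gamma> ` V)"
      "homeomorphic_map (top_of_set V) (top_of_set (\<gamma> ` V)) \<gamma>" for U c \<gamma> V
  proof -
    have inj: "inj_on \<gamma> V"
      using c(7) by (simp add: homeomorphic_eq_everything_map)
    have img: "c ` U = V"
      unfolding c(1,2) using inj by (force simp: image_image)
    obtain g where g: "homeomorphic_maps (top_of_set V) (top_of_set (\<gamma> ` V)) \<gamma> g"
      using c(7) unfolding homeomorphic_map_maps by blast
    then have "homeomorphic_map (top_of_set (\<gamma> ` V)) (top_of_set V) g"
      by (simp add: homeomorphic_maps_map)
    then have "homeomorphic_map (top_of_set U) (top_of_set V) c"
      unfolding c(1,2)
    proof (rule homeomorphic_map_eq)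
      show "g x = inv_into V \<gamma> x" if "x \<in> topspace (top_of_set (\<gamma> ` V))" for x
        using that g inj by (auto simp: homeomorphic_maps_def)
    qed
    moreover have "inv_into U c t = \<gamma> t" if "t \<in> V" for t
      using inj that unfolding c(1,2) by (intro inv_into_f_eq) (auto intro: inj_on_inv_into)
    ultimately show ?thesis
      using c inj img by simp
  qed
  have chartD: "\<exists>\<gamma> V. U = \<gamma> ` V \<and> c = inv_into V \<gamma> \<and> open V \<and> smooth_on V \<gamma> \<and> inj_on \<gamma> V \<and>
      openin (top_of_set C) (\<gamma> ` V) \<and> c ` U = V \<and> homeomorphic_map (top_of_set U) (top_of_set V) c \<and>
      (\<forall>t\<in>V. vector_derivative \<gamma> (at t) \<noteq> 0) \<and> (\<forall>t\<in>V. inv_into U c t = \<gamma> t)"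
    if uc: "(U, c) \<in> curve_charts C" for U c
  proof -
    obtain \<gamma> V where *: "U = \<gamma> ` V" "c = inv_into V \<gamma>" "open V" "smooth_on V \<gamma>"
      "\<forall>t\<in>V. vector_derivative \<gamma> (at t) \<noteq> 0" "openin (top_of_set C) (\<gamma> ` V)"
      "homeomorphic_map (top_of_set V) (top_of_set (\<gamma> ` V)) \<gamma>"
      using uc unfolding curve_charts_def by auto
    show ?thesis
      using chart[OF *] *(1,2) by (intro exI[of _ \<gamma>] exI[of _ V]) simp
  qed
  show ?thesis
    unfolding smooth_manifold_def
  proof (intro conjI)
    show "points (curve_mfd C) \<noteq> {}" using C by simp
    show "Hausdorff_space (mtop (curve_mfd C))"
      by (simp add: curve_mfd_def Hausdorff_space_subtopology)
    show "second_countable (mtop (curve_mfd C))"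
      by (simp add: curve_mfd_def second_countable_subtopology second_countable_euclidean)
    show "\<forall>(U, c)\<in>atlas (curve_mfd C). openin (mtop (curve_mfd C)) U \<and> open (c ` U) \<and>
        homeomorphic_map (subtopology (mtop (curve_mfd C)) U) (top_of_set (c ` U)) c"
    proof clarify
      fix U c assume "(U, c) \<in> atlas (curve_mfd C)"
      then have "(U, c) \<in> curve_charts C" by (simp add: curve_mfd_def)
      from chartD[OF this] obtain \<gamma> V where *: "U = \<gamma> ` V" "open V" "openin (top_of_set C) (\<gamma> ` V)" "c ` U = V"
        "homeomorphic_map (top_of_set U) (top_of_set V) c"
        by blast
      have "U \<subseteq> C"
        using openin_subset[OF *(3)] *(1) by simp
      then have "subtopology (mtop (curve_mfd C)) U = top_of_set U"
        by (simp add: curve_mfd_def subtopology_subtopology inf.absorb2)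
      then show "openin (mtop (curve_mfd C)) U \<and> open (c ` U) \<and>
          homeomorphic_map (subtopology (mtop (curve_mfd C)) U) (top_of_set (c ` U)) c"
        using * by (simp add: curve_mfd_def)
    qed
    have "U \<subseteq> C" if "(U, c) \<in> curve_charts C" for U c
    proof -
      from chartD[OF that] obtain \<gamma> and V :: "real set" where "U = \<gamma> ` V" "openin (top_of_set C) (\<gamma> ` V)" by blast
      then show ?thesis using openin_subset by fastforce
    qed
    moreover have "\<exists>U c. (U, c) \<in> curve_charts C \<and> q \<in> U" if "q \<in> C" for q
      using C(1) that unfolding embedded_1_manifold_def by blast
    ultimately show "(\<Union>(U, c)\<in>atlas (curve_mfd C). U) = points (curve_mfd C)"
      unfolding points_curve_mfd by (auto simp: curve_mfd_def) blast
    show "\<forall>(U, c)\<in>atlas (curve_mfd C). \<forall>(V, d)\<in>atlas (curve_mfd C).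
        smooth_on (c ` (U \<inter> V)) (d \<circ> inv_into U c)"
    proof clarify
      fix U1 c1 U2 c2 assume "(U1, c1) \<in> atlas (curve_mfd C)" "(U2, c2) \<in> atlas (curve_mfd C)"
      then have "(U1, c1) \<in> curve_charts C" "(U2, c2) \<in> curve_charts C" by (simp_all add: curve_mfd_def)
      from chartD[OF this(1)] chartD[OF this(2)] obtain \<gamma>1 V1 \<gamma>2 V2
        where 1: "U1 = \<gamma>1 ` V1" "c1 = inv_into V1 \<gamma>1" "open V1" "smooth_on V1 \<gamma>1" "inj_on \<gamma>1 V1"
          "openin (top_of_set C) (\<gamma>1 ` V1)" "c1 ` U1 = V1"
          "homeomorphic_map (top_of_set U1) (top_of_set V1) c1" "\<forall>t\<in>V1. inv_into U1 c1 t = \<gamma>1 t"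
          and 2: "U2 = \<gamma>2 ` V2" "c2 = inv_into V2 \<gamma>2" "open V2" "smooth_on V2 \<gamma>2" "inj_on \<gamma>2 V2"
          "openin (top_of_set C) (\<gamma>2 ` V2)" "c2 ` U2 = V2"
          "homeomorphic_map (top_of_set U2) (top_of_set V2) c2" "\<forall>t\<in>V2. vector_derivative \<gamma>2 (at t) \<noteq> 0"
        by blast
      let ?A = "c1 ` (U1 \<inter> U2)"
      have A_sub: "?A \<subseteq> V1" using 1(7) by auto
      have \<gamma>A: "\<gamma>1 t \<in> U2" if "t \<in> ?A" for t
        using that f_inv_into_f[of _ \<gamma>1 V1] unfolding 1(1,2) by auto
      have "U1 \<subseteq> C" using openin_subset[OF 1(6)] 1(1) by simp
      then have "openin (top_of_set U1) (U1 \<inter> U2)"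
        by (intro openin_subset_trans[OF openin_Int[OF 1(6)[folded 1(1)] 2(6)[folded 2(1)]] Int_lower1])
      then have "openin (top_of_set V1) ?A"
        using 1(8) unfolding homeomorphic_eq_everything_map open_map_def by blast
      then have A: "open ?A"
        using 1(3) openin_open_eq by blast
      have "continuous_on U2 c2"
        using homeomorphic_imp_continuous_map[OF 2(8)] by simp
      then have cont: "continuous_on ?A (\<lambda>t. c2 (\<gamma>1 t))"
        by (rule continuous_on_compose2)
          (use \<gamma>A continuous_on_subset[OF smooth_on_continuous_on[OF 1(4)] A_sub] in auto)
      have "smooth_on ?A (\<lambda>t. c2 (\<gamma>1 t))"
      proof (rule curve_transition_smooth[OF A 2(3) smooth_on_subset[OF 1(4) A_sub] 2(4) _ cont])
        show "(\<lambda>t. c2 (\<gamma>1 t)) ` ?A \<subseteq> V2"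
          using \<gamma>A 2(7) by auto
        show "\<gamma>2 (c2 (\<gamma>1 t)) = \<gamma>1 t" if "t \<in> ?A" for t
          using \<gamma>A[OF that] unfolding 2(1,2) by (rule f_inv_into_f)
      qed (use 2(9) in auto)
      then show "smooth_on ?A (c2 \<circ> inv_into U1 c1)"
        by (rule smooth_on_cong[OF A, rotated]) (use 1(9) A_sub in auto)
    qed
  qed
qed

section \<open>Tangent lines of a curve and the coefficient of T\<close>

text \<open>Over the reals the only basis vector is 1 and the coordinate is \<open>d\<close> itself.
  So \<open>tangent_expansion\<close> makes every tangent vector \<open>v\<close> the multiple
  \<open>v d\<close> of one coordinate vector.\<close>

lemma one_dim_tangent:
  fixes N :: "('b, real) mfd"
  assumes N: "smooth_manifold N" and W: "(W, d) \<in> atlas N" "q \<in> W"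
    and t: "t \<in> tangent_space N q" "t \<noteq> 0\<^sub>t" and w: "w \<in> tangent_space N q"
  shows "t d \<noteq> 0" "w = (w d / t d) *\<^sub>t t"
proof -
  have expand: "v f = v d * coord_vec N W d 1 q f" if "v \<in> tangent_space N q" for v f
    using tangent_expansion[OF N W that, of f] by simp
  show "t d \<noteq> 0"
  proof
    assume "t d = 0"
    then have "t f = 0" for f
      using expand[OF t(1), of f] by simp
    then show False using t(2) by (simp add: fun_eq_iff)
  qed
  then show "w = (w d / t d) *\<^sub>t t"
  proof (intro ext)
    show "w f = w d / t d * t f" for f
      using expand[OF t(1), of f] expand[OF w, of f] \<open>t d \<noteq> 0\<close> by simp
  qed
qed

text \<open>\<open>comp_h\<close> is a definite description; that \<open>T\<close> does not vanish
  makes the coefficient unique.\<close>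

lemma comp_h_eqI:
  assumes "differential (curve_mfd C) snd z v = h *\<^sub>t T (snd z)" "T (snd z) \<noteq> 0\<^sub>t"
  shows "comp_h C T z v = h"
  unfolding comp_h_def
proof (rule the_equality[of _ h])
  fix h' assume "differential (curve_mfd C) snd z v = h' *\<^sub>t T (snd z)"
  then have "h * T (snd z) f = h' * T (snd z) f" for f
    using assms(1) fun_cong by metis
  moreover obtain f where "T (snd z) f \<noteq> 0"
    using assms(2) by (auto simp: fun_eq_iff)
  ultimately show "h' = h" by (metis mult_right_cancel)
qed (rule assms(1))

section \<open>The structure on the product with a curve\<close>

lemma vector_field_scale:
  assumes M: "smooth_manifold M" and X: "X \<in> \<chi> M"
  shows "(\<lambda>p. a *\<^sub>t X p) \<in> \<chi> M"
  unfolding vector_fields_def smooth_vfield_on_def mem_Collect_eq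
proof (intro conjI ballI allI impI)
  show "a *\<^sub>t X p \<in> tangent_space M p" if "p \<in> points M" for p
    by (rule tangent_space_scale[OF M vector_fieldD(1)[OF M X that]])
  show "smooth_fun M V (\<lambda>p. a * X p f)" if "openin (mtop M) V" "smooth_fun M V f" for V f
    by (rule smooth_fun_mult[OF M that(1) smooth_fun_const[OF M that(1)] vector_fieldD(2)[OF M X that]])
qed

text \<open>The curve is represented by what the construction draws from it: a one-dimensional
  manifold with a nowhere zero field. The parity of the dimension and the equation for
  \<open>d\<omega>\<close> enter later, as premises of \<open>almost_contact\<close> and
  \<open>ext_deriv_\<eta>\<close>.\<close>

locale curve_product =
  fixes M1 :: "('a, 'e::euclidean_space) mfd"
    and J :: "'a \<Rightarrow> 'a tvec \<Rightarrow> 'a tvec"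
    and g1 :: "'a \<Rightarrow> 'a tvec \<Rightarrow> 'a tvec \<Rightarrow> real"
    and \<omega> :: "'a \<Rightarrow> 'a tvec \<Rightarrow> real"
    and C :: "'m::euclidean_space set"
    and T :: "'m \<Rightarrow> 'm tvec"
    and \<alpha> :: real
  assumes hermitian: "almost_hermitian_manifold M1 J g1"
    and \<omega>: "one_form M1 \<omega>"
    and N: "smooth_manifold (curve_mfd C)"
    and T: "T \<in> \<chi> (curve_mfd C)"
    and T_nonzero: "q \<in> C \<Longrightarrow> T q \<noteq> 0\<^sub>t"
begin

abbreviation "N \<equiv> curve_mfd C"
abbreviation "P \<equiv> prod_mfd M1 N"
abbreviation "comp1 \<equiv> comp_M M1"
abbreviation "comp2 \<equiv> comp_h C T"
abbreviation "\<phi> \<equiv> phi_bar M1 J \<omega> C T \<alpha>"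
abbreviation "\<xi> \<equiv> xi_bar M1 C T"
abbreviation "\<eta> \<equiv> eta_bar M1 \<omega> C T \<alpha>"
abbreviation "g \<equiv> g_bar M1 g1 \<omega> C T \<alpha>"
abbreviation "pair z u h \<equiv> tpair M1 N z u (h *\<^sub>t T (snd z))"

lemma M1: "smooth_manifold M1" and J: "tensor_field_11 M1 J" and g1: "riemannian_metric M1 g1"
  using hermitian by (simp_all add: almost_hermitian_manifold_def)

lemma J_J: "p \<in> points M1 \<Longrightarrow> u \<in> tangent_space M1 p \<Longrightarrow> J p (J p u) = (-1) *\<^sub>t u"
  and g1_J: "p \<in> points M1 \<Longrightarrow> u \<in> tangent_space M1 p \<Longrightarrow> v \<in> tangent_space M1 p \<Longrightarrow>
    g1 p (J p u) (J p v) = g1 p u v"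
  using hermitian unfolding almost_hermitian_manifold_def by blast+

lemma J_tangent: "p \<in> points M1 \<Longrightarrow> u \<in> tangent_space M1 p \<Longrightarrow> J p u \<in> tangent_space M1 p"
  and J_add: "p \<in> points M1 \<Longrightarrow> u \<in> tangent_space M1 p \<Longrightarrow> v \<in> tangent_space M1 p \<Longrightarrow>
    J p (u +\<^sub>t v) = J p u +\<^sub>t J p v"
  and J_scale: "p \<in> points M1 \<Longrightarrow> u \<in> tangent_space M1 p \<Longrightarrow> J p (a *\<^sub>t u) = a *\<^sub>t J p u"
  and J_smooth: "openin (mtop M1) U \<Longrightarrow> smooth_vfield_on M1 U X \<Longrightarrow> smooth_vfield_on M1 U (\<lambda>p. J p (X p))"
  using J unfolding tensor_field_11_def by blast+

lemma g1_linear: "p \<in> points M1 \<Longrightarrow> w \<in> tangent_space M1 p \<Longrightarrow> linear_on_tangent M1 p (\<lambda>u. g1 p u w)"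
  and g1_sym: "p \<in> points M1 \<Longrightarrow> u \<in> tangent_space M1 p \<Longrightarrow> w \<in> tangent_space M1 p \<Longrightarrow> g1 p u w = g1 p w u"
  and g1_pos: "p \<in> points M1 \<Longrightarrow> u \<in> tangent_space M1 p \<Longrightarrow> u \<noteq> 0\<^sub>t \<Longrightarrow> g1 p u u > 0"
  and g1_smooth: "openin (mtop M1) U \<Longrightarrow> smooth_vfield_on M1 U X \<Longrightarrow> smooth_vfield_on M1 U Y \<Longrightarrow>
    smooth_fun M1 U (\<lambda>p. g1 p (X p) (Y p))"
  using g1 unfolding riemannian_metric_def linear_on_tangent_def by blast+

text \<open>Linearity is part of \<open>riemannian_metric\<close> for the first argument; symmetry
  carries it to the second.\<close>

lemma g1_linear2:
  assumes "p \<in> points M1" "w \<in> tangent_space M1 p"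
  shows "linear_on_tangent M1 p (g1 p w)"
  unfolding linear_on_tangent_def
proof (intro ballI allI conjI)
  fix u v a assume uv: "u \<in> tangent_space M1 p" "v \<in> tangent_space M1 p"
  show "g1 p w (u +\<^sub>t v) = g1 p w u + g1 p w v"
    unfolding g1_sym[OF assms tangent_space_add[OF M1 uv]]
      linear_on_tangent_add[OF g1_linear[OF assms] uv] g1_sym[OF assms uv(1)] g1_sym[OF assms uv(2)] ..
  show "g1 p w (a *\<^sub>t u) = a * g1 p w u"
    unfolding g1_sym[OF assms tangent_space_scale[OF M1 uv(1)]]
      linear_on_tangent_scale[OF g1_linear[OF assms] uv(1)] g1_sym[OF assms uv(1)] ..
qed

lemma P: "smooth_manifold P"
  by (rule smooth_manifold_prod[OF M1 N])

lemma T_tangent: "q \<in> C \<Longrightarrow> T q \<in> tangent_space N q"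
  using vector_fieldD(1)[OF N T] by simp

lemma pointsD: "z \<in> points P \<Longrightarrow> fst z \<in> points M1" "z \<in> points P \<Longrightarrow> snd z \<in> C"
  by auto

lemma comp1_tangent: "z \<in> points P \<Longrightarrow> v \<in> tangent_space P z \<Longrightarrow> comp1 z v \<in> tangent_space M1 (fst z)"
  unfolding comp_M_def by (rule differential_fst_tangent[OF M1 N])

lemma openin_C: "openin (mtop N) C"
  by (simp add: curve_mfd_def)

lemma comp2_eqI:
  assumes "z \<in> points P" "differential N snd z v = h *\<^sub>t T (snd z)"
  shows "comp2 z v = h"
  by (rule comp_h_eqI[where T = T]) (rule assms, rule T_nonzero[OF pointsD(2)[OF assms(1)]])

text \<open>One-dimensionality supplies the coefficient that the definite description asks for. The
  quotient formula is what later shows that it depends smoothly on \<open>z\<close>.\<close>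

lemma comp2_in_chart:
  assumes z: "z \<in> points P" and v: "v \<in> tangent_space P z" and W: "(W, d) \<in> atlas N" "snd z \<in> W"
  shows "differential N snd z v = comp2 z v *\<^sub>t T (snd z)"
    and "T (snd z) d \<noteq> 0" and "comp2 z v = v (\<lambda>x. d (snd x)) / T (snd z) d"
proof -
  note q = pointsD(2)[OF z]
  note one_dim = one_dim_tangent[OF N W T_tangent[OF q] T_nonzero[OF q] differential_snd_tangent[OF M1 N z v]]
  show "T (snd z) d \<noteq> 0" by (rule one_dim)
  have d: "smooth_at N (snd z) d"
    using smooth_at_coordinate[OF N W, of 1] by simp
  have eq: "comp2 z v = differential N snd z v d / T (snd z) d"
    by (rule comp2_eqI[OF z one_dim(2)])
  show "differential N snd z v = comp2 z v *\<^sub>t T (snd z)"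
    unfolding eq by (rule one_dim)
  show "comp2 z v = v (\<lambda>x. d (snd x)) / T (snd z) d"
    unfolding eq by (simp add: differential_def comp_def d)
qed

lemma differential_snd_eq:
  assumes z: "z \<in> points P" and v: "v \<in> tangent_space P z"
  shows "differential N snd z v = comp2 z v *\<^sub>t T (snd z)"
proof -
  have "snd z \<in> points N" using z by auto
  then obtain W d where W: "(W, d) \<in> atlas N" "snd z \<in> W"
    using chart_exists[OF N] by metis
  show ?thesis by (rule comp2_in_chart(1)[OF z v W])
qed

lemma pair_eq:
  assumes z: "z \<in> points P" and v: "v \<in> tangent_space P z"
  shows "pair z (comp1 z v) (comp2 z v) = v"
  using tangent_decompose[OF M1 N z v] unfolding comp_M_def differential_snd_eq[OF z v] .

lemma pair_tangent:
  assumes z: "z \<in> points P" and u: "u \<in> tangent_space M1 (fst z)"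
  shows "pair z u h \<in> tangent_space P z"
  by (rule tpair_tangent[OF M1 N z u tangent_space_scale[OF N T_tangent[OF pointsD(2)[OF z]]]])

lemma comp1_pair:
  assumes z: "z \<in> points P" and u: "u \<in> tangent_space M1 (fst z)"
  shows "comp1 z (pair z u h) = u"
  unfolding comp_M_def
  by (rule differential_fst_tpair[OF M1 N z u tangent_space_scale[OF N T_tangent[OF pointsD(2)[OF z]]]])

lemma comp2_pair:
  assumes z: "z \<in> points P" and u: "u \<in> tangent_space M1 (fst z)"
  shows "comp2 z (pair z u h) = h"
  by (rule comp2_eqI[OF z differential_snd_tpair[OF M1 N z u
          tangent_space_scale[OF N T_tangent[OF pointsD(2)[OF z]]]]])

lemma comp1_add: "comp1 z (u +\<^sub>t v) = comp1 z u +\<^sub>t comp1 z v"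
  and comp1_scale: "comp1 z (a *\<^sub>t u) = a *\<^sub>t comp1 z u"
  by (auto simp: comp_M_def differential_def)

lemma comp2_linear:
  assumes z: "z \<in> points P"
  shows "linear_on_tangent P z (comp2 z)"
  unfolding linear_on_tangent_def
proof (intro ballI allI conjI)
  fix u v a assume u: "u \<in> tangent_space P z" and v: "v \<in> tangent_space P z"
  have "differential N snd z (u +\<^sub>t v) = differential N snd z u +\<^sub>t differential N snd z v"
    "differential N snd z (a *\<^sub>t u) = a *\<^sub>t differential N snd z u"
    by (auto simp: differential_def)
  then have sum: "differential N snd z (u +\<^sub>t v) = (comp2 z u + comp2 z v) *\<^sub>t T (snd z)"
    and scale: "differential N snd z (a *\<^sub>t u) = (a * comp2 z u) *\<^sub>t T (snd z)"
    unfolding differential_snd_eq[OF z u] differential_snd_eq[OF z v] by (simp_all add: algebra_simps)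
  show "comp2 z (u +\<^sub>t v) = comp2 z u + comp2 z v" "comp2 z (a *\<^sub>t u) = a * comp2 z u"
    by (rule comp2_eqI[OF z sum], rule comp2_eqI[OF z scale])
qed

lemma \<omega>_linear: "p \<in> points M1 \<Longrightarrow> linear_on_tangent M1 p (\<omega> p)"
  by (rule one_form_linear[OF \<omega>])

lemma \<eta>_linear:
  assumes z: "z \<in> points P"
  shows "linear_on_tangent P z (\<eta> z)"
  unfolding linear_on_tangent_def
proof (intro ballI allI conjI)
  fix u v a assume u: "u \<in> tangent_space P z" and v: "v \<in> tangent_space P z"
  note t = comp1_tangent[OF z u] comp1_tangent[OF z v]
  show "\<eta> z (u +\<^sub>t v) = \<eta> z u + \<eta> z v"
    unfolding eta_bar_def comp1_add linear_on_tangent_add[OF \<omega>_linear[OF pointsD(1)[OF z]] t]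
      linear_on_tangent_add[OF comp2_linear[OF z] u v] by (simp add: algebra_simps)
  show "\<eta> z (a *\<^sub>t u) = a * \<eta> z u"
    unfolding eta_bar_def comp1_scale linear_on_tangent_scale[OF \<omega>_linear[OF pointsD(1)[OF z]] t(1)]
      linear_on_tangent_scale[OF comp2_linear[OF z] u] by (simp add: algebra_simps)
qed

lemma \<eta>_pair:
  assumes "z \<in> points P" "u \<in> tangent_space M1 (fst z)"
  shows "\<eta> z (pair z u h) = \<alpha> * \<omega> (fst z) u + h"
  unfolding eta_bar_def comp1_pair[OF assms] comp2_pair[OF assms] ..

lemma \<phi>_eq: "\<phi> z v = pair z (J (fst z) (comp1 z v)) (- \<alpha> * \<omega> (fst z) (J (fst z) (comp1 z v)))"
  by (simp add: phi_bar_def Let_def)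

lemma J_comp1_tangent:
  assumes "z \<in> points P" "v \<in> tangent_space P z"
  shows "J (fst z) (comp1 z v) \<in> tangent_space M1 (fst z)"
  by (rule J_tangent[OF pointsD(1)[OF assms(1)] comp1_tangent[OF assms]])

lemma comp1_\<phi>:
  assumes "z \<in> points P" "v \<in> tangent_space P z"
  shows "comp1 z (\<phi> z v) = J (fst z) (comp1 z v)"
  unfolding \<phi>_eq by (rule comp1_pair[OF assms(1) J_comp1_tangent[OF assms]])

lemma \<phi>_tangent:
  assumes "z \<in> points P" "v \<in> tangent_space P z"
  shows "\<phi> z v \<in> tangent_space P z"
  unfolding \<phi>_eq by (rule pair_tangent[OF assms(1) J_comp1_tangent[OF assms]])

text \<open>The summand \<open>\<alpha> * \<omega> (J X1)\<close> of \<open>\<eta>\<close> cancels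
  against the T-component of \<open>\<phi>\<close>, which is chosen for this purpose.\<close>

lemma \<eta>_\<phi>:
  assumes "z \<in> points P" "v \<in> tangent_space P z"
  shows "\<eta> z (\<phi> z v) = 0"
  unfolding \<phi>_eq \<eta>_pair[OF assms(1) J_comp1_tangent[OF assms]] by simp

lemma \<xi>_eq: "\<xi> z = pair z 0\<^sub>t 1"
  by (simp add: xi_bar_def)

lemma \<eta>_\<xi>:
  assumes z: "z \<in> points P"
  shows "\<eta> z (\<xi> z) = 1"
proof -
  have "\<omega> (fst z) (0 *\<^sub>t 0\<^sub>t) = 0 * \<omega> (fst z) 0\<^sub>t"
    by (rule linear_on_tangent_scale[OF \<omega>_linear[OF pointsD(1)[OF z]] tangent_zero[OF M1]])
  then show ?thesis
    unfolding \<xi>_eq \<eta>_pair[OF z tangent_zero[OF M1]] by simp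
qed

lemma \<phi>_\<phi>:
  assumes z: "z \<in> points P" and v: "v \<in> tangent_space P z"
  shows "\<phi> z (\<phi> z v) = (-1) *\<^sub>t v +\<^sub>t \<eta> z v *\<^sub>t \<xi> z"
proof -
  note p = pointsD(1)[OF z] and t = comp1_tangent[OF z v]
  have "\<phi> z (\<phi> z v) = pair z ((-1) *\<^sub>t comp1 z v) (\<alpha> * \<omega> (fst z) (comp1 z v))"
    unfolding \<phi>_eq[of z "\<phi> z v"] comp1_\<phi>[OF z v] J_J[OF p t]
      linear_on_tangent_scale[OF \<omega>_linear[OF p] t] by simp
  \<comment> \<open>The T-component \<open>\<alpha> * \<omega> X1\<close> equals
    \<open>\<eta> z v - h\<close>, where \<open>h = comp2 z v\<close>: this is minus the T-component
    of \<open>v\<close> plus that of \<open>\<eta> z v\<close> times \<open>\<xi>\<close>.\<close>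
  also have "\<dots> = (-1) *\<^sub>t pair z (comp1 z v) (comp2 z v) +\<^sub>t \<eta> z v *\<^sub>t \<xi> z"
    unfolding \<xi>_eq by (rule ext) (simp add: tpair_def eta_bar_def algebra_simps)
  finally show ?thesis
    unfolding pair_eq[OF z v] .
qed

text \<open>The second summand of \<open>g\<close> vanishes by \<open>\<eta>_\<phi>\<close>, and
  \<open>\<alpha>\<close> with it; what remains is the fundamental form of \<open>M1\<close> on the
  first components.\<close>

lemma g_\<phi>:
  assumes z: "z \<in> points P" and u: "u \<in> tangent_space P z" and v: "v \<in> tangent_space P z"
  shows "g z u (\<phi> z v) = g1 (fst z) (comp1 z u) (J (fst z) (comp1 z v))"
  unfolding g_bar_def comp1_\<phi>[OF z v] \<eta>_\<phi>[OF z v] by simp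

section \<open>Smoothness of the structure tensors\<close>

lemma smooth_fun_comp1:
  assumes U: "openin (mtop P) U" and X: "smooth_vfield_on P U X" and \<theta>: "one_form M1 \<theta>"
  shows "smooth_fun P U (\<lambda>z. \<theta> (fst z) (comp1 z (X z)))"
proof (rule smooth_fun_local[OF P])
  have U': "openin (prod_topology (mtop M1) (mtop N)) U" using U by simp
  fix z assume z: "z \<in> U"
  then have zP: "fst z \<in> points M1" "snd z \<in> points N" using openin_subset[OF U] by auto
  obtain V c where V: "(V, c) \<in> atlas M1" "fst z \<in> V"
    using chart_exists[OF M1 zP(1)] .
  have "smooth_fun P (U \<inter> (V \<times> points N)) (\<lambda>z. \<theta> (fst z) (comp1 z (X z)))"
    unfolding comp_M_def
  proof (rule smooth_fun_contract_fst[OF M1 N U' X V(1)])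
    show "linear_on_tangent M1 p (\<theta> p)" if "p \<in> V" for p
      using chart_subset[OF M1 V(1)] that by (intro one_form_linear[OF \<theta>]) auto
    show "smooth_fun M1 V (\<lambda>p. \<theta> p (coord_vec M1 V c b p))" for b
      using \<theta> chart_openin[OF M1 V(1)] smooth_vfield_coord_vec[OF M1 V(1)] unfolding one_form_def by blast
  qed
  moreover have "openin (mtop P) (V \<times> points N)"
    using chart_openin[OF M1 V(1)] by (simp add: openin_prod_Times_iff openin_C)
  ultimately show "\<exists>W. openin (mtop P) W \<and> z \<in> W \<and> smooth_fun P W (\<lambda>z. \<theta> (fst z) (comp1 z (X z)))"
    using U z V(2) zP by (intro exI[of _ "U \<inter> (V \<times> points N)"] conjI openin_Int) (auto simp: mem_Times_iff)
qed

lemma smooth_fun_comp2: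
  assumes U: "openin (mtop P) U" and X: "smooth_vfield_on P U X"
  shows "smooth_fun P U (\<lambda>z. comp2 z (X z))"
proof (rule smooth_fun_local[OF P])
  fix z assume z: "z \<in> U"
  then have zP: "fst z \<in> points M1" "snd z \<in> points N" using openin_subset[OF U] by auto
  obtain W d where W: "(W, d) \<in> atlas N" "snd z \<in> W"
    using chart_exists[OF N zP(2)] .
  note Wo = chart_openin[OF N W(1)]
  let ?A = "U \<inter> (points M1 \<times> W)"
  have A: "openin (mtop P) ?A"
    using U Wo by (intro openin_Int) (simp_all add: openin_prod_Times_iff openin_C)
  have chart_A: "z \<in> points P" "X z \<in> tangent_space P z" "snd z \<in> W" if "z \<in> ?A" for z
    using that openin_subset[OF U] smooth_vfieldD(1)[OF P X] by auto
  have d: "smooth_fun N W d"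
    using smooth_fun_coordinate[OF N W(1), of 1] by simp
  have num: "smooth_fun P ?A (\<lambda>z. X z (\<lambda>x. d (snd x)))"
    by (rule smooth_vfieldD(2)[OF P X A Int_lower1 smooth_fun_subset[OF smooth_fun_snd[OF M1 N Wo d] Int_lower2]])
  have den: "smooth_fun P ?A (\<lambda>z. T (snd z) d)"
    by (rule smooth_fun_subset[OF smooth_fun_snd[OF M1 N Wo vector_fieldD(2)[OF N T Wo d]] Int_lower2])
  have "smooth_fun P ?A (\<lambda>z. X z (\<lambda>x. d (snd x)) * inverse (T (snd z) d))"
    by (rule smooth_fun_mult[OF P A num smooth_fun_inverse[OF P A den comp2_in_chart(2)[OF chart_A(1,2) W(1) chart_A(3)]]])
  then have "smooth_fun P ?A (\<lambda>z. comp2 z (X z))"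
    by (rule smooth_fun_cong[OF P A, rotated])
      (simp only: comp2_in_chart(3)[OF chart_A(1,2) W(1) chart_A(3)] divide_inverse)
  then show "\<exists>W. openin (mtop P) W \<and> z \<in> W \<and> smooth_fun P W (\<lambda>z. comp2 z (X z))"
    using A z zP W(2) by (intro exI[of _ ?A]) (auto simp: mem_Times_iff)
qed

lemma \<eta>_smooth:
  assumes U: "openin (mtop P) U" and X: "smooth_vfield_on P U X"
  shows "smooth_fun P U (\<lambda>z. \<eta> z (X z))"
  unfolding eta_bar_def
  by (rule smooth_fun_add[OF P U smooth_fun_mult[OF P U smooth_fun_const[OF P U] smooth_fun_comp1[OF U X \<omega>]]
        smooth_fun_comp2[OF U X]])

lemma one_form_\<eta>: "one_form P \<eta>"
  using \<eta>_linear \<eta>_smooth unfolding one_form_def linear_on_tangent_def by blast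

text \<open>The T-component of \<open>\<phi>\<close> is a constant multiple of this form, so
  \<open>smooth_fun_comp1\<close> covers it.\<close>

lemma one_form_\<omega>_J: "one_form M1 (\<lambda>p u. \<omega> p (J p u))"
  unfolding one_form_def
proof (intro conjI ballI allI impI)
  fix p u v a assume *: "p \<in> points M1" "u \<in> tangent_space M1 p" "v \<in> tangent_space M1 p"
  note t = J_tangent[OF *(1,2)] J_tangent[OF *(1,3)]
  show "\<omega> p (J p (u +\<^sub>t v)) = \<omega> p (J p u) + \<omega> p (J p v)"
    unfolding J_add[OF *] by (rule linear_on_tangent_add[OF \<omega>_linear[OF *(1)] t])
  show "\<omega> p (J p (a *\<^sub>t u)) = a * \<omega> p (J p u)"
    unfolding J_scale[OF *(1,2)] by (rule linear_on_tangent_scale[OF \<omega>_linear[OF *(1)] t(1)])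
next
  fix U X assume "openin (mtop M1) U" "smooth_vfield_on M1 U X"
  then show "smooth_fun M1 U (\<lambda>p. \<omega> p (J p (X p)))"
    using \<omega> J_smooth unfolding one_form_def by blast
qed

text \<open>Tested on coordinates: those of \<open>M1\<close> see a component of \<open>J\<close>
  contracted along \<open>fst\<close>, those of the curve see the form \<open>\<omega>\<close> after
  \<open>J\<close> times a component of \<open>T\<close>.\<close>

lemma \<phi>_smooth:
  assumes U: "openin (mtop P) U" and X: "smooth_vfield_on P U X"
  shows "smooth_vfield_on P U (\<lambda>z. \<phi> z (X z))"
proof (rule prod_vfieldI[OF M1 N])
  show U': "openin (prod_topology (mtop M1) (mtop N)) U" using U by simp
  have UP: "z \<in> points P" "X z \<in> tangent_space P z" if "z \<in> U" for z
    using that openin_subset[OF U] smooth_vfieldD(1)[OF P X] by auto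
  show "\<phi> z (X z) \<in> tangent_space P z" if "z \<in> U" for z
    by (rule \<phi>_tangent[OF UP[OF that]])
  fix V c W d assume V: "(V, c) \<in> atlas M1" and W: "(W, d) \<in> atlas N"
  note Vo = chart_openin[OF M1 V] and Wo = chart_openin[OF N W]
  let ?A = "U \<inter> (V \<times> W)"
  have A: "openin (mtop P) ?A"
    using U chart_openin[OF P prod_chart[OF V W]] by (rule openin_Int)
  have sub: "?A \<subseteq> U \<inter> (V \<times> points N)" "?A \<subseteq> points M1 \<times> W" "?A \<subseteq> U"
    using chart_subset[OF M1 V] chart_subset[OF N W] by auto
  have at: "z \<in> points P" "X z \<in> tangent_space P z" "fst z \<in> V" "snd z \<in> W" if "z \<in> ?A" for z
    using that UP by auto
  note Tt = tangent_space_scale[OF N T_tangent[OF pointsD(2)]]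
  show "smooth_fun P ?A (\<lambda>z. \<phi> z (X z) (\<lambda>x. c (fst x) \<bullet> b))" for b
  proof (rule smooth_fun_cong[OF P A])
    show "smooth_fun P ?A (\<lambda>z. J (fst z) (comp1 z (X z)) (\<lambda>x. c x \<bullet> b))"
      unfolding comp_M_def
    proof (rule smooth_fun_subset[OF smooth_fun_contract_fst[OF M1 N U' X V, of "\<lambda>p u. J p u (\<lambda>x. c x \<bullet> b)"] sub(1)])
      show "linear_on_tangent M1 p (\<lambda>u. J p u (\<lambda>x. c x \<bullet> b))" if "p \<in> V" for p
        using chart_subset[OF M1 V] that unfolding linear_on_tangent_def
        by (auto simp: J_add J_scale subset_iff)
      show "smooth_fun M1 V (\<lambda>p. J p (coord_vec M1 V c b' p) (\<lambda>x. c x \<bullet> b))" for b'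
        by (rule smooth_vfieldD(2)[OF M1 J_smooth[OF Vo smooth_vfield_coord_vec[OF M1 V]] Vo subset_refl
              smooth_fun_coordinate[OF M1 V]])
    qed
    show "J (fst z) (comp1 z (X z)) (\<lambda>x. c x \<bullet> b) = \<phi> z (X z) (\<lambda>x. c (fst x) \<bullet> b)" if "z \<in> ?A" for z
      unfolding \<phi>_eq
      by (rule tpair_apply_fst[OF M1 N at(1)[OF that] Tt[OF at(1)[OF that]]
            smooth_at_coordinate[OF M1 V at(3)[OF that]], symmetric])
  qed
  show "smooth_fun P ?A (\<lambda>z. \<phi> z (X z) (\<lambda>x. d (snd x) \<bullet> b))" for b
  proof (rule smooth_fun_cong[OF P A])
    show "smooth_fun P ?A (\<lambda>z. - \<alpha> * \<omega> (fst z) (J (fst z) (comp1 z (X z))) * T (snd z) (\<lambda>x. d x \<bullet> b))"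
      by (intro smooth_fun_mult[OF P A] smooth_fun_const[OF P A]
          smooth_fun_subset[OF smooth_fun_comp1[OF U X one_form_\<omega>_J] sub(3)]
          smooth_fun_subset[OF smooth_fun_snd[OF M1 N Wo vector_fieldD(2)[OF N T Wo smooth_fun_coordinate[OF N W]]] sub(2)])
    show "- \<alpha> * \<omega> (fst z) (J (fst z) (comp1 z (X z))) * T (snd z) (\<lambda>x. d x \<bullet> b) =
        \<phi> z (X z) (\<lambda>x. d (snd x) \<bullet> b)" if "z \<in> ?A" for z
      unfolding \<phi>_eq
      by (rule tpair_apply_snd[OF M1 N at(1)[OF that] J_comp1_tangent[OF at(1,2)[OF that]]
            smooth_at_coordinate[OF N W at(4)[OF that]], symmetric])
  qed
qed

lemma tensor_field_\<phi>: "tensor_field_11 P \<phi>"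
  unfolding tensor_field_11_def
proof (intro conjI ballI allI impI)
  fix z u v a assume z: "z \<in> points P" and u: "u \<in> tangent_space P z" and v: "v \<in> tangent_space P z"
  note p = pointsD(1)[OF z] and t = comp1_tangent[OF z u] comp1_tangent[OF z v]
  note Jt = J_tangent[OF p t(1)] J_tangent[OF p t(2)]
  show "\<phi> z u \<in> tangent_space P z" by (rule \<phi>_tangent[OF z u])
  show "\<phi> z (u +\<^sub>t v) = \<phi> z u +\<^sub>t \<phi> z v"
    unfolding \<phi>_eq comp1_add J_add[OF p t] linear_on_tangent_add[OF \<omega>_linear[OF p] Jt]
    by (rule ext) (simp add: tpair_def algebra_simps)
  show "\<phi> z (a *\<^sub>t u) = a *\<^sub>t \<phi> z u"
    unfolding \<phi>_eq comp1_scale J_scale[OF p t(1)] linear_on_tangent_scale[OF \<omega>_linear[OF p] Jt(1)]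
    by (rule ext) (simp add: tpair_def algebra_simps)
qed (rule \<phi>_smooth)

lemma vector_field_pair:
  assumes "X \<in> \<chi> M1"
  shows "(\<lambda>z. pair z (X (fst z)) h) \<in> \<chi> P"
  by (rule vector_field_tpair[OF M1 N assms vector_field_scale[OF N T]])

lemma vector_field_\<xi>: "\<xi> \<in> \<chi> P"
proof -
  have "(\<lambda>p. 0\<^sub>t) \<in> \<chi> M1"
    using tangent_zero[OF M1] smooth_fun_const[OF M1] by (simp add: vector_fields_def smooth_vfield_on_def)
  from vector_field_pair[OF this, of 1] show ?thesis
    unfolding \<xi>_eq[abs_def] .
qed

text \<open>Both arguments of \<open>g1\<close> are fields along \<open>fst\<close>, so they are
  contracted one at a time: with a coordinate field in the first slot, the second falls under
  \<open>smooth_fun_contract_fst\<close>; afterwards the first slot is expanded.\<close>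

lemma g1_comp1_smooth:
  assumes U: "openin (mtop P) U" and X: "smooth_vfield_on P U X" and Y: "smooth_vfield_on P U Y"
  shows "smooth_fun P U (\<lambda>z. g1 (fst z) (comp1 z (X z)) (comp1 z (Y z)))"
proof (rule smooth_fun_local[OF P])
  have U': "openin (prod_topology (mtop M1) (mtop N)) U" using U by simp
  fix z assume z: "z \<in> U"
  then have zP: "fst z \<in> points M1" "snd z \<in> points N" using openin_subset[OF U] by auto
  obtain V c where V: "(V, c) \<in> atlas M1" "fst z \<in> V"
    using chart_exists[OF M1 zP(1)] .
  note Vo = chart_openin[OF M1 V(1)] and VM = chart_subset[OF M1 V(1)]
  let ?A = "U \<inter> (V \<times> points N)"
  have A: "openin (mtop P) ?A"
    using U Vo by (intro openin_Int) (simp_all add: openin_prod_Times_iff openin_C)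
  have at: "z \<in> points P" "X z \<in> tangent_space P z" "Y z \<in> tangent_space P z" "fst z \<in> V" if "z \<in> ?A" for z
    using that openin_subset[OF U] smooth_vfieldD(1)[OF P X] smooth_vfieldD(1)[OF P Y] by auto
  have Y_smooth: "smooth_fun P ?A (\<lambda>z. g1 (fst z) (coord_vec M1 V c b (fst z)) (comp1 z (Y z)))" for b
    unfolding comp_M_def
  proof (rule smooth_fun_contract_fst[OF M1 N U' Y V(1), of "\<lambda>p. g1 p (coord_vec M1 V c b p)"])
    show "linear_on_tangent M1 p (g1 p (coord_vec M1 V c b p))" if "p \<in> V" for p
      using VM that by (intro g1_linear2 coord_vec_tangent[OF M1 V(1)]) auto
    show "smooth_fun M1 V (\<lambda>p. g1 p (coord_vec M1 V c b p) (coord_vec M1 V c b' p))" for b'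
      by (rule g1_smooth[OF Vo smooth_vfield_coord_vec[OF M1 V(1)] smooth_vfield_coord_vec[OF M1 V(1)]])
  qed
  have X_smooth: "smooth_fun P ?A (\<lambda>z. X z (\<lambda>x. c (fst x) \<bullet> b))" for b
    by (rule smooth_vfieldD(2)[OF P X A Int_lower1
          smooth_fun_subset[OF smooth_fun_fst[OF M1 N Vo smooth_fun_coordinate[OF M1 V(1)]] Int_lower2]])
  have "smooth_fun P ?A (\<lambda>z. \<Sum>b\<in>Basis. X z (\<lambda>x. c (fst x) \<bullet> b) *
      g1 (fst z) (coord_vec M1 V c b (fst z)) (comp1 z (Y z)))"
    by (rule smooth_fun_sum[OF P A smooth_fun_mult[OF P A X_smooth Y_smooth]])
  then have "smooth_fun P ?A (\<lambda>z. g1 (fst z) (comp1 z (X z)) (comp1 z (Y z)))"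
  proof (rule smooth_fun_cong[OF P A, rotated])
    fix z assume z: "z \<in> ?A"
    note zP = at(1)[OF z]
    have "comp1 z (X z) (\<lambda>x. c x \<bullet> b) = X z (\<lambda>x. c (fst x) \<bullet> b)" for b
      using smooth_at_coordinate[OF M1 V(1) at(4)[OF z]] by (simp add: comp_M_def differential_def comp_def)
    then show "(\<Sum>b\<in>Basis. X z (\<lambda>x. c (fst x) \<bullet> b) * g1 (fst z) (coord_vec M1 V c b (fst z)) (comp1 z (Y z))) =
        g1 (fst z) (comp1 z (X z)) (comp1 z (Y z))"
      using linear_on_tangent_expansion[OF M1 V(1) at(4)[OF z]
          g1_linear[OF pointsD(1)[OF zP] comp1_tangent[OF zP at(3)[OF z]]] comp1_tangent[OF zP at(2)[OF z]]]
      by simp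
  qed
  then show "\<exists>W. openin (mtop P) W \<and> z \<in> W \<and> smooth_fun P W (\<lambda>z. g1 (fst z) (comp1 z (X z)) (comp1 z (Y z)))"
    using A z zP V(2) by (intro exI[of _ ?A]) (auto simp: mem_Times_iff)
qed

lemma riemannian_g: "riemannian_metric P g"
  unfolding riemannian_metric_def
proof (rule conjI, intro ballI allI)
  fix z u v w a assume z: "z \<in> points P" and u: "u \<in> tangent_space P z" and v: "v \<in> tangent_space P z"
    and w: "w \<in> tangent_space P z"
  note p = pointsD(1)[OF z]
  note t = comp1_tangent[OF z u] comp1_tangent[OF z v] comp1_tangent[OF z w]
  note lin = g1_linear[OF p t(3)]
  have add: "g z (u +\<^sub>t v) w = g z u w + g z v w"
    unfolding g_bar_def comp1_add linear_on_tangent_add[OF lin t(1,2)] linear_on_tangent_add[OF \<eta>_linear[OF z] u v]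
    by (simp add: algebra_simps)
  have scale: "g z (a *\<^sub>t u) w = a * g z u w"
    unfolding g_bar_def comp1_scale linear_on_tangent_scale[OF lin t(1)] linear_on_tangent_scale[OF \<eta>_linear[OF z] u]
    by (simp add: algebra_simps)
  have sym: "g z u v = g z v u"
    unfolding g_bar_def g1_sym[OF p t(1,2)] by simp
  have pos: "g z u u > 0" if "u \<noteq> 0\<^sub>t"
  \<comment> \<open>Either \<open>g1\<close> is already positive on the first component, or that
    component is 0. In the latter case \<open>\<eta> z u\<close> is just the coefficient of
    \<open>T\<close>, which cannot be 0 because \<open>u\<close> would then be the pair of
    zeros.\<close>
  proof (cases "comp1 z u = 0\<^sub>t")
    case False
    from g1_pos[OF p t(1) this] show ?thesis
      unfolding g_bar_def by (simp add: add_pos_nonneg)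
  next
    case True
    have "\<omega> (fst z) (0 *\<^sub>t 0\<^sub>t) = 0 * \<omega> (fst z) 0\<^sub>t" "g1 (fst z) (0 *\<^sub>t 0\<^sub>t) 0\<^sub>t = 0 * g1 (fst z) 0\<^sub>t 0\<^sub>t"
      by (rule linear_on_tangent_scale[OF \<omega>_linear[OF p] tangent_zero[OF M1]],
          rule linear_on_tangent_scale[OF g1_linear[OF p tangent_zero[OF M1]] tangent_zero[OF M1]])
    then have "g z u u = comp2 z u * comp2 z u"
      unfolding g_bar_def eta_bar_def True by simp
    moreover have "comp2 z u \<noteq> 0"
    proof
      assume "comp2 z u = 0"
      then have "u = pair z 0\<^sub>t 0"
        using pair_eq[OF z u] True by simp
      also have "\<dots> = 0\<^sub>t"
        by (rule ext) (simp add: tpair_def)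
      finally show False using that by simp
    qed
    ultimately show ?thesis by (metis not_real_square_gt_zero)
  qed
  show "g z (u +\<^sub>t v) w = g z u w + g z v w \<and> g z (a *\<^sub>t u) w = a * g z u w \<and>
      g z u v = g z v u \<and> (u \<noteq> 0\<^sub>t \<longrightarrow> g z u u > 0)"
    using add scale sym pos by blast
next
  show "\<forall>U X Y. openin (mtop P) U \<longrightarrow> smooth_vfield_on P U X \<longrightarrow> smooth_vfield_on P U Y \<longrightarrow>
      smooth_fun P U (\<lambda>z. g z (X z) (Y z))"
    unfolding g_bar_def
    by (intro allI impI smooth_fun_add[OF P] smooth_fun_mult[OF P] g1_comp1_smooth \<eta>_smooth)
qed

lemma almost_contact:
  assumes "even DIM('e)"
  shows "almost_contact_metric_manifold P \<phi> \<xi> \<eta> g"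
  unfolding almost_contact_metric_manifold_def
proof (intro conjI ballI)
  show "odd DIM('e \<times> real)" using assms by simp
  fix z u v assume z: "z \<in> points P" and u: "u \<in> tangent_space P z" and v: "v \<in> tangent_space P z"
  have "g z (\<phi> z u) (\<phi> z v) = g1 (fst z) (J (fst z) (comp1 z u)) (J (fst z) (comp1 z v))"
    unfolding g_\<phi>[OF z \<phi>_tangent[OF z u] v] comp1_\<phi>[OF z u] ..
  also have "\<dots> = g1 (fst z) (comp1 z u) (comp1 z v)"
    by (rule g1_J[OF pointsD(1)[OF z] comp1_tangent[OF z u] comp1_tangent[OF z v]])
  finally show "g z (\<phi> z u) (\<phi> z v) = g z u v - \<eta> z u * \<eta> z v"
    by (simp add: g_bar_def)
qed (rule P tensor_field_\<phi> vector_field_\<xi> one_form_\<eta> riemannian_g \<phi>_\<phi> \<eta>_\<xi>, (assumption+)?)+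

section \<open>The exterior derivative\<close>

lemma pair_apply_fst:
  assumes X: "X \<in> \<chi> M1" and z: "z \<in> points P" and f: "smooth_at M1 (fst z) f"
  shows "pair z (X (fst z)) a (\<lambda>x. f (fst x)) = X (fst z) f"
  by (rule tpair_apply_fst[OF M1 N z tangent_space_scale[OF N T_tangent[OF pointsD(2)[OF z]]] f])

lemma pair_apply_snd:
  assumes X: "X \<in> \<chi> M1" and z: "z \<in> points P" and f: "smooth_at N (snd z) f"
  shows "pair z (X (fst z)) a (\<lambda>x. f (snd x)) = a * T (snd z) f"
  by (rule tpair_apply_snd[OF M1 N z vector_fieldD(1)[OF M1 X pointsD(1)[OF z]] f])

lemma smooth_at_fst: "z \<in> points P \<Longrightarrow> smooth_at M1 (fst z) f \<Longrightarrow> smooth_at P z (\<lambda>x. f (fst x))"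
  using smooth_map_fst[OF M1 N] unfolding smooth_map_def by blast

lemma smooth_at_snd: "z \<in> points P \<Longrightarrow> smooth_at N (snd z) f \<Longrightarrow> smooth_at P z (\<lambda>x. f (snd x))"
  using smooth_map_snd[OF M1 N] unfolding smooth_map_def by blast

text \<open>The inner function is the pullback of \<open>Y f\<close> only over the set where
  \<open>f\<close> is smooth, hence the detour through \<open>tangent_cong\<close>. With its
  companion for \<open>snd\<close> it determines both components of a bracket.\<close>

lemma second_derivative_fst:
  assumes X: "X \<in> \<chi> M1" and Y: "Y \<in> \<chi> M1" and z: "z \<in> points P" and f: "smooth_at M1 (fst z) f"
  shows "pair z (X (fst z)) a (\<lambda>x. pair x (Y (fst x)) b (\<lambda>x. f (fst x))) = X (fst z) (\<lambda>p. Y p f)"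
proof -
  obtain U where U: "openin (mtop M1) U" "fst z \<in> U" "smooth_fun M1 U f"
    using f by (auto simp: smooth_at_def)
  note Yf = smooth_at_vector_field[OF M1 Y f]
  have "pair z (X (fst z)) a (\<lambda>x. Y (fst x) f) = pair z (X (fst z)) a (\<lambda>x. pair x (Y (fst x)) b (\<lambda>x. f (fst x)))"
  proof (rule tangent_cong[OF P vector_fieldD(1)[OF P vector_field_pair[OF X] z] smooth_at_fst[OF z Yf]])
    show "openin (mtop P) (U \<times> points N)"
      using U by (simp add: openin_prod_Times_iff openin_C)
    show "z \<in> U \<times> points N"
      using U(2) z by (auto simp: mem_Times_iff)
    fix x assume "x \<in> U \<times> points N"
    then have "x \<in> points P" "fst x \<in> U"
      using openin_subset[OF U(1)] by auto
    then show "Y (fst x) f = pair x (Y (fst x)) b (\<lambda>x. f (fst x))"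
      by (intro pair_apply_fst[OF Y, symmetric] smooth_atI[OF M1 U(1) _ U(3)])
  qed
  then show ?thesis
    unfolding pair_apply_fst[OF X z Yf] by simp
qed

text \<open>The value is symmetric under exchanging \<open>(X, a)\<close> and \<open>(Y, b)\<close>,
  which makes the T-component of the bracket vanish.\<close>

lemma second_derivative_snd:
  assumes X: "X \<in> \<chi> M1" and Y: "Y \<in> \<chi> M1" and z: "z \<in> points P" and f: "smooth_at N (snd z) f"
  shows "pair z (X (fst z)) a (\<lambda>x. pair x (Y (fst x)) b (\<lambda>x. f (snd x))) = a * b * T (snd z) (\<lambda>q. T q f)"
proof -
  obtain U where U: "openin (mtop N) U" "snd z \<in> U" "smooth_fun N U f"
    using f by (auto simp: smooth_at_def)
  note Tf = smooth_at_vector_field[OF N T f]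
  have "pair z (X (fst z)) a (\<lambda>x. b * T (snd x) f) = pair z (X (fst z)) a (\<lambda>x. pair x (Y (fst x)) b (\<lambda>x. f (snd x)))"
  proof (rule tangent_cong[OF P vector_fieldD(1)[OF P vector_field_pair[OF X] z]
          smooth_at_scale[OF P smooth_at_snd[OF z Tf]]])
    show "openin (mtop P) (points M1 \<times> U)"
      using U by (simp add: openin_prod_Times_iff openin_C)
    show "z \<in> points M1 \<times> U"
      using U(2) z by (auto simp: mem_Times_iff)
    fix x assume "x \<in> points M1 \<times> U"
    then have "x \<in> points P" "snd x \<in> U"
      using openin_subset[OF U(1)] by auto
    then show "b * T (snd x) f = pair x (Y (fst x)) b (\<lambda>x. f (snd x))"
      by (intro pair_apply_snd[OF Y, symmetric] smooth_atI[OF N U(1) _ U(3)])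
  qed
  moreover have "pair z (X (fst z)) a (\<lambda>x. b * T (snd x) f) = a * T (snd z) (\<lambda>q. b * T q f)"
    by (rule pair_apply_snd[OF X z smooth_at_scale[OF N Tf]])
  ultimately show ?thesis
    using tangent_scale[OF N T_tangent[OF pointsD(2)[OF z]] Tf, of b] by simp
qed

lemma ext_deriv_pair:
  assumes X: "X \<in> \<chi> M1" and Y: "Y \<in> \<chi> M1" and z: "z \<in> points P"
  shows "ext_deriv P \<eta> (\<lambda>x. pair x (X (fst x)) a) (\<lambda>x. pair x (Y (fst x)) b) z =
    \<alpha> * ext_deriv M1 \<omega> X Y (fst z)"
proof -
  note p = pointsD(1)[OF z]
  \<comment> \<open>On the product, \<open>\<eta>\<close> of the second field is the pullback of
    \<open>\<alpha> * \<omega> q (B q) + b\<close>. The derivation kills \<open>b\<close>, which is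
    what the constant coefficients are for.\<close>
  have first: "pair z (A (fst z)) a (\<lambda>x. \<eta> x (pair x (B (fst x)) b)) = \<alpha> * A (fst z) (\<lambda>q. \<omega> q (B q))"
    if A: "A \<in> \<chi> M1" and B: "B \<in> \<chi> M1" for A B a b
  proof -
    have "smooth_fun M1 (points M1) (\<lambda>q. \<omega> q (B q))"
      using \<omega> vector_fieldD(3)[OF M1 B subset_refl] openin_topspace unfolding one_form_def by blast
    then have \<omega>B: "smooth_at M1 (fst z) (\<lambda>q. \<omega> q (B q))"
      by (rule smooth_atI[OF M1 openin_topspace p])
    note F = smooth_at_add[OF M1 smooth_at_scale[OF M1 \<omega>B] smooth_at_const[OF M1 p], of \<alpha> b]
    note Ap = vector_fieldD(1)[OF M1 A p]
    have "pair z (A (fst z)) a (\<lambda>x. \<alpha> * \<omega> (fst x) (B (fst x)) + b) =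
        pair z (A (fst z)) a (\<lambda>x. \<eta> x (pair x (B (fst x)) b))"
      by (rule tangent_cong[OF P vector_fieldD(1)[OF P vector_field_pair[OF A] z] smooth_at_fst[OF z F]
            openin_topspace z])
        (rule \<eta>_pair[symmetric], assumption, rule vector_fieldD(1)[OF M1 B pointsD(1)])
    moreover have "pair z (A (fst z)) a (\<lambda>x. \<alpha> * \<omega> (fst x) (B (fst x)) + b) =
        A (fst z) (\<lambda>q. \<alpha> * \<omega> q (B q) + b)"
      by (rule pair_apply_fst[OF A z F])
    moreover have "A (fst z) (\<lambda>q. \<alpha> * \<omega> q (B q) + b) = \<alpha> * A (fst z) (\<lambda>q. \<omega> q (B q))"
      unfolding tangent_add[OF M1 Ap smooth_at_scale[OF M1 \<omega>B] smooth_at_const[OF M1 p]]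
        tangent_scale[OF M1 Ap \<omega>B] tangent_const[OF M1 Ap p] by simp
    ultimately show ?thesis by simp
  qed
  let ?L = "lie_bracket P (\<lambda>x. pair x (X (fst x)) a) (\<lambda>x. pair x (Y (fst x)) b) z"
  \<comment> \<open>The equality is tested on every \<open>f\<close>; where \<open>f\<close> is not
    smooth, both sides take the default value 0.\<close>
  have "comp1 z ?L = lie_bracket M1 X Y (fst z)"
  proof
    show "comp1 z ?L f = lie_bracket M1 X Y (fst z) f" for f
      using smooth_at_fst[OF z, of f] second_derivative_fst[OF X Y z, of f a b]
        second_derivative_fst[OF Y X z, of f b a]
      by (simp add: comp_M_def differential_def comp_def lie_bracket_def)
  qed
  moreover have "comp2 z ?L = 0"
  proof (rule comp2_eqI[OF z], rule ext)
    show "differential N snd z ?L f = 0 * T (snd z) f" for f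
      using smooth_at_snd[OF z, of f] second_derivative_snd[OF X Y z, of f a b]
        second_derivative_snd[OF Y X z, of f b a]
      by (simp add: differential_def comp_def lie_bracket_def)
  qed
  ultimately have "\<eta> z ?L = \<alpha> * \<omega> (fst z) (lie_bracket M1 X Y (fst z))"
    by (simp add: eta_bar_def)
  then show ?thesis
    unfolding ext_deriv_def first[OF X Y] first[OF Y X] by (simp add: algebra_simps)
qed

text \<open>By tensoriality a vector at \<open>z\<close> may be extended to a field \<open>(X\<^sub>1, h T)\<close> with \<open>h\<close> constant.\<close>

lemma ext_deriv_\<eta>:
  assumes X: "X \<in> \<chi> P" and Y: "Y \<in> \<chi> P" and z: "z \<in> points P"
    and d\<omega>: "\<forall>X\<in>\<chi> M1. \<forall>Y\<in>\<chi> M1. \<forall>p\<in>points M1. ext_deriv M1 \<omega> X Y p = fundamental_form J g1 p (X p) (Y p)"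
  shows "ext_deriv P \<eta> X Y z = \<alpha> * g z (X z) (\<phi> z (Y z))"
proof -
  note p = pointsD(1)[OF z]
  note Xz = vector_fieldD(1)[OF P X z] and Yz = vector_fieldD(1)[OF P Y z]
  obtain X1 where X1: "X1 \<in> \<chi> M1" "X1 (fst z) = comp1 z (X z)"
    using vector_field_extension[OF M1 p comp1_tangent[OF z Xz]] .
  obtain Y1 where Y1: "Y1 \<in> \<chi> M1" "Y1 (fst z) = comp1 z (Y z)"
    using vector_field_extension[OF M1 p comp1_tangent[OF z Yz]] .
  let ?X = "\<lambda>x. pair x (X1 (fst x)) (comp2 z (X z))" and ?Y = "\<lambda>x. pair x (Y1 (fst x)) (comp2 z (Y z))"
  have "ext_deriv P \<eta> X Y z = ext_deriv P \<eta> ?X ?Y z"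
  proof (rule ext_deriv_tensorial[OF P one_form_\<eta> X Y vector_field_pair[OF X1(1)] vector_field_pair[OF Y1(1)] z])
    show "X z = ?X z" unfolding X1(2) by (rule pair_eq[OF z Xz, symmetric])
    show "Y z = ?Y z" unfolding Y1(2) by (rule pair_eq[OF z Yz, symmetric])
  qed
  also have "\<dots> = \<alpha> * ext_deriv M1 \<omega> X1 Y1 (fst z)"
    by (rule ext_deriv_pair[OF X1(1) Y1(1) z])
  also have "ext_deriv M1 \<omega> X1 Y1 (fst z) = g z (X z) (\<phi> z (Y z))"
    using d\<omega> X1 Y1 p by (simp add: fundamental_form_def g_\<phi>[OF z Xz Yz])
  finally show ?thesis .
qed

text \<open>Without a nonzero value, \<open>\<alpha>\<close> could not be recovered. For
  \<open>u \<noteq> 0\<close> the form on \<open>u\<close>, \<open>J u\<close> is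
  \<open>g1(u, J (J u)) = - g1(u, u)\<close>; a coordinate vector of a chart serves as
  \<open>u\<close>, and fields with constant T-coefficient 0 realize the pair on the
  product.\<close>

lemma exists_nonzero_fundamental_form:
  obtains X Y z where "X \<in> \<chi> P" "Y \<in> \<chi> P" "z \<in> points P" "g z (X z) (\<phi> z (Y z)) \<noteq> 0"
proof -
  have "points M1 \<noteq> {}" "points N \<noteq> {}"
    using M1 N unfolding smooth_manifold_def by blast+
  then obtain p q where p: "p \<in> points M1" and q: "q \<in> C"
    unfolding points_curve_mfd by blast
  then have z: "(p, q) \<in> points P" by simp
  obtain V c where V: "(V, c) \<in> atlas M1" "p \<in> V"
    using chart_exists[OF M1 p] .
  obtain b :: 'e where b: "b \<in> Basis" using nonempty_Basis by blast
  let ?u = "coord_vec M1 V c b p"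
  have u: "?u \<in> tangent_space M1 p"
    by (rule coord_vec_tangent[OF M1 V])
  have "?u (\<lambda>x. c x \<bullet> b) = 1"
    using coord_vec_coordinate[OF M1 V, of b b] b by simp
  then have "?u \<noteq> 0\<^sub>t" by (auto dest: fun_cong)
  then have pos: "g1 p ?u ?u > 0"
    by (rule g1_pos[OF p u])
  obtain X where X: "X \<in> \<chi> M1" "X p = ?u"
    using vector_field_extension[OF M1 p u] .
  obtain Y where Y: "Y \<in> \<chi> M1" "Y p = J p ?u"
    using vector_field_extension[OF M1 p J_tangent[OF p u]] .
  let ?X = "\<lambda>x. pair x (X (fst x)) 0" and ?Y = "\<lambda>x. pair x (Y (fst x)) 0"
  have comp: "comp1 (p, q) (?X (p, q)) = ?u" "comp1 (p, q) (?Y (p, q)) = J p ?u"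
    using comp1_pair[OF z, of "X p" 0] comp1_pair[OF z, of "Y p" 0] u J_tangent[OF p u] X(2) Y(2) by simp_all
  have "g (p, q) (?X (p, q)) (\<phi> (p, q) (?Y (p, q))) =
      g1 (fst (p, q)) (comp1 (p, q) (?X (p, q))) (J (fst (p, q)) (comp1 (p, q) (?Y (p, q))))"
    by (rule g_\<phi>[OF z vector_fieldD(1)[OF P vector_field_pair[OF X(1)] z]
          vector_fieldD(1)[OF P vector_field_pair[OF Y(1)] z]])
  also have "\<dots> = g1 p ?u (J p (J p ?u))"
    unfolding comp by (simp only: fst_conv)
  also have "\<dots> = - g1 p ?u ?u"
    unfolding J_J[OF p u] using linear_on_tangent_scale[OF g1_linear2[OF p u] u, of "-1"] by simp
  finally have "g (p, q) (?X (p, q)) (\<phi> (p, q) (?Y (p, q))) \<noteq> 0"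
    using pos by simp
  then show thesis
    by (rule that[OF vector_field_pair[OF X(1)] vector_field_pair[OF Y(1)] z])
qed

end

theorem theorem3p3:
  fixes M1 :: "('a, 'e::euclidean_space) mfd"
    and J :: "'a \<Rightarrow> 'a tvec \<Rightarrow> 'a tvec"
    and g1 :: "'a \<Rightarrow> 'a tvec \<Rightarrow> 'a tvec \<Rightarrow> real"
    and \<omega> :: "'a \<Rightarrow> 'a tvec \<Rightarrow> real"
    and n :: nat
    and I :: "real set"
    and \<beta> :: "real \<Rightarrow> 'm::euclidean_space"
    and T :: "'m \<Rightarrow> 'm tvec"
    and \<alpha> :: real
  assumes "almost_hermitian_manifold M1 J g1"
    and "n \<ge> 1" and "DIM('e) = 2 * n"
    and "one_form M1 \<omega>"
    and "\<forall>X\<in>\<chi> M1. \<forall>Y\<in>\<chi> M1. \<forall>p\<in>points M1.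
           ext_deriv M1 \<omega> X Y p = fundamental_form J g1 p (X p) (Y p)"
    and "open_curve I \<beta>"
    and "unit_tangent_field (\<beta> ` I) T"
  shows "contact_metric_manifold (prod_mfd M1 (curve_mfd (\<beta> ` I)))
           (phi_bar M1 J \<omega> (\<beta> ` I) T \<alpha>) (xi_bar M1 (\<beta> ` I) T)
           (eta_bar M1 \<omega> (\<beta> ` I) T \<alpha>) (g_bar M1 g1 \<omega> (\<beta> ` I) T \<alpha>)
         \<longleftrightarrow> \<alpha> = 1"
proof -
  interpret curve_product M1 J g1 \<omega> "\<beta> ` I" T \<alpha>
  proof
    show "smooth_manifold (curve_mfd (\<beta> ` I))"
      using assms(6) by (intro smooth_manifold_curve) (auto simp: open_curve_def)
    show "T \<in> \<chi> (curve_mfd (\<beta> ` I))"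
      using assms(7) by (simp add: unit_tangent_field_def)
    \<comment> \<open>Unit length enters as nonvanishing: the zero derivation has ambient vector 0,
      whose norm is not 1.\<close>
    show "T q \<noteq> 0\<^sub>t" if "q \<in> \<beta> ` I" for q
    proof
      assume "T q = 0\<^sub>t"
      then have "ambient_vector (T q) = 0" by (simp add: ambient_vector_def)
      then show False
        using assms(7) that by (auto simp: unit_tangent_field_def)
    qed
  qed (rule assms)+
  \<comment> \<open>The almost contact part holds for every \<open>\<alpha>\<close>, with
    \<open>DIM('e) = 2 * n\<close> giving the parity. By \<open>ext_deriv_\<eta>\<close> the
    remaining condition compares a function with \<open>\<alpha>\<close> times itself, so one
    nonzero value decides it.\<close>
  have contact: "contact_metric_manifold P \<phi> \<xi> \<eta> g \<longleftrightarrow>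
      (\<forall>X\<in>\<chi> P. \<forall>Y\<in>\<chi> P. \<forall>z\<in>points P. \<alpha> * g z (X z) (\<phi> z (Y z)) = g z (X z) (\<phi> z (Y z)))"
    unfolding contact_metric_manifold_def
    using almost_contact assms(3) ext_deriv_\<eta>[OF _ _ _ assms(5)] by simp
  obtain X Y z where "X \<in> \<chi> P" "Y \<in> \<chi> P" "z \<in> points P" "g z (X z) (\<phi> z (Y z)) \<noteq> 0"
    by (rule exists_nonzero_fundamental_form)
  then have "\<alpha> = 1" if "contact_metric_manifold P \<phi> \<xi> \<eta> g"
    using that unfolding contact by force
  moreover have "contact_metric_manifold P \<phi> \<xi> \<eta> g" if "\<alpha> = 1"
    unfolding contact using that by simp
  ultimately show ?thesis by blast
qed

end
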